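(* Let $T>0$ and let $M=(M_r)_{r\in[0,T]}$ be a real-valued continuous Gaussian martingale with quadratic variation $\langle M\rangle_r=\mathbb{E}[M_r^2]$, $r\in[0,T]$, such that $\langle M\rangle_t>\langle M\rangle_s$ for all $0\le s<t\le T$. Let $h:\mathbb{R}\to\mathbb{R}$, $h(r)=r$. Assume that for all $0\le s<t\le T$ $$\frac{135}{88}[\langle M\rangle,h]_{s,t}^2\le(t-s)^2(\langle M\rangle_t-\langle M\rangle_s)^2 .$$ For $0\le s<t\le T$ define $\omega^{s,t}:[0,1]\to\mathbb{R}$ by $$\omega^{s,t}_r=\begin{cases}a(s,t)r,&r\in[0,\frac13],\\ b(s,t)r+b_0(s,t),&r\in[\frac13,\frac23],\\ c(s,t)r+c_0(s,t),&r\in[\frac23,1],\end{cases}$$ where, with $\kappa(s,t)=\sqrt{22}\sqrt{(t-s)^2(\langle M\rangle_t-\langle M\rangle_s)^2-\frac{135}{88}[\langle M\rangle,h]_{s,t}^2}$, $$a(s,t)=-\frac{\kappa(s,t)-\frac12[\langle M\rangle,h]_{s,t}-8I^{(1,0)}_{s,t}[\langle M\rangle]}{2(t-s)\sqrt{\langle M\rangle_t-\langle M\rangle_s}},\qquad b(s,t)=\frac{\kappa(s,t)+[\langle M\rangle,h]_{s,t}-2I^{(1,0)}_{s,t}[\langle M\rangle]}{(t-s)\sqrt{\langle M\rangle_t-\langle M\rangle_s}},$$ $$c(s,t)=-\frac{\kappa(s,t)+\frac{17}2[\langle M\rangle,h]_{s,t}-8I^{(1,0)}_{s,t}[\langle M\rangle]}{2(t-s)\sqrt{\langle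 M\rangle_t-\langle M\rangle_s}},$$ $$b_0(s,t)=-\frac{\kappa(s,t)+\frac12[\langle M\rangle,h]_{s,t}-4I^{(1,0)}_{s,t}[\langle M\rangle]}{2(t-s)\sqrt{\langle M\rangle_t-\langle M\rangle_s}},\qquad c_0(s,t)=\frac{\kappa(s,t)+\frac{13}2[\langle M\rangle,h]_{s,t}-4I^{(1,0)}_{s,t}[\langle M\rangle]}{2(t-s)\sqrt{\langle M\rangle_t-\langle M\rangle_s}}.$$ Let $(W^{s,t})_{0\le s<t\le T}$ be any family of random paths $W^{s,t}$ on $[s,t]$ with $$\mathbb{P}[W^{s,t}=\sqrt3\,\omega^{s,t}\circ\phi]=\tfrac16,\qquad\mathbb{P}[W^{s,t}=-\sqrt3\,\omega^{s,t}\circ\phi]=\tfrac16,\qquad\mathbb{P}[W^{s,t}\equiv0]=\tfrac23,$$ where $\phi:[s,t]\to[0,1]$, $\phi(r)=\frac{r-s}{t-s}$. Then for all $0\le s<t\le T$ $$\mathbb{E}\big[S^5_{s,t}[W^{s,t}]\big]=\mathbb{E}\big[S^5_{s,t}[\circ M]\big],$$ i.e. $\mathbb{E}[I^\alpha_{s,t}[W^{s,t}]]=\mathbb{E}[I^\alpha_{s,t}[\circ M]]$ for every word $\alpha\in\mathcal{A}_5$.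
   Context: Here $d=1$. For a word $\alpha=(\alpha_1,\dots,\alpha_k)$ with letters in $\{0,1\}$ put $\|\alpha\|=k+\#\{i\in\{1,\dots,k\}:\alpha_i=0\}$, $\|\emptyset\|=0$; $\mathcal{A}_5$ is the set of words (including $\emptyset$) with $\|\alpha\|\le5$. For a continuous real path $\omega$ of bounded variation, $I^\alpha_{s,t}[\omega]=\int_s^t\int_s^{t_k}\cdots\int_s^{t_2}d\omega^{\alpha_1}_{t_1}\cdots d\omega^{\alpha_k}_{t_k}$ with $\omega^1=\omega$, $\omega^0_r=r$, $I^\emptyset=1$; in particular $I^{(1,0)}_{s,t}[\langle M\rangle]=\int_s^t(\langle M\rangle_r-\langle M\rangle_s)\,dr$. For a continuous martingale $M$, $I^\alpha_{s,t}[\circ M]$ is the analogous iterated Stratonovich integral, with $M^1=M$, $M^0_r=r$. The truncated signatures are $S^5_{s,t}[\cdot]=\sum_{\alpha=(i_1,\dots,i_k)\in\mathcal{A}_5}I^\alpha_{s,t}[\cdot]\,e_{i_1}\otimes\dots\otimes e_{i_k}$ with $e_0,e_1$ the standard basis of $\mathbb{R}\oplus\mathbb{R}$. For continuous $f,g$ of bounded variation on $[0,T]$, $[f,g]_{s,t}:=\int_s^t\int_s^udf(r)\,dg(u)-\int_s^t\int_s^udg(r)\,df(u)$. *)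

theory Defs
  imports "HOL-Probability.Probability"
begin

section \<open>Words\<close>

text \<open>Words are lists over the letters 0 and 1; the letter 0 (time) counts twice.\<close>

definition word_weight :: "nat list \<Rightarrow> nat" where
  "word_weight \<alpha> = length \<alpha> + count_list \<alpha> 0"

definition words_upto :: "nat \<Rightarrow> nat list set" where
  "words_upto n = {\<alpha>. set \<alpha> \<subseteq> {0, 1} \<and> word_weight \<alpha> \<le> n}"


section \<open>Iterated integrals of paths\<close>

text \<open>
  Riemann--Stieltjes integral: tagged Riemann sums, with mesh tending to 0
  (a division that is fine for the constant-radius gauge).
\<close>

definition has_RS_integral ::
  "(real \<Rightarrow> real) \<Rightarrow> (real \<Rightarrow> real) \<Rightarrow> real \<Rightarrow> real \<Rightarrow> real \<Rightarrow> bool" where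
  "has_RS_integral f g a b I \<longleftrightarrow>
     (\<forall>\<epsilon>>0. \<exists>\<delta>>0. \<forall>p. p tagged_division_of {a..b} \<and> (\<lambda>x. ball x \<delta>) fine p \<longrightarrow>
        \<bar>(\<Sum>(x, K)\<in>p. f x * (g (Sup K) - g (Inf K))) - I\<bar> < \<epsilon>)"

definition RS_integral ::
  "(real \<Rightarrow> real) \<Rightarrow> (real \<Rightarrow> real) \<Rightarrow> real \<Rightarrow> real \<Rightarrow> real" where
  "RS_integral f g a b = (THE I. has_RS_integral f g a b I)"

definition letter_path :: "(real \<Rightarrow> real) \<Rightarrow> nat \<Rightarrow> real \<Rightarrow> real" where
  "letter_path x i = (if i = 0 then (\<lambda>r. r) else x)"

text \<open>
  The last letter of a word belongs to the outermost integral, so the recursion runs over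
  the reversed word.
\<close>

primrec iter_int_rev :: "(real \<Rightarrow> real) \<Rightarrow> real \<Rightarrow> nat list \<Rightarrow> real \<Rightarrow> real" where
  "iter_int_rev x s [] = (\<lambda>u. 1)"
| "iter_int_rev x s (i # w) =
     (\<lambda>u. RS_integral (iter_int_rev x s w) (letter_path x i) s u)"

definition iter_int :: "(real \<Rightarrow> real) \<Rightarrow> nat list \<Rightarrow> real \<Rightarrow> real \<Rightarrow> real" where
  "iter_int x \<alpha> s t = iter_int_rev x s (rev \<alpha>) t"

definition bracket :: "(real \<Rightarrow> real) \<Rightarrow> (real \<Rightarrow> real) \<Rightarrow> real \<Rightarrow> real \<Rightarrow> real" where
  "bracket f g s t =
     RS_integral (\<lambda>u. RS_integral (\<lambda>_. 1) f s u) g s t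
   - RS_integral (\<lambda>u. RS_integral (\<lambda>_. 1) g s u) f s t"


section \<open>Continuous Gaussian martingales\<close>

definition martingale_upto ::
  "'a measure \<Rightarrow> (real \<Rightarrow> 'a measure) \<Rightarrow> real \<Rightarrow> (real \<Rightarrow> 'a \<Rightarrow> real) \<Rightarrow> bool" where
  "martingale_upto P F T M \<longleftrightarrow>
     (\<forall>r\<in>{0..T}. subalgebra P (F r)) \<and>
     (\<forall>r\<in>{0..T}. \<forall>r'\<in>{r..T}. subalgebra (F r') (F r)) \<and>
     (\<forall>r\<in>{0..T}. M r \<in> borel_measurable (F r) \<and> integrable P (M r)) \<and>
     (\<forall>r\<in>{0..T}. \<forall>r'\<in>{r..T}. AE x in P. real_cond_exp P (F r) (M r') x = M r x)"

definition continuous_process_upto ::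
  "'a measure \<Rightarrow> real \<Rightarrow> (real \<Rightarrow> 'a \<Rightarrow> real) \<Rightarrow> bool" where
  "continuous_process_upto P T M \<longleftrightarrow> (AE x in P. continuous_on {0..T} (\<lambda>r. M r x))"

text \<open>Point masses count as (degenerate) Gaussian laws.\<close>

definition gaussian_rv :: "'a measure \<Rightarrow> ('a \<Rightarrow> real) \<Rightarrow> bool" where
  "gaussian_rv P X \<longleftrightarrow>
     (\<exists>m \<sigma>. 0 < \<sigma> \<and> distributed P lborel X (normal_density m \<sigma>)) \<or>
     (\<exists>m. AE x in P. X x = m)"

definition gaussian_process_upto ::
  "'a measure \<Rightarrow> real \<Rightarrow> (real \<Rightarrow> 'a \<Rightarrow> real) \<Rightarrow> bool" where
  "gaussian_process_upto P T M \<longleftrightarrow>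
     (\<forall>r\<in>{0..T}. M r \<in> borel_measurable P) \<and>
     (\<forall>R c. finite R \<and> R \<subseteq> {0..T} \<longrightarrow> gaussian_rv P (\<lambda>x. \<Sum>r\<in>R. c r * M r x))"

text \<open>
  Convergence in probability of sums over divisions of \<open>{s..u}\<close> as the mesh tends to 0.
\<close>

definition mesh_limit_in_prob ::
  "'a measure \<Rightarrow> real \<Rightarrow> real \<Rightarrow> (real set set \<Rightarrow> 'a \<Rightarrow> real) \<Rightarrow> ('a \<Rightarrow> real) \<Rightarrow> bool" where
  "mesh_limit_in_prob P s u S L \<longleftrightarrow>
     (\<forall>\<epsilon>>0. \<forall>\<eta>>0. \<exists>\<delta>>0. \<forall>D. D division_of {s..u} \<and> (\<forall>K\<in>D. Sup K - Inf K < \<delta>) \<longrightarrow>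
        measure P {x \<in> space P. \<epsilon> \<le> \<bar>S D x - L x\<bar>} < \<eta>)"

definition quadratic_variation_upto ::
  "'a measure \<Rightarrow> real \<Rightarrow> (real \<Rightarrow> 'a \<Rightarrow> real) \<Rightarrow> (real \<Rightarrow> 'a \<Rightarrow> real) \<Rightarrow> bool" where
  "quadratic_variation_upto P T M A \<longleftrightarrow>
     (\<forall>r\<in>{0..T}. A r \<in> borel_measurable P) \<and>
     continuous_process_upto P T A \<and>
     (\<forall>u\<in>{0..T}. mesh_limit_in_prob P 0 u (\<lambda>D x. \<Sum>K\<in>D. (M (Sup K) x - M (Inf K) x)\<^sup>2) (A u))"


section \<open>Iterated Stratonovich integrals\<close>

text \<open>
  The Stratonovich integral process of \<open>X\<close> against \<open>Z\<close> on \<open>[s, t]\<close>: a process with continuous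
  paths which at each time is the limit in probability of the trapezoidal sums, i.e. of the
  left-point (Ito) sums plus one half of the covariation sums.  Such a process is unique up to
  indistinguishability, and \<open>stratonovich\<close> selects a version of it.  When \<open>Z r x = r\<close>, the
  trapezoidal sums of a continuous process converge to its pathwise integral, so the letter 0
  needs no separate treatment.
\<close>

definition is_stratonovich ::
  "'a measure \<Rightarrow> real \<Rightarrow> real \<Rightarrow> (real \<Rightarrow> 'a \<Rightarrow> real) \<Rightarrow> (real \<Rightarrow> 'a \<Rightarrow> real)
     \<Rightarrow> (real \<Rightarrow> 'a \<Rightarrow> real) \<Rightarrow> bool" where
  "is_stratonovich P s t X Z Y \<longleftrightarrow>
     (\<forall>u\<in>{s..t}. Y u \<in> borel_measurable P) \<and>
     (\<forall>x\<in>space P. continuous_on {s..t} (\<lambda>u. Y u x)) \<and>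
     (\<forall>u\<in>{s..t}. mesh_limit_in_prob P s u
        (\<lambda>D x. \<Sum>K\<in>D. (X (Inf K) x + X (Sup K) x) / 2 * (Z (Sup K) x - Z (Inf K) x)) (Y u))"

definition stratonovich ::
  "'a measure \<Rightarrow> real \<Rightarrow> real \<Rightarrow> (real \<Rightarrow> 'a \<Rightarrow> real) \<Rightarrow> (real \<Rightarrow> 'a \<Rightarrow> real)
     \<Rightarrow> real \<Rightarrow> 'a \<Rightarrow> real" where
  "stratonovich P s t X Z = (SOME Y. is_stratonovich P s t X Z Y)"

definition letter_process :: "(real \<Rightarrow> 'a \<Rightarrow> real) \<Rightarrow> nat \<Rightarrow> real \<Rightarrow> 'a \<Rightarrow> real" where
  "letter_process M i = (if i = 0 then (\<lambda>r x. r) else M)"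

primrec iter_strat_rev ::
  "'a measure \<Rightarrow> (real \<Rightarrow> 'a \<Rightarrow> real) \<Rightarrow> real \<Rightarrow> real \<Rightarrow> nat list \<Rightarrow> real \<Rightarrow> 'a \<Rightarrow> real" where
  "iter_strat_rev P M s t [] = (\<lambda>u x. 1)"
| "iter_strat_rev P M s t (i # w) =
     stratonovich P s t (iter_strat_rev P M s t w) (letter_process M i)"

definition iter_strat ::
  "'a measure \<Rightarrow> (real \<Rightarrow> 'a \<Rightarrow> real) \<Rightarrow> nat list \<Rightarrow> real \<Rightarrow> real \<Rightarrow> 'a \<Rightarrow> real" where
  "iter_strat P M \<alpha> s t = iter_strat_rev P M s t (rev \<alpha>) t"


section \<open>The cubature path\<close>

text \<open>In the following, \<open>V\<close> is the (deterministic) quadratic variation.\<close>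

definition br :: "(real \<Rightarrow> real) \<Rightarrow> real \<Rightarrow> real \<Rightarrow> real" where
  "br V s t = bracket V (\<lambda>r. r) s t"

definition I10 :: "(real \<Rightarrow> real) \<Rightarrow> real \<Rightarrow> real \<Rightarrow> real" where
  "I10 V s t = iter_int V [1, 0] s t"

definition kappa :: "(real \<Rightarrow> real) \<Rightarrow> real \<Rightarrow> real \<Rightarrow> real" where
  "kappa V s t =
     sqrt 22 * sqrt ((t - s)\<^sup>2 * (V t - V s)\<^sup>2 - 135 / 88 * (br V s t)\<^sup>2)"

definition coeff_a :: "(real \<Rightarrow> real) \<Rightarrow> real \<Rightarrow> real \<Rightarrow> real" where
  "coeff_a V s t = - ((kappa V s t - 1/2 * br V s t - 8 * I10 V s t)
                      / (2 * (t - s) * sqrt (V t - V s)))"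

definition coeff_b :: "(real \<Rightarrow> real) \<Rightarrow> real \<Rightarrow> real \<Rightarrow> real" where
  "coeff_b V s t = (kappa V s t + br V s t - 2 * I10 V s t)
                   / ((t - s) * sqrt (V t - V s))"

definition coeff_c :: "(real \<Rightarrow> real) \<Rightarrow> real \<Rightarrow> real \<Rightarrow> real" where
  "coeff_c V s t = - ((kappa V s t + 17/2 * br V s t - 8 * I10 V s t)
                      / (2 * (t - s) * sqrt (V t - V s)))"

definition coeff_b0 :: "(real \<Rightarrow> real) \<Rightarrow> real \<Rightarrow> real \<Rightarrow> real" where
  "coeff_b0 V s t = - ((kappa V s t + 1/2 * br V s t - 4 * I10 V s t)
                       / (2 * (t - s) * sqrt (V t - V s)))"

definition coeff_c0 :: "(real \<Rightarrow> real) \<Rightarrow> real \<Rightarrow> real \<Rightarrow> real" where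
  "coeff_c0 V s t = (kappa V s t + 13/2 * br V s t - 4 * I10 V s t)
                    / (2 * (t - s) * sqrt (V t - V s))"

definition omega :: "(real \<Rightarrow> real) \<Rightarrow> real \<Rightarrow> real \<Rightarrow> real \<Rightarrow> real" where
  "omega V s t r =
     (if r \<le> 1/3 then coeff_a V s t * r
      else if r \<le> 2/3 then coeff_b V s t * r + coeff_b0 V s t
      else coeff_c V s t * r + coeff_c0 V s t)"

definition phi :: "real \<Rightarrow> real \<Rightarrow> real \<Rightarrow> real" where
  "phi s t r = (r - s) / (t - s)"

end

(*
  Stratonovich integrals obey ordinary calculus: an iterated integral of M over a word is the pathwise
  functional obtained by integrating each run of letters 1 to a power of an increment, which leaves only
  Lebesgue integrals in time.  For every continuous path n, the trapezoidal rule approximates the increments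
  of this functional up to an error o((v - u) + (n v - n u)^2).  For a Lipschitz path this yields the
  Riemann--Stieltjes integrals; for M, whose squared increments over a division have expected sum
  V u - V s, it yields the limits in probability that define the Stratonovich integrals.  Both sides of the
  claim thus become expectations of the same functionals.  Words with an odd number of letters 1 contribute
  0 by symmetry, and for the others Fubini and the Gaussian moments leave only V t - V s and the integral
  of V - V s.  Writing w for the path omega reparametrized to {s..t}, it remains to see that
  w t = sqrt (V t - V s), that w^2 has integral I10, and that w has integral I10 / sqrt (V t - V s); this
  is what the coefficients a, b, c and kappa are chosen for.
*)
theory Submission
  imports Defs
begin

section \<open>Riemann--Stieltjes integrals\<close>

text \<open>The three-point law of \<open>W\<close> has second moment 1 and fourth moment 3, like a
  standard normal variable, and its odd moments vanish. So only words with an even positive number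
  of letters 1 constrain \<open>w\<close>. Those without a letter 0 fix \<open>w t\<close> up to
  sign, \<open>[1,1,0]\<close> fixes the integral of the square, \<open>[1,0,1]\<close> then fixes
  the integral of \<open>w\<close>, and \<open>[0,1,1]\<close> follows. With three pieces of equal
  length these are three equations for three slopes. The last is quadratic; up to a factor,
  \<open>kappa\<close> is the root of its discriminant, which the bracket bound keeps nonnegative.

  Two obstacles shape the argument. Stratonovich integrals are an arbitrary choice, known only
  through limits in probability over all fine divisions, whereas the trapezoidal error is small path
  by path, with a modulus depending on the path, and sums of squared increments are controlled only
  in expectation. Moreover, paths of \<open>M\<close> are continuous only almost surely and
  \<open>W\<close> is prescribed on three events only; hence a modification of \<open>M\<close> and
  the completion of \<open>Q\<close>.\<close>

lemma has_RS_integral_unique: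
  assumes "a \<le> b" "has_RS_integral f g a b I" "has_RS_integral f g a b J"
  shows "I = J"
proof (rule ccontr)
  assume "I \<noteq> J"
  define e where "e = \<bar>I - J\<bar> / 2"
  have e: "e > 0" using \<open>I \<noteq> J\<close> by (simp add: e_def)
  obtain d1 where d1: "d1 > 0" "\<And>p. p tagged_division_of {a..b} \<Longrightarrow> (\<lambda>x. ball x d1) fine p \<Longrightarrow>
      \<bar>(\<Sum>(x, K)\<in>p. f x * (g (Sup K) - g (Inf K))) - I\<bar> < e"
    using assms(2)[unfolded has_RS_integral_def, rule_format, OF e] by blast
  obtain d2 where d2: "d2 > 0" "\<And>p. p tagged_division_of {a..b} \<Longrightarrow> (\<lambda>x. ball x d2) fine p \<Longrightarrow>
      \<bar>(\<Sum>(x, K)\<in>p. f x * (g (Sup K) - g (Inf K))) - J\<bar> < e"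
    using assms(3)[unfolded has_RS_integral_def, rule_format, OF e] by blast
  have "gauge (\<lambda>x::real. ball x (min d1 d2))" using d1 d2 by (intro gauge_ball) auto
  then obtain p where p: "p tagged_division_of {a..b}" "(\<lambda>x. ball x (min d1 d2)) fine p"
    using fine_division_exists_real by blast
  have "(\<lambda>x. ball x d1) fine p" "(\<lambda>x. ball x d2) fine p"
    using p(2) unfolding fine_def by fastforce+
  then have "\<bar>(\<Sum>(x, K)\<in>p. f x * (g (Sup K) - g (Inf K))) - I\<bar> < e"
    "\<bar>(\<Sum>(x, K)\<in>p. f x * (g (Sup K) - g (Inf K))) - J\<bar> < e"
    using d1(2)[OF p(1)] d2(2)[OF p(1)] by auto
  moreover have "\<bar>I - J\<bar> \<le> \<bar>S - I\<bar> + \<bar>S - J\<bar>" for S by simp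
  ultimately have "\<bar>I - J\<bar> < e + e" by (meson add_strict_mono le_less_trans)
  then show False by (simp add: e_def)
qed

lemma RS_integral_eq:
  assumes "a \<le> b" "has_RS_integral f g a b I"
  shows "RS_integral f g a b = I"
  unfolding RS_integral_def using assms has_RS_integral_unique by blast

text \<open>Tags and cell endpoints all lie in \<open>{a..b}\<close>. A random path prescribed only
  on \<open>{s..t}\<close> can therefore be exchanged for the explicit one, see
  \<open>iter_int_cong\<close>.\<close>

lemma has_RS_integral_cong:
  assumes "\<And>r. r \<in> {a..b} \<Longrightarrow> f r = f' r" "\<And>r. r \<in> {a..b} \<Longrightarrow> g r = g' r"
  shows "has_RS_integral f g a b I \<longleftrightarrow> has_RS_integral f' g' a b I"
proof -
  have "(\<Sum>(x, K)\<in>p. f x * (g (Sup K) - g (Inf K))) = (\<Sum>(x, K)\<in>p. f' x * (g' (Sup K) - g' (Inf K)))"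
    if p: "p tagged_division_of {a..b}" for p
  proof (rule sum.cong, simp, safe)
    fix x K assume xK: "(x, K) \<in> p"
    obtain c d where K: "K = cbox c d" using tagged_division_ofD(4)[OF p xK] by blast
    have "x \<in> K" "K \<subseteq> {a..b}" using tagged_division_ofD[OF p] xK by auto
    then have "c \<le> d" "x \<in> {a..b}" "c \<in> {a..b}" "d \<in> {a..b}" "Sup K = d" "Inf K = c"
      using K by auto
    then show "f x * (g (Sup K) - g (Inf K)) = f' x * (g' (Sup K) - g' (Inf K))"
      using assms by simp
  qed
  then have "(p tagged_division_of {a..b} \<and> (\<lambda>x. ball x d) fine p \<longrightarrow>
        \<bar>(\<Sum>(x, K)\<in>p. f x * (g (Sup K) - g (Inf K))) - I\<bar> < e) \<longleftrightarrow>
      (p tagged_division_of {a..b} \<and> (\<lambda>x. ball x d) fine p \<longrightarrow>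
        \<bar>(\<Sum>(x, K)\<in>p. f' x * (g' (Sup K) - g' (Inf K))) - I\<bar> < e)" for p d e
    by simp
  then show ?thesis unfolding has_RS_integral_def by (simp only:)
qed

lemma RS_integral_cong:
  assumes "\<And>r. r \<in> {a..b} \<Longrightarrow> f r = f' r" "\<And>r. r \<in> {a..b} \<Longrightarrow> g r = g' r"
  shows "RS_integral f g a b = RS_integral f' g' a b"
  unfolding RS_integral_def using has_RS_integral_cong[where f=f and g=g and f'=f' and g'=g' and a=a and b=b, OF assms] by presburger

text \<open>Telescoping \<open>h\<close> over a division leaves the sum of the local errors, and
  telescoping the monotone control \<open>m\<close> bounds that sum. The control is 0 for the
  integrand 1, the identity for Lipschitz paths, and \<open>r + V r\<close> for the integrand
  \<open>u - s\<close> against \<open>V\<close>.\<close>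

lemma has_RS_integralI:
  assumes ab: "a \<le> b" and mono: "mono_on {a..b} m"
    and err: "\<And>e. e > 0 \<Longrightarrow> \<exists>d>0. \<forall>u v r. a \<le> u \<and> u \<le> r \<and> r \<le> v \<and> v \<le> b \<and> v - u < d \<longrightarrow>
       \<bar>h v - h u - f r * (g v - g u)\<bar> \<le> e * (m v - m u)"
  shows "has_RS_integral f g a b (h b - h a)"
  unfolding has_RS_integral_def
proof (intro allI impI)
  fix e :: real assume e: "e > 0"
  have m: "0 \<le> m b - m a" using mono ab by (auto simp: mono_on_def)
  \<comment> \<open>The summand 1 covers a control without growth, and the factor 2 leaves a strict
    inequality at the end.\<close>
  define e' where "e' = e / (2 * (m b - m a + 1))"
  have e': "e' > 0" using e m by (simp add: e'_def)
  obtain d where d: "d > 0" "\<And>u v r. a \<le> u \<Longrightarrow> u \<le> r \<Longrightarrow> r \<le> v \<Longrightarrow> v \<le> b \<Longrightarrow> v - u < d \<Longrightarrow>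
       \<bar>h v - h u - f r * (g v - g u)\<bar> \<le> e' * (m v - m u)"
    using err[OF e'] by blast
  show "\<exists>d>0. \<forall>p. p tagged_division_of {a..b} \<and> (\<lambda>x. ball x d) fine p \<longrightarrow>
     \<bar>(\<Sum>(x, K)\<in>p. f x * (g (Sup K) - g (Inf K))) - (h b - h a)\<bar> < e"
  \<comment> \<open>A cell inside the ball of radius \<open>d/2\<close> around its tag is shorter
    than \<open>d\<close>.\<close>
  proof (intro exI[of _ "d/2"] conjI allI impI)
    show "d / 2 > 0" using d by simp
    fix p assume "p tagged_division_of {a..b} \<and> (\<lambda>x. ball x (d/2)) fine p"
    then have p: "p tagged_division_of {a..b}" and fine: "(\<lambda>x. ball x (d/2)) fine p" by auto
    have "\<bar>(\<Sum>(x, K)\<in>p. f x * (g (Sup K) - g (Inf K))) - (h b - h a)\<bar>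
        = \<bar>\<Sum>(x, K)\<in>p. (h (Sup K) - h (Inf K)) - f x * (g (Sup K) - g (Inf K))\<bar>"
      unfolding additive_tagged_division_1[OF ab p, of h, symmetric]
      unfolding split_def sum_subtractf by (simp add: abs_minus_commute)
    also have "\<dots> \<le> (\<Sum>(x, K)\<in>p. \<bar>(h (Sup K) - h (Inf K)) - f x * (g (Sup K) - g (Inf K))\<bar>)"
      by (simp add: split_def sum_abs)
    also have "\<dots> \<le> (\<Sum>(x, K)\<in>p. e' * (m (Sup K) - m (Inf K)))"
    proof (rule sum_mono, safe)
      fix x K assume xK: "(x, K) \<in> p"
      obtain c c' where K: "K = cbox c c'" using tagged_division_ofD(4)[OF p xK] by blast
      have "x \<in> K" "K \<subseteq> {a..b}" using tagged_division_ofD[OF p] xK by auto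
      then have *: "c \<le> x" "x \<le> c'" "a \<le> c" "c' \<le> b" "Sup K = c'" "Inf K = c"
        using K by auto
      have "K \<subseteq> ball x (d/2)" using fine xK by (auto simp: fine_def)
      moreover have "c \<in> K" "c' \<in> K" using K * by auto
      ultimately have "c \<in> ball x (d/2)" "c' \<in> ball x (d/2)" by blast+
      then have "c' - c < d" unfolding mem_ball dist_real_def by linarith
      then show "\<bar>(h (Sup K) - h (Inf K)) - f x * (g (Sup K) - g (Inf K))\<bar> \<le> e' * (m (Sup K) - m (Inf K))"
        using d(2)[of c x c'] * by simp
    qed
    also have "\<dots> = e' * (m b - m a)"
      unfolding additive_tagged_division_1[OF ab p, of m, symmetric]
      by (simp add: split_def sum_distrib_left)
    also have "\<dots> < e"
    proof -
      have "e' * (m b - m a) \<le> e' * (m b - m a + 1)" using e' by simp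
      also have "\<dots> = e / 2" unfolding e'_def using m by (simp add: field_simps)
      finally show ?thesis using e by linarith
    qed
    finally show "\<bar>(\<Sum>(x, K)\<in>p. f x * (g (Sup K) - g (Inf K))) - (h b - h a)\<bar> < e" .
  qed
qed

lemma RS_integral_one:
  assumes "a \<le> b" shows "RS_integral (\<lambda>_. 1) g a b = g b - g a"
  by (rule RS_integral_eq[OF assms has_RS_integralI[OF assms, where m = "\<lambda>_. 0"]])
    (auto simp: mono_on_def intro!: exI[of _ 1])

section \<open>Pathwise trapezoidal calculus\<close>

text \<open>
  The error bound is summable to a small quantity over fine divisions both for Lipschitz \<open>n\<close> and, in
  probability, for paths of a process with \<open>L\<^sup>2\<close>-orthogonal increments.
\<close>

definition trapezoid ::
  "(real \<Rightarrow> real) \<Rightarrow> real \<Rightarrow> real \<Rightarrow> (real \<Rightarrow> real) \<Rightarrow> (real \<Rightarrow> real) \<Rightarrow> (real \<Rightarrow> real) \<Rightarrow> bool" where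
  "trapezoid n s t f g h \<longleftrightarrow>
     (\<forall>e>0. \<exists>d>0. \<forall>u v. s \<le> u \<and> u \<le> v \<and> v \<le> t \<and> v - u < d \<longrightarrow>
        \<bar>h v - h u - (f u + f v) / 2 * (g v - g u)\<bar> \<le> e * ((v - u) + (n v - n u)\<^sup>2))"

lemma uniform_modulus:
  fixes f :: "real \<Rightarrow> real"
  assumes "continuous_on {s..t} f" "e > 0"
  obtains d where "d > 0" "\<And>u v. u \<in> {s..t} \<Longrightarrow> v \<in> {s..t} \<Longrightarrow> \<bar>v - u\<bar> < d \<Longrightarrow> \<bar>f v - f u\<bar> \<le> e"
proof -
  have "uniformly_continuous_on {s..t} f"
    using assms compact_uniformly_continuous by blast
  then obtain d where "d > 0" "\<And>u v. u \<in> {s..t} \<Longrightarrow> v \<in> {s..t} \<Longrightarrow> dist v u < d \<Longrightarrow> dist (f v) (f u) < e"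
    using assms(2) unfolding uniformly_continuous_on_def by metis
  then show ?thesis by (intro that[of d]) (auto simp: dist_real_def less_imp_le)
qed

lemma continuous_bounded:
  fixes f :: "real \<Rightarrow> real"
  assumes "continuous_on {s..t} f"
  obtains B where "B \<ge> 1" "\<And>u. u \<in> {s..t} \<Longrightarrow> \<bar>f u\<bar> \<le> B"
proof -
  have "bounded (f ` {s..t})" using assms compact_continuous_image compact_imp_bounded by blast
  then obtain B where "\<forall>u\<in>{s..t}. \<bar>f u\<bar> \<le> B" by (auto simp: bounded_iff)
  then show ?thesis by (intro that[of "max 1 B"]) (auto simp: le_max_iff_disj)
qed

lemma abs_integral_le:
  fixes f :: "real \<Rightarrow> real"
  assumes "u \<le> v" "continuous_on {u..v} f" "\<And>r. r \<in> {u..v} \<Longrightarrow> \<bar>f r\<bar> \<le> B"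
  shows "\<bar>integral {u..v} f\<bar> \<le> B * (v - u)"
  using integral_bound[of u v f B] assms by auto

text \<open>On a short cell \<open>f\<close> stays within \<open>e\<close> of the mean of its
  endpoint values, so the time part of the error bound alone suffices.\<close>

lemma trapezoid_time:
  assumes f: "continuous_on {s..t} f"
  shows "trapezoid n s t f (\<lambda>r. r) (\<lambda>u. integral {s..u} f)"
  unfolding trapezoid_def
proof (intro allI impI)
  fix e :: real assume "e > 0"
  then obtain d where d: "d > 0" "\<And>u v. u \<in> {s..t} \<Longrightarrow> v \<in> {s..t} \<Longrightarrow> \<bar>v - u\<bar> < d \<Longrightarrow> \<bar>f v - f u\<bar> \<le> e"
    using uniform_modulus[OF f] by blast
  show "\<exists>d>0. \<forall>u v. s \<le> u \<and> u \<le> v \<and> v \<le> t \<and> v - u < d \<longrightarrow>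
      \<bar>integral {s..v} f - integral {s..u} f - (f u + f v) / 2 * (v - u)\<bar> \<le> e * ((v - u) + (n v - n u)\<^sup>2)"
  proof (intro exI[of _ d] conjI allI impI)
    fix u v assume *: "s \<le> u \<and> u \<le> v \<and> v \<le> t \<and> v - u < d"
    have cont: "continuous_on {u..v} f" using * by (intro continuous_on_subset[OF f]) auto
    have "integral {s..u} f + integral {u..v} f = integral {s..v} f"
      using * by (intro Henstock_Kurzweil_Integration.integral_combine integrable_continuous_real
          continuous_on_subset[OF f]) auto
    moreover have "integral {u..v} (\<lambda>r. f r - (f u + f v) / 2) = integral {u..v} f - (f u + f v) / 2 * (v - u)"
      using * integrable_continuous_real[OF cont] by (subst integral_diff) auto
    moreover have "\<bar>integral {u..v} (\<lambda>r. f r - (f u + f v) / 2)\<bar> \<le> e * (v - u)"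
    proof (rule abs_integral_le)
      fix r assume r: "r \<in> {u..v}"
      have "\<bar>f r - f u\<bar> \<le> e" "\<bar>f r - f v\<bar> \<le> e" using d(2)[of u r] d(2)[of v r] r * by auto
      then show "\<bar>f r - (f u + f v) / 2\<bar> \<le> e" unfolding abs_le_iff by (simp add: field_simps)
    qed (use * cont in \<open>auto intro: continuous_on_diff\<close>)
    ultimately have "\<bar>integral {s..v} f - integral {s..u} f - (f u + f v) / 2 * (v - u)\<bar> \<le> e * (v - u)"
      by linarith
    also have "\<dots> \<le> e * ((v - u) + (n v - n u)\<^sup>2)"
      using \<open>e > 0\<close> by (intro mult_left_mono) auto
    finally show "\<bar>integral {s..v} f - integral {s..u} f - (f u + f v) / 2 * (v - u)\<bar>
        \<le> e * ((v - u) + (n v - n u)\<^sup>2)" .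
  qed (rule d(1))
qed

lemma abs_power_diff_le:
  fixes a b B :: real
  assumes "\<bar>a\<bar> \<le> B" "\<bar>b\<bar> \<le> B" "1 \<le> B"
  shows "\<bar>a ^ i - b ^ i\<bar> \<le> \<bar>a - b\<bar> * (i * B ^ i)"
proof -
  have "a ^ i - b ^ i = (a - b) * (\<Sum>j<i. b ^ (i - Suc j) * a ^ j)"
    by (rule power_diff_sumr2)
  moreover have "\<bar>\<Sum>j<i. b ^ (i - Suc j) * a ^ j\<bar> \<le> (\<Sum>j<i. B ^ i)"
  proof (rule order_trans[OF sum_abs sum_mono])
    fix j assume "j \<in> {..<i}"
    then have "\<bar>b ^ (i - Suc j) * a ^ j\<bar> \<le> B ^ (i - Suc j) * B ^ j"
      using assms by (auto simp: abs_mult power_abs intro!: mult_mono power_mono)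
    also have "\<dots> = B ^ (i - 1)" using \<open>j \<in> _\<close> by (simp add: power_add[symmetric])
    also have "\<dots> \<le> B ^ i" using assms by (intro power_increasing) auto
    finally show "\<bar>b ^ (i - Suc j) * a ^ j\<bar> \<le> B ^ i" .
  qed
  ultimately show ?thesis by (simp add: abs_mult mult_left_mono)
qed

text \<open>Pairing the summands \<open>a\<^sup>i b\<^sup>k\<^sup>-\<^sup>i\<close> and \<open>a\<^sup>k\<^sup>-\<^sup>i b\<^sup>i\<close> exhibits the error as a sum of products of differences.\<close>

lemma trapezoid_power:
  fixes a b B :: real
  assumes "\<bar>a\<bar> \<le> B" "\<bar>b\<bar> \<le> B" "1 \<le> B"
  shows "\<bar>b ^ Suc k / fact (Suc k) - a ^ Suc k / fact (Suc k) - (a ^ k / fact k + b ^ k / fact k) / 2 * (b - a)\<bar>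
    \<le> (Suc k * (k * B ^ k)\<^sup>2) * \<bar>b - a\<bar> * (b - a)\<^sup>2"
proof -
  define D where "D = (\<Sum>i\<le>k. (a ^ i - b ^ i) * (a ^ (k - i) - b ^ (k - i)))"
  define S where "S = (\<Sum>i\<le>k. a ^ i * b ^ (k - i))"
  have refl: "(\<Sum>i\<le>k. a ^ (k - i) * b ^ i) = S"
    unfolding S_def by (rule sum.reindex_bij_witness[of _ "\<lambda>i. k - i" "\<lambda>i. k - i"]) auto
  have "D = (\<Sum>i\<le>k. a ^ k + b ^ k - a ^ i * b ^ (k - i) - a ^ (k - i) * b ^ i)"
    unfolding D_def by (intro sum.cong) (auto simp: algebra_simps power_add[symmetric])
  with refl have D: "D = Suc k * (a ^ k + b ^ k) - 2 * S"
    by (simp add: sum_subtractf sum.distrib S_def distrib_left)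
  have S: "b ^ Suc k - a ^ Suc k = (b - a) * S"
    using power_diff_sumr2[of b "Suc k" a] refl by (simp add: lessThan_Suc_atMost del: power_Suc)
  have frac: "y / (c * q) - x / (c * q) - (p / q + r / q) / 2 * z = (y - x - c * (p + r) / 2 * z) / (c * q)"
    if "c > 0" "q > 0" for c p q r x y z :: real
    using that by (simp add: field_simps)
  have alg: "(b - a) * S - c * (p + r) / 2 * (b - a) = - (b - a) * (c * (p + r) - 2 * S) / 2" for c p r
    by (simp add: field_simps)
  have "b ^ Suc k / fact (Suc k) - a ^ Suc k / fact (Suc k) - (a ^ k / fact k + b ^ k / fact k) / 2 * (b - a)
     = ((b ^ Suc k - a ^ Suc k) - Suc k * (a ^ k + b ^ k) / 2 * (b - a)) / fact (Suc k)"
    unfolding fact_Suc by (rule frac) auto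
  also have "\<dots> = (- (b - a) * D / 2) / fact (Suc k)"
    unfolding S D alg ..
  finally have eq: "\<bar>b ^ Suc k / fact (Suc k) - a ^ Suc k / fact (Suc k) - (a ^ k / fact k + b ^ k / fact k) / 2 * (b - a)\<bar>
     = \<bar>b - a\<bar> * \<bar>D\<bar> / (2 * fact (Suc k))" by (simp add: abs_mult abs_minus_commute del: fact_Suc)
  \<comment> \<open>Each of the two differences in a summand of \<open>D\<close> yields a factor
    \<open>\<bar>b - a\<bar>\<close>; with the outer \<open>b - a\<close> the error is of third
    order.\<close>
  have "\<bar>D\<bar> \<le> (\<Sum>i\<le>k. \<bar>b - a\<bar> * (k * B ^ k) * (\<bar>b - a\<bar> * (k * B ^ k)))"
    unfolding D_def
  proof (rule order_trans[OF sum_abs sum_mono])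
    fix i assume "i \<in> {..k}"
    have *: "\<bar>a ^ j - b ^ j\<bar> \<le> \<bar>b - a\<bar> * (k * B ^ k)" if "j \<le> k" for j
    proof -
      have "real j * B ^ j \<le> k * B ^ k"
        using that assms by (intro mult_mono power_increasing) auto
      then show ?thesis
        using abs_power_diff_le[OF assms, of j]
        by (smt (verit) abs_minus_commute mult_left_mono abs_ge_zero)
    qed
    show "\<bar>(a ^ i - b ^ i) * (a ^ (k - i) - b ^ (k - i))\<bar> \<le> \<bar>b - a\<bar> * (k * B ^ k) * (\<bar>b - a\<bar> * (k * B ^ k))"
      unfolding abs_mult using *[of i] *[of "k - i"] \<open>i \<in> _\<close> assms by (intro mult_mono) auto
  qed
  also have "\<dots> = (Suc k * (k * B ^ k)\<^sup>2) * (b - a)\<^sup>2"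
    using abs_mult_self_eq[of "b-a"] by (simp add: power2_eq_square mult_ac)
  finally have D: "\<bar>D\<bar> \<le> (Suc k * (k * B ^ k)\<^sup>2) * (b - a)\<^sup>2" .
  have "\<bar>b - a\<bar> * \<bar>D\<bar> / (2 * fact (Suc k)) \<le> \<bar>b - a\<bar> * \<bar>D\<bar> / 1"
    using fact_ge_1[of "Suc k", where 'a=real] by (intro divide_left_mono) auto
  also have "\<dots> \<le> \<bar>b - a\<bar> * ((Suc k * (k * B ^ k)\<^sup>2) * (b - a)\<^sup>2)"
    using D by (simp add: mult_left_mono)
  finally show ?thesis unfolding eq by (simp add: algebra_simps)
qed

section \<open>Iterated integrals as pathwise functionals\<close>

text \<open>
  \<open>jint n s w k u\<close> is the iterated integral over \<open>{s..u}\<close> of the word whose reversal consists of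
  \<open>k\<close> letters 1 followed by \<open>w\<close>.  A maximal run of \<open>k\<close> outermost letters 1 integrates to \<open>(n u - n r) ^ k / fact k\<close>, so only
  the letters 0 leave an integral and no derivative or stochastic integral of \<open>n\<close> is needed.
\<close>

primrec jint :: "(real \<Rightarrow> real) \<Rightarrow> real \<Rightarrow> nat list \<Rightarrow> nat \<Rightarrow> real \<Rightarrow> real" where
  "jint n s [] k u = (n u - n s) ^ k / fact k"
| "jint n s (i # w) k u =
     (if i = 0 then integral {s..u} (\<lambda>r. jint n s w 0 r * ((n u - n r) ^ k / fact k))
      else jint n s w (Suc k) u)"

text \<open>Either the run reaches the start of the word and gives a positive power of
  \<open>n s - n s\<close>, or it meets a letter 0 and gives an integral over \<open>{s..s}\<close>.
  A telescoped increment \<open>h u - h s\<close> is thus \<open>h u\<close> itself.\<close>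

lemma jint_Suc_start [simp]: "jint n s w (Suc k) s = 0"
  by (induction w arbitrary: k) auto

text \<open>\<open>u\<close> occurs both as a limit of integration and in the integrand. Expanding
  the power binomially separates \<open>n u\<close> from \<open>n r\<close> and leaves finitely many
  indefinite integrals with continuous coefficients.\<close>

lemma continuous_on_integral_power:
  fixes f n :: "real \<Rightarrow> real"
  assumes f: "continuous_on {s..t} f" and n: "continuous_on {s..t} n"
  shows "continuous_on {s..t} (\<lambda>u. integral {s..u} (\<lambda>r. f r * ((n u - n r) ^ k / fact k)))"
proof -
  define c where "c i r = f r * (- n r) ^ (k - i) * (of_nat (k choose i) / fact k)" for i r
  have c: "continuous_on {s..t} (c i)" for i
    unfolding c_def using f n by (intro continuous_intros)
  have eq: "integral {s..u} (\<lambda>r. f r * ((n u - n r) ^ k / fact k)) = (\<Sum>i\<le>k. n u ^ i * integral {s..u} (c i))"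
    if u: "u \<in> {s..t}" for u
  proof -
    have "(\<lambda>r. f r * ((n u - n r) ^ k / fact k)) = (\<lambda>r. \<Sum>i\<le>k. n u ^ i * c i r)"
    proof
      fix r
      have "(n u - n r) ^ k = (\<Sum>i\<le>k. of_nat (k choose i) * n u ^ i * (- n r) ^ (k - i))"
        using binomial_ring[of "n u" "- n r" k] by simp
      then show "f r * ((n u - n r) ^ k / fact k) = (\<Sum>i\<le>k. n u ^ i * c i r)"
        by (simp add: c_def sum_distrib_left sum_divide_distrib mult_ac)
    qed
    moreover have "c i integrable_on {s..u}" for i
      using u by (intro integrable_continuous_real continuous_on_subset[OF c]) auto
    ultimately show ?thesis
      by (simp only: integral_sum integrable_on_mult_right finite_atMost integral_mult_right)
  qed
  have "continuous_on {s..t} (\<lambda>u. \<Sum>i\<le>k. n u ^ i * integral {s..u} (c i))"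
    using n c by (intro continuous_intros indefinite_integral_continuous_1 integrable_continuous_real)
  then show ?thesis by (rule continuous_on_eq) (rule eq[symmetric])
qed

lemma continuous_on_jint:
  assumes "continuous_on {s..t} n"
  shows "continuous_on {s..t} (jint n s w k)"
proof (induction w arbitrary: k)
  case Nil
  show ?case using assms by (auto intro!: continuous_intros)
next
  case (Cons i w)
  show ?case
    using continuous_on_integral_power[OF Cons[of 0] assms, of k] Cons[of "Suc k"]
    by (cases "i = 0") simp_all
qed

text \<open>By \<open>trapezoid_power\<close> the error is at most a constant times
  \<open>\<bar>n v - n u\<bar>\<close> times the squared increment; uniform continuity of
  \<open>n\<close> makes the product of the first two factors at most \<open>e\<close>.\<close>

lemma trapezoid_run_Nil:
  assumes n: "continuous_on {s..t} n"
  shows "trapezoid n s t (jint n s [] k) n (jint n s [] (Suc k))"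
  unfolding trapezoid_def
proof (intro allI impI)
  fix e :: real assume e: "e > 0"
  have "continuous_on {s..t} (\<lambda>u. n u - n s)" using n by (intro continuous_intros)
  then obtain B where B: "B \<ge> 1" "\<And>u. u \<in> {s..t} \<Longrightarrow> \<bar>n u - n s\<bar> \<le> B"
    using continuous_bounded by blast
  \<comment> \<open>The added 1 keeps \<open>C\<close> positive when \<open>k = 0\<close>, where the
    other term vanishes.\<close>
  define C where "C = Suc k * (k * B ^ k)\<^sup>2 + 1"
  have C: "C > 0" by (simp add: C_def add_nonneg_pos)
  obtain d where d: "d > 0" "\<And>u v. u \<in> {s..t} \<Longrightarrow> v \<in> {s..t} \<Longrightarrow> \<bar>v - u\<bar> < d \<Longrightarrow> \<bar>n v - n u\<bar> \<le> e / C"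
    using uniform_modulus[OF n, of "e / C"] e C by auto
  show "\<exists>d>0. \<forall>u v. s \<le> u \<and> u \<le> v \<and> v \<le> t \<and> v - u < d \<longrightarrow>
    \<bar>jint n s [] (Suc k) v - jint n s [] (Suc k) u - (jint n s [] k u + jint n s [] k v) / 2 * (n v - n u)\<bar>
      \<le> e * ((v - u) + (n v - n u)\<^sup>2)"
  proof (intro exI[of _ d] conjI allI impI)
    fix u v assume *: "s \<le> u \<and> u \<le> v \<and> v \<le> t \<and> v - u < d"
    have "\<bar>jint n s [] (Suc k) v - jint n s [] (Suc k) u - (jint n s [] k u + jint n s [] k v) / 2 * (n v - n u)\<bar>
       \<le> (Suc k * (k * B ^ k)\<^sup>2) * \<bar>n v - n u\<bar> * (n v - n u)\<^sup>2"
      using trapezoid_power[of "n u - n s" B "n v - n s" k] B * by (simp del: power_Suc fact_Suc)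
    also have "\<dots> \<le> (C * (e / C)) * (n v - n u)\<^sup>2"
      using d(2)[of u v] * C by (intro mult_right_mono mult_mono) (auto simp: C_def)
    also have "\<dots> \<le> e * ((v - u) + (n v - n u)\<^sup>2)"
      using e C * by (simp add: mult_left_mono)
    finally show "\<bar>jint n s [] (Suc k) v - jint n s [] (Suc k) u - (jint n s [] k u + jint n s [] k v) / 2 * (n v - n u)\<bar>
      \<le> e * ((v - u) + (n v - n u)\<^sup>2)" .
  qed (rule d(1))
qed

text \<open>Cut \<open>{s..v}\<close> at \<open>u\<close>. On \<open>{s..u}\<close>
  (\<open>E1\<close>) the estimate for powers applies to \<open>n u - n r\<close> and
  \<open>n v - n r\<close> for every fixed \<open>r\<close> and is integrated. On
  \<open>{u..v}\<close> (\<open>E2\<close>) only terms belonging to \<open>v\<close> remain; there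
  \<open>n v - n r\<close> is small, which gives a small multiple of the length and is one reason
  for the summand \<open>v - u\<close> in \<open>trapezoid\<close>.\<close>

lemma trapezoid_run:
  fixes f n :: "real \<Rightarrow> real"
  assumes n: "continuous_on {s..t} n" and f: "continuous_on {s..t} f"
  defines "\<And>k. h k \<equiv> \<lambda>u. integral {s..u} (\<lambda>r. f r * ((n u - n r) ^ k / fact k))"
  shows "trapezoid n s t (h k) n (h (Suc k))"
  unfolding trapezoid_def
proof (intro allI impI)
  fix e :: real assume e: "e > 0"
  obtain B' where B': "B' \<ge> 1" "\<And>u. u \<in> {s..t} \<Longrightarrow> \<bar>n u\<bar> \<le> B'"
    using continuous_bounded[OF n] by blast
  define B where "B = 2 * B'"
  have B: "B \<ge> 1" and nB: "\<And>u v. u \<in> {s..t} \<Longrightarrow> v \<in> {s..t} \<Longrightarrow> \<bar>n u - n v\<bar> \<le> B"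
    using B' unfolding B_def by (auto, smt (verit, best) atLeastAtMost_iff)
  obtain A where A: "A \<ge> 1" "\<And>u. u \<in> {s..t} \<Longrightarrow> \<bar>f u\<bar> \<le> A"
    using continuous_bounded[OF f] by blast
  define K where "K = Suc k * (k * B ^ k)\<^sup>2"
  have K: "K \<ge> 0" by (simp add: K_def)
  \<comment> \<open>The two summands are the constants of the bounds on \<open>{s..u}\<close> and on
    \<open>{u..v}\<close>; dividing \<open>e\<close> by their sum turns these bounds into
    \<open>e\<close> times the squared increment and \<open>e\<close> times
    \<open>v - u\<close>.\<close>
  define C where "C = A * K * \<bar>t - s\<bar> + 2 * A * B ^ k"
  have C: "C > 0" using A B K by (auto simp: C_def intro!: add_nonneg_pos)
  obtain d where d: "d > 0" "\<And>u v. u \<in> {s..t} \<Longrightarrow> v \<in> {s..t} \<Longrightarrow> \<bar>v - u\<bar> < d \<Longrightarrow> \<bar>n v - n u\<bar> \<le> e / C"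
    using uniform_modulus[OF n, of "e / C"] e C by auto
  show "\<exists>d>0. \<forall>u v. s \<le> u \<and> u \<le> v \<and> v \<le> t \<and> v - u < d \<longrightarrow>
    \<bar>h (Suc k) v - h (Suc k) u - (h k u + h k v) / 2 * (n v - n u)\<bar> \<le> e * ((v - u) + (n v - n u)\<^sup>2)"
  proof (intro exI[of _ d] conjI allI impI)
    fix u v assume *: "s \<le> u \<and> u \<le> v \<and> v \<le> t \<and> v - u < d"
    define D where "D = n v - n u"
    have D: "\<bar>D\<bar> \<le> e / C" unfolding D_def using d(2)[of u v] * by auto
    have su: "{s..u} \<subseteq> {s..t}" "{u..v} \<subseteq> {s..t}" "{s..v} \<subseteq> {s..t}" using * by auto
    define p where "p k x r = f r * ((n x - n r) ^ k / fact k)" for k x r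
    have h: "h k x = integral {s..x} (p k x)" for k x unfolding h_def p_def ..
    have pc: "continuous_on S (p k x)" if "S \<subseteq> {s..t}" for S k x
      unfolding p_def using continuous_on_subset[OF f that] continuous_on_subset[OF n that]
      by (intro continuous_intros) auto
    note pi = integrable_continuous_real[OF pc]
    have split: "h k v = integral {s..u} (p k v) + integral {u..v} (p k v)" for k
      unfolding h using * pi[OF su(3)] by (intro Henstock_Kurzweil_Integration.integral_combine[symmetric]) auto
    define E1 where "E1 r = p (Suc k) v r - p (Suc k) u r - (p k u r + p k v r) * (D / 2)" for r
    define E2 where "E2 r = p (Suc k) v r - p k v r * (D / 2)" for r
    have "integral {s..u} E1 = integral {s..u} (p (Suc k) v) - integral {s..u} (p (Suc k) u)
        - (integral {s..u} (p k u) + integral {s..u} (p k v)) * (D / 2)"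
      unfolding E1_def by (intro integral_unique has_integral_diff has_integral_add has_integral_mult_left
          integrable_integral pi[OF su(1)])
    moreover have "integral {u..v} E2 = integral {u..v} (p (Suc k) v) - integral {u..v} (p k v) * (D / 2)"
      unfolding E2_def by (intro integral_unique has_integral_diff has_integral_mult_left
          integrable_integral pi[OF su(2)])
    ultimately have "h (Suc k) v - h (Suc k) u - (h k u + h k v) / 2 * D = integral {s..u} E1 + integral {u..v} E2"
      unfolding split[of k] split[of "Suc k"] h[of _ u] by (simp add: field_simps)
    also have "\<bar>\<dots>\<bar> \<le> (A * (K * \<bar>D\<bar> * D\<^sup>2)) * (u - s) + (A * (B ^ k * (e / C * 2))) * (v - u)"
    proof (rule order_trans[OF abs_triangle_ineq add_mono])
      show "\<bar>integral {s..u} E1\<bar> \<le> (A * (K * \<bar>D\<bar> * D\<^sup>2)) * (u - s)"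
      proof (rule abs_integral_le)
        show "continuous_on {s..u} E1" unfolding E1_def using pc[OF su(1)] by (intro continuous_intros) auto
        fix r assume r: "r \<in> {s..u}"
        define a where "a = n u - n r"
        have aD: "n v - n r = a + D" by (simp add: a_def D_def)
        have alg: "y * X - y * Y - (y * Z + y * V) * (D / 2) = y * (X - Y - (Z + V) / 2 * ((a + D) - a))"
          for X Y Z V y by (simp add: field_simps)
        have "E1 r = f r * ((a + D) ^ Suc k / fact (Suc k) - a ^ Suc k / fact (Suc k)
            - (a ^ k / fact k + (a + D) ^ k / fact k) / 2 * ((a + D) - a))"
          unfolding E1_def p_def aD a_def[symmetric] by (rule alg)
        also have "\<bar>\<dots>\<bar> \<le> A * (K * \<bar>(a + D) - a\<bar> * ((a + D) - a)\<^sup>2)"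
          unfolding abs_mult K_def
        proof (intro mult_mono trapezoid_power)
          show "\<bar>f r\<bar> \<le> A" using r * by (intro A) auto
          show "\<bar>a\<bar> \<le> B" "\<bar>a + D\<bar> \<le> B" unfolding a_def D_def using nB[of u r] nB[of v r] r * by auto
        qed (use A B in auto)
        finally show "\<bar>E1 r\<bar> \<le> A * (K * \<bar>D\<bar> * D\<^sup>2)" by simp
      qed (use * in auto)
      show "\<bar>integral {u..v} E2\<bar> \<le> (A * (B ^ k * (e / C * 2))) * (v - u)"
      proof (rule abs_integral_le)
        show "continuous_on {u..v} E2" unfolding E2_def using pc[OF su(2)] by (intro continuous_intros) auto
        fix r assume r: "r \<in> {u..v}"
        define a where "a = n v - n r"
        have a: "\<bar>a\<bar> \<le> e / C" "\<bar>a\<bar> \<le> B" unfolding a_def using d(2)[of r v] nB[of v r] r * by auto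
        have fact: "1 \<le> (fact k :: real)" by simp
        have "E2 r = f r * (a ^ k / fact k * (a / Suc k - D / 2))"
        proof -
          have "a ^ Suc k / fact (Suc k) = a ^ k / fact k * (a / Suc k)"
            by (simp add: mult.commute)
          then show ?thesis
            unfolding E2_def p_def a_def[symmetric] by (simp only: right_diff_distrib mult.assoc)
        qed
        also have "\<bar>\<dots>\<bar> \<le> A * (B ^ k * (e / C * 2))"
          unfolding abs_mult
        proof (intro mult_mono)
          show "\<bar>f r\<bar> \<le> A" using r * by (intro A) auto
          have "\<bar>a ^ k / fact k\<bar> \<le> \<bar>a\<bar> ^ k / 1"
            unfolding abs_divide power_abs by (intro frac_le) auto
          also have "\<dots> \<le> B ^ k" using a by (simp add: power_mono)
          finally show "\<bar>a ^ k / fact k\<bar> \<le> B ^ k" .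
          have "\<bar>a / Suc k\<bar> \<le> \<bar>a\<bar>" by (simp add: abs_divide divide_le_eq mult_le_cancel_left1 del: of_nat_Suc)
          then show "\<bar>a / Suc k - D / 2\<bar> \<le> e / C * 2" using a(1) D by linarith
        qed (use A B in auto)
        finally show "\<bar>E2 r\<bar> \<le> A * (B ^ k * (e / C * 2))" .
      qed (use * in auto)
    qed
    also have "\<dots> \<le> e * ((v - u) + D\<^sup>2)"
    proof -
      have "A * (K * \<bar>D\<bar> * D\<^sup>2) * (u - s) \<le> A * (K * (e / C) * D\<^sup>2) * \<bar>t - s\<bar>"
        using A(1) K D e C * by (intro mult_mono) simp_all
      also have "\<dots> = (A * K * \<bar>t - s\<bar>) * (e / C * D\<^sup>2)" by (simp add: mult_ac)
      also have "\<dots> \<le> C * (e / C * D\<^sup>2)"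
        using A B e C by (intro mult_right_mono) (auto simp: C_def)
      also have "\<dots> = e * D\<^sup>2" using C by simp
      finally have 1: "A * (K * \<bar>D\<bar> * D\<^sup>2) * (u - s) \<le> e * D\<^sup>2" .
      have "A * (B ^ k * (e / C * 2)) * (v - u) = (2 * A * B ^ k) * (e / C * (v - u))" by (simp add: mult_ac)
      also have "\<dots> \<le> C * (e / C * (v - u))"
        using A K e C * by (intro mult_right_mono) (auto simp: C_def)
      also have "\<dots> = e * (v - u)" using C by simp
      finally show ?thesis using 1 by (simp add: distrib_left)
    qed
    finally show "\<bar>h (Suc k) v - h (Suc k) u - (h k u + h k v) / 2 * (n v - n u)\<bar> \<le> e * ((v - u) + (n v - n u)\<^sup>2)"
      by (simp add: D_def)
  qed (rule d(1))
qed

text \<open>A letter 1 only raises the exponent of the run, so \<open>k\<close> must vary in the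
  induction; a letter 0 ends the run, and \<open>trapezoid_run\<close> applies with the functional
  of the remaining word as \<open>f\<close>.\<close>

lemma trapezoid_jint_Suc:
  assumes n: "continuous_on {s..t} n"
  shows "trapezoid n s t (jint n s w k) n (jint n s w (Suc k))"
proof (induction w arbitrary: k)
  case Nil
  show ?case by (rule trapezoid_run_Nil[OF n])
next
  case (Cons i w)
  have "jint n s (i # w) k = (if i = 0 then \<lambda>u. integral {s..u} (\<lambda>r. jint n s w 0 r * ((n u - n r) ^ k / fact k))
      else jint n s w (Suc k))" for k by (auto simp: fun_eq_iff)
  then show ?case
    using trapezoid_run[OF n continuous_on_jint[OF n, of w 0], of k] Cons[of "Suc k"]
    by (cases "i = 0") presburger+
qed

lemma trapezoid_jint_Cons:
  assumes n: "continuous_on {s..t} n"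
  shows "trapezoid n s t (jint n s w 0) (letter_path n i) (jint n s (i # w) 0)"
proof -
  have "jint n s (i # w) 0 = (if i = 0 then \<lambda>u. integral {s..u} (jint n s w 0) else jint n s w (Suc 0))"
    by (auto simp: fun_eq_iff)
  then show ?thesis
    using trapezoid_time[OF continuous_on_jint[OF n, of w 0], of n] trapezoid_jint_Suc[OF n, of w 0]
    by (simp add: letter_path_def)
qed

lemma jint_Cons_start [simp]: "jint n s (i # w) 0 s = 0"
  by simp

text \<open>Each letter 1 contributes a factor \<open>c\<close>. One evaluation of the functional on
  the deterministic path thus serves all three multiples taken by the random path.\<close>

lemma jint_scale:
  "jint (\<lambda>r. c * n r) s w k u = c ^ (k + length (filter (\<lambda>i. i \<noteq> 0) w)) * jint n s w k u"
proof (induction w arbitrary: k u)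
  case Nil
  show ?case by (simp add: right_diff_distrib[symmetric] power_mult_distrib)
next
  case (Cons i w)
  have "(\<lambda>r. jint (\<lambda>r. c * n r) s w 0 r * ((c * n u - c * n r) ^ k / fact k)) =
     (\<lambda>r. c ^ (k + length (filter (\<lambda>i. i \<noteq> 0) w)) * (jint n s w 0 r * ((n u - n r) ^ k / fact k)))"
    unfolding Cons by (simp add: right_diff_distrib[symmetric] power_mult_distrib power_add mult_ac)
  then show ?case using Cons[of "Suc k"] by simp
qed

section \<open>From the trapezoidal rule to integrals along Lipschitz paths\<close>

text \<open>The Lipschitz bound turns the squared increment of \<open>n\<close> into a multiple of
  \<open>v - u\<close>. Passing from the mean of the endpoint values of \<open>f\<close> to its
  value at an arbitrary tag costs a further small multiple, by uniform continuity of
  \<open>f\<close>.\<close>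

lemma RS_integral_lipschitz:
  assumes tr: "trapezoid n s t f g h" and f: "continuous_on {s..t} f"
    and L: "\<And>u v. u \<in> {s..t} \<Longrightarrow> v \<in> {s..t} \<Longrightarrow> \<bar>n v - n u\<bar> \<le> L * \<bar>v - u\<bar>"
      "\<And>u v. u \<in> {s..t} \<Longrightarrow> v \<in> {s..t} \<Longrightarrow> \<bar>g v - g u\<bar> \<le> L * \<bar>v - u\<bar>"
    and x: "x \<in> {s..t}" 
  shows "RS_integral f g s x = h x - h s"
proof (rule RS_integral_eq[OF _ has_RS_integralI[where m = "\<lambda>r. r"]])
  fix e :: real assume e: "e > 0"
  \<comment> \<open>The three terms account for the length \<open>v - u\<close>, the squared
    increment of \<open>n\<close>, and the passage to the tag.\<close>
  define B where "B = 1 + L\<^sup>2 * (t - s) + \<bar>L\<bar>"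
  have B: "B > 0" using x by (auto simp: B_def intro!: add_pos_nonneg)
  then have eB: "e / B > 0" using e by simp
  obtain d1 where d1: "d1 > 0" "\<And>u v. s \<le> u \<Longrightarrow> u \<le> v \<Longrightarrow> v \<le> t \<Longrightarrow> v - u < d1 \<Longrightarrow>
      \<bar>h v - h u - (f u + f v) / 2 * (g v - g u)\<bar> \<le> e / B * ((v - u) + (n v - n u)\<^sup>2)"
    using tr[unfolded trapezoid_def, rule_format, OF eB] by blast
  obtain d2 where d2: "d2 > 0" "\<And>u v. u \<in> {s..t} \<Longrightarrow> v \<in> {s..t} \<Longrightarrow> \<bar>v - u\<bar> < d2 \<Longrightarrow> \<bar>f v - f u\<bar> \<le> e / B"
    using uniform_modulus[OF f eB] by blast
  show "\<exists>d>0. \<forall>u v r. s \<le> u \<and> u \<le> r \<and> r \<le> v \<and> v \<le> x \<and> v - u < d \<longrightarrow>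
     \<bar>h v - h u - f r * (g v - g u)\<bar> \<le> e * (v - u)"
  proof (intro exI[of _ "min d1 d2"] conjI allI impI)
    show "min d1 d2 > 0" using d1(1) d2(1) by simp
    fix u v r assume *: "s \<le> u \<and> u \<le> r \<and> r \<le> v \<and> v \<le> x \<and> v - u < min d1 d2"
    have uv: "u \<in> {s..t}" "v \<in> {s..t}" "r \<in> {s..t}" using * x by auto
    have "(n v - n u)\<^sup>2 \<le> (L * (v - u))\<^sup>2"
      using L(1)[OF uv(1,2)] * by (intro power2_le_iff_abs_le[THEN iffD2]) auto
    also have "\<dots> \<le> L\<^sup>2 * (t - s) * (v - u)"
      unfolding power_mult_distrib power2_eq_square[of "v - u"] mult.assoc
      using * x by (intro mult_left_mono mult_right_mono) auto
    finally have n2: "(n v - n u)\<^sup>2 \<le> L\<^sup>2 * (t - s) * (v - u)" .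
    have 1: "\<bar>h v - h u - (f u + f v) / 2 * (g v - g u)\<bar> \<le> e / B * ((v - u) + (n v - n u)\<^sup>2)"
      using d1(2)[of u v] * x by auto
    also have "\<dots> \<le> e / B * ((v - u) + L\<^sup>2 * (t - s) * (v - u))"
      using n2 eB by (intro mult_left_mono) auto
    finally have 1: "\<bar>h v - h u - (f u + f v) / 2 * (g v - g u)\<bar> \<le> e / B * ((v - u) + L\<^sup>2 * (t - s) * (v - u))" .
    have "\<bar>(f u + f v) / 2 - f r\<bar> \<le> e / B"
    proof -
      have "\<bar>f u - f r\<bar> \<le> e / B" "\<bar>f v - f r\<bar> \<le> e / B"
        using d2(2)[OF uv(3,1)] d2(2)[OF uv(3,2)] * by auto
      moreover have "\<bar>(p + q) / 2 - z\<bar> \<le> y" if "\<bar>p - z\<bar> \<le> y" "\<bar>q - z\<bar> \<le> y" for p q y z :: real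
        using that unfolding abs_le_iff by (simp add: field_simps)
      ultimately show ?thesis by blast
    qed
    then have 2: "\<bar>((f u + f v) / 2 - f r) * (g v - g u)\<bar> \<le> e / B * (\<bar>L\<bar> * (v - u))"
      unfolding abs_mult using L(2)[OF uv(1,2)] eB *
      by (intro mult_mono) (auto intro: order_trans[OF _ mult_right_mono[OF abs_ge_self]])
    have "h v - h u - f r * (g v - g u) =
        (h v - h u - (f u + f v) / 2 * (g v - g u)) + ((f u + f v) / 2 - f r) * (g v - g u)"
      by (simp add: algebra_simps)
    then have "\<bar>h v - h u - f r * (g v - g u)\<bar> \<le> e / B * ((v - u) + L\<^sup>2 * (t - s) * (v - u)) + e / B * (\<bar>L\<bar> * (v - u))"
      using 1 2 by linarith
    also have "\<dots> = e / B * (B * (v - u))" unfolding B_def by (simp only: distrib_left distrib_right mult_1_left)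
    also have "\<dots> = e * (v - u)" using B by simp
    finally show "\<bar>h v - h u - f r * (g v - g u)\<bar> \<le> e * (v - u)" .
  qed
qed (use x in \<open>auto simp: mono_on_def\<close>)

lemma lipschitz_imp_continuous_on:
  fixes n :: "real \<Rightarrow> real"
  assumes "\<And>u v. u \<in> S \<Longrightarrow> v \<in> S \<Longrightarrow> \<bar>n v - n u\<bar> \<le> L * \<bar>v - u\<bar>"
  shows "continuous_on S n"
proof -
  have "(max 0 L)-lipschitz_on S n"
    using assms by (intro lipschitz_onI)
      (auto simp: dist_real_def intro: order_trans[OF _ mult_right_mono[of L "max 0 L"]])
  then show ?thesis by (rule lipschitz_on_continuous_on)
qed

lemma iter_int_rev_lipschitz:
  assumes L: "\<And>u v. u \<in> {s..t} \<Longrightarrow> v \<in> {s..t} \<Longrightarrow> \<bar>n v - n u\<bar> \<le> L * \<bar>v - u\<bar>" and "x \<in> {s..t}"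
  shows "iter_int_rev n s w x = jint n s w 0 x"
  using \<open>x \<in> {s..t}\<close>
proof (induction w arbitrary: x)
  case Nil
  show ?case by simp
next
  case (Cons i w)
  have n: "continuous_on {s..t} n" by (rule lipschitz_imp_continuous_on[of _ n L]) (rule L)
  have "iter_int_rev n s (i # w) x = RS_integral (jint n s w 0) (letter_path n i) s x"
    using Cons by (auto intro!: RS_integral_cong)
  also have "\<dots> = jint n s (i # w) 0 x - jint n s (i # w) 0 s"
  proof (rule RS_integral_lipschitz[OF trapezoid_jint_Cons[OF n] continuous_on_jint[OF n]])
    fix u v assume uv: "u \<in> {s..t}" "v \<in> {s..t}"
    \<comment> \<open>\<open>max 1 L\<close> is a common Lipschitz constant for both letter paths,
      the identity included.\<close>
    show "\<bar>n v - n u\<bar> \<le> max 1 L * \<bar>v - u\<bar>"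
      using L[OF uv] by (rule order_trans) (auto intro: mult_right_mono)
    then show "\<bar>letter_path n i v - letter_path n i u\<bar> \<le> max 1 L * \<bar>v - u\<bar>"
      using mult_right_mono[of 1 "max 1 L" "\<bar>v - u\<bar>"] by (auto simp: letter_path_def)
  qed (rule Cons.prems)
  finally show ?case unfolding jint_Cons_start by simp
qed

lemma iter_int_lipschitz:
  assumes "\<And>u v. u \<in> {s..t} \<Longrightarrow> v \<in> {s..t} \<Longrightarrow> \<bar>n v - n u\<bar> \<le> L * \<bar>v - u\<bar>" and "s \<le> t"
  shows "iter_int n \<alpha> s t = jint n s (rev \<alpha>) 0 t"
  unfolding iter_int_def using assms by (intro iter_int_rev_lipschitz) auto

lemma iter_int_cong:
  assumes "\<And>r. r \<in> {s..t} \<Longrightarrow> x r = y r" "s \<le> t"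
  shows "iter_int x \<alpha> s t = iter_int y \<alpha> s t"
proof -
  have "iter_int_rev x s w u = iter_int_rev y s w u" if "u \<in> {s..t}" for w u
    using that
  proof (induction w arbitrary: u)
    case (Cons i w)
    then show ?case using assms(1) by (auto intro!: RS_integral_cong simp: letter_path_def)
  qed simp
  then show ?thesis using assms(2) by (simp add: iter_int_def)
qed

section \<open>The bracket with time\<close>

text \<open>\<open>V\<close> need not be Lipschitz, but here it is the integrand. The path
  \<open>n\<close> in the error bound may therefore be constant, and only the identity as integrator
  has to be Lipschitz.\<close>

lemma I10_eq:
  assumes V: "continuous_on {s..t} V" and st: "s \<le> t"
  shows "I10 V s t = integral {s..t} (\<lambda>r. V r - V s)"
proof -
  have "I10 V s t = RS_integral (\<lambda>u. RS_integral (\<lambda>_. 1) V s u) (\<lambda>r. r) s t"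
    by (simp add: I10_def iter_int_def letter_path_def)
  also have "\<dots> = RS_integral (\<lambda>u. V u - V s) (\<lambda>r. r) s t"
    by (rule RS_integral_cong) (auto simp: RS_integral_one)
  also have "\<dots> = integral {s..t} (\<lambda>r. V r - V s) - integral {s..s} (\<lambda>r. V r - V s)"
  proof (rule RS_integral_lipschitz[where n = "\<lambda>_. 0" and L = 1])
    have c: "continuous_on {s..t} (\<lambda>r. V r - V s)" using V by (intro continuous_intros)
    then show "trapezoid (\<lambda>_. 0) s t (\<lambda>u. V u - V s) (\<lambda>r. r) (\<lambda>t. integral {s..t} (\<lambda>r. V r - V s))"
      by (rule trapezoid_time)
    show "continuous_on {s..t} (\<lambda>r. V r - V s)" by (rule c)
  qed (use st in auto)
  finally show ?thesis by simp
qed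

text \<open>Integration by parts for an integrator that is merely continuous and monotone:
  \<open>G\<close> is the primitive it predicts, and its error on a cell is controlled by the length
  plus the increment of \<open>V\<close>.\<close>

lemma RS_integral_time_mono:
  assumes V: "continuous_on {s..t} V" and st: "s \<le> t" and mono: "mono_on {s..t} V"
  shows "RS_integral (\<lambda>u. u - s) V s t = (t - s) * (V t - V s) - integral {s..t} (\<lambda>r. V r - V s)"
proof -
  define G where "G u = (u - s) * (V u - V s) - integral {s..u} (\<lambda>r. V r - V s)" for u
  have c: "continuous_on {s..t} (\<lambda>r. V r - V s)" using V by (intro continuous_intros)
  have "RS_integral (\<lambda>u. u - s) V s t = G t - G s"
  proof (rule RS_integral_eq[OF st has_RS_integralI[OF st, where m = "\<lambda>r. r + V r"]])
    show "mono_on {s..t} (\<lambda>r. r + V r)" using mono by (auto simp: mono_on_def intro: add_mono)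
    fix e :: real assume e: "e > 0"
    obtain d where d: "d > 0" "\<And>u v. u \<in> {s..t} \<Longrightarrow> v \<in> {s..t} \<Longrightarrow> \<bar>v - u\<bar> < d \<Longrightarrow> \<bar>V v - V u\<bar> \<le> e"
      using uniform_modulus[OF V e] by blast
    show "\<exists>d>0. \<forall>u v r. s \<le> u \<and> u \<le> r \<and> r \<le> v \<and> v \<le> t \<and> v - u < d \<longrightarrow>
       \<bar>G v - G u - (r - s) * (V v - V u)\<bar> \<le> e * (v + V v - (u + V u))"
    \<comment> \<open>A mesh below \<open>e\<close> bounds \<open>(v - r) * (V v - V u)\<close>, and
      a mesh below \<open>d\<close> bounds the integral of \<open>V u - V r\<close>.\<close>
    proof (intro exI[of _ "min d e"] conjI allI impI)
      show "min d e > 0" using d(1) e by simp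
      fix u v r assume *: "s \<le> u \<and> u \<le> r \<and> r \<le> v \<and> v \<le> t \<and> v - u < min d e"
      have Vuv: "V u \<le> V v" using mono * by (auto simp: mono_on_def)
      have cuv: "continuous_on {u..v} (\<lambda>r. V u - V r)" using * by (intro continuous_intros continuous_on_subset[OF V]) auto
      have "integral {s..u} (\<lambda>r. V r - V s) + integral {u..v} (\<lambda>r. V r - V s) = integral {s..v} (\<lambda>r. V r - V s)"
        using * by (intro Henstock_Kurzweil_Integration.integral_combine integrable_continuous_real
          continuous_on_subset[OF c]) auto
      moreover have "integral {u..v} (\<lambda>r. V u - V r) = integral {u..v} (\<lambda>r. (V u - V s) - (V r - V s))"
        by simp
      moreover have "\<dots> = (V u - V s) * (v - u) - integral {u..v} (\<lambda>r. V r - V s)"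
        using * by (subst integral_diff) (auto intro!: integrable_continuous_real continuous_on_subset[OF c])
      ultimately have "G v - G u - (r - s) * (V v - V u) = (v - r) * (V v - V u) + integral {u..v} (\<lambda>r. V u - V r)"
        unfolding G_def by (simp add: algebra_simps)
      moreover have "\<bar>integral {u..v} (\<lambda>r. V u - V r)\<bar> \<le> e * (v - u)"
      proof (rule abs_integral_le[OF _ cuv])
        show "\<bar>V u - V r\<bar> \<le> e" if "r \<in> {u..v}" for r using d(2)[of r u] that * by auto
      qed (use * in auto)
      moreover have "\<bar>(v - r) * (V v - V u)\<bar> \<le> e * (V v - V u)"
        unfolding abs_mult using * Vuv by (intro mult_mono) auto
      ultimately show "\<bar>G v - G u - (r - s) * (V v - V u)\<bar> \<le> e * (v + V v - (u + V u))"
        by (simp add: distrib_left right_diff_distrib)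
    qed
  qed
  then show ?thesis by (simp add: G_def)
qed

text \<open>Integration by parts expresses one integral of the bracket through the other. Hence
  \<open>(t - s) * (V t - V s)\<close> is \<open>2 * I10 V s t - br V s t\<close>, which later makes
  the conditions on the path polynomial in \<open>I10\<close>, \<open>br\<close> and
  \<open>kappa\<close>.\<close>

lemma br_eq:
  assumes V: "continuous_on {s..t} V" and st: "s \<le> t" and mono: "mono_on {s..t} V"
  shows "br V s t = 2 * I10 V s t - (t - s) * (V t - V s)"
proof -
  have "RS_integral (\<lambda>u. RS_integral (\<lambda>_. 1) V s u) (\<lambda>r. r) s t = I10 V s t"
    by (simp add: I10_def iter_int_def letter_path_def)
  moreover have "RS_integral (\<lambda>u. RS_integral (\<lambda>_. 1) (\<lambda>r. r) s u) V s t = RS_integral (\<lambda>u. u - s) V s t"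
    by (rule RS_integral_cong) (auto simp: RS_integral_one)
  ultimately show ?thesis
    unfolding br_def bracket_def RS_integral_time_mono[OF assms] I10_eq[OF V st] by simp
qed

section \<open>Limits in probability along divisions\<close>

text \<open>One division that is fine enough for both limits puts \<open>L\<close> and
  \<open>L'\<close> within \<open>e\<close> of the same sum off sets of small measure. This
  identifies the version picked by \<open>stratonovich\<close> with an explicit one.\<close>

lemma mesh_limit_unique:
  assumes "prob_space P" and "s \<le> u"
    and S: "\<And>D. D division_of {s..u} \<Longrightarrow> S D \<in> borel_measurable P"
    and L: "L \<in> borel_measurable P" "L' \<in> borel_measurable P"
    and lim: "mesh_limit_in_prob P s u S L" "mesh_limit_in_prob P s u S L'"
  shows "AE x in P. L x = L' x"
proof -
  interpret prob_space P by fact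
  note [measurable] = L
  have le: "measure P {x \<in> space P. 2 * e \<le> \<bar>L x - L' x\<bar>} \<le> 2 * y" if e: "e > 0" and y: "y > 0" for e y
  proof -
    obtain d1 where d1: "d1 > 0" "\<And>D. D division_of {s..u} \<Longrightarrow> (\<forall>K\<in>D. Sup K - Inf K < d1) \<Longrightarrow>
        measure P {x \<in> space P. e \<le> \<bar>S D x - L x\<bar>} < y"
      using lim(1)[unfolded mesh_limit_in_prob_def, rule_format, OF e y] by blast
    obtain d2 where d2: "d2 > 0" "\<And>D. D division_of {s..u} \<Longrightarrow> (\<forall>K\<in>D. Sup K - Inf K < d2) \<Longrightarrow>
        measure P {x \<in> space P. e \<le> \<bar>S D x - L' x\<bar>} < y"
      using lim(2)[unfolded mesh_limit_in_prob_def, rule_format, OF e y] by blast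
    obtain D where D: "D division_of {s..u}" "\<forall>K\<in>D. Sup K - Inf K < min d1 d2"
    proof -
      have "gauge (\<lambda>x::real. ball x (min d1 d2 / 4))" using d1(1) d2(1) by (intro gauge_ball) auto
      then obtain p where p: "p tagged_division_of {s..u}" "(\<lambda>x. ball x (min d1 d2 / 4)) fine p"
        using fine_division_exists_real by blast
      have "Sup K - Inf K < min d1 d2" if "K \<in> snd ` p" for K
      proof -
        from that obtain x where xK: "(x, K) \<in> p" by auto
        obtain a b where K: "K = cbox a b" "x \<in> K" using tagged_division_ofD(2,4)[OF p(1) xK] by blast
        then have "a \<le> b" by auto
        then have "a \<in> K" "b \<in> K" "Sup K = b" "Inf K = a" using K by auto
        moreover have "K \<subseteq> ball x (min d1 d2 / 4)" using p(2) xK by (auto simp: fine_def)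
        ultimately have "a \<in> ball x (min d1 d2 / 4)" "b \<in> ball x (min d1 d2 / 4)" by blast+
        then have "\<bar>x - a\<bar> < min d1 d2 / 4" "\<bar>x - b\<bar> < min d1 d2 / 4" by (simp_all add: dist_real_def)
        then have "b - a < min d1 d2" using d1(1) d2(1) by linarith
        then show ?thesis using \<open>Sup K = b\<close> \<open>Inf K = a\<close> by simp
      qed
      with division_of_tagged_division[OF p(1)] show ?thesis by (intro that) auto
    qed
    note [measurable] = S[OF D(1)]
    have "measure P {x \<in> space P. 2 * e \<le> \<bar>L x - L' x\<bar>}
      \<le> measure P ({x \<in> space P. e \<le> \<bar>S D x - L x\<bar>} \<union> {x \<in> space P. e \<le> \<bar>S D x - L' x\<bar>})"
    proof (rule finite_measure_mono)
      show "{x \<in> space P. 2 * e \<le> \<bar>L x - L' x\<bar>}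
        \<subseteq> {x \<in> space P. e \<le> \<bar>S D x - L x\<bar>} \<union> {x \<in> space P. e \<le> \<bar>S D x - L' x\<bar>}" by auto
    qed measurable
    also have "\<dots> \<le> measure P {x \<in> space P. e \<le> \<bar>S D x - L x\<bar>} + measure P {x \<in> space P. e \<le> \<bar>S D x - L' x\<bar>}"
      by (rule measure_Un_le) measurable
    also have "\<dots> \<le> y + y" using d1(2)[OF D(1)] d2(2)[OF D(1)] D(2) by (intro add_mono) (auto intro: less_imp_le)
    finally show ?thesis by simp
  qed
  have zero: "measure P {x \<in> space P. 2 * e \<le> \<bar>L x - L' x\<bar>} = 0" if "e > 0" for e
  proof -
    have "measure P {x \<in> space P. 2 * e \<le> \<bar>L x - L' x\<bar>} \<le> 0 + y" if "y > 0" for y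
      using le[OF \<open>e > 0\<close>, of "y / 2"] that by simp
    then show ?thesis using field_le_epsilon[of "measure P {x \<in> space P. 2 * e \<le> \<bar>L x - L' x\<bar>}" 0]
      by (simp add: measure_le_0_iff)
  qed
  have "AE x in P. \<bar>L x - L' x\<bar> < 2 * (1 / Suc k)" for k
    using zero[of "1 / Suc k"] by (subst AE_iff_measurable[OF _ refl]) (auto simp: emeasure_eq_measure not_less)
  then have "AE x in P. \<forall>k. \<bar>L x - L' x\<bar> < 2 * (1 / Suc k)" by (simp add: AE_all_countable)
  then show ?thesis
  proof eventually_elim
    case (elim x)
    show ?case
    proof (rule ccontr)
      assume "L x \<noteq> L' x"
      then have "0 < \<bar>L x - L' x\<bar> / 2" by simp
      then obtain k where "inverse (of_nat (Suc k)) < \<bar>L x - L' x\<bar> / 2" using reals_Archimedean by blast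
      moreover have "2 * y < z" if "y < z / 2" for y z :: real using that by linarith
      ultimately have "2 * (1 / Suc k) < \<bar>L x - L' x\<bar>" unfolding inverse_eq_divide by blast
      then show False using elim[rule_format, of k] by (meson less_asym)
    qed
  qed
qed

text \<open>Tagging each cell with its left endpoint reduces the claim to additivity over tagged
  divisions.\<close>

lemma division_telescope:
  fixes h :: "real \<Rightarrow> real"
  assumes D: "D division_of {a..b}" and ab: "a \<le> b"
  shows "(\<Sum>K\<in>D. h (Sup K) - h (Inf K)) = h b - h a"
proof -
  define p where "p = (\<lambda>K. (Inf K, K)) ` D"
  have Inf: "Inf K \<in> K" if K: "K \<in> D" for K
  proof -
    obtain c d where "K = cbox c d" using division_ofD(4)[OF D K] by blast
    then show ?thesis using division_ofD(3)[OF D K] by auto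
  qed
  have "p tagged_division_of {a..b}"
  proof (rule tagged_division_ofI)
    show "finite p" using D by (auto simp: p_def)
    show "x \<in> K" "K \<subseteq> {a..b}" "\<exists>c d. K = cbox c d" if "(x, K) \<in> p" for x K
      using that Inf division_ofD(2,4)[OF D] by (auto simp: p_def)
    show "interior K1 \<inter> interior K2 = {}" if "(x1, K1) \<in> p" "(x2, K2) \<in> p" "(x1, K1) \<noteq> (x2, K2)"
      for x1 K1 x2 K2 using that division_ofD(5)[OF D] by (auto simp: p_def)
    have "{K. \<exists>x. (x, K) \<in> p} = D" by (auto simp: p_def)
    then show "\<Union>{K. \<exists>x. (x, K) \<in> p} = {a..b}" using division_ofD(6)[OF D] by simp
  qed
  from additive_tagged_division_1[OF ab this, of h] show ?thesis
    unfolding p_def by (subst (asm) sum.reindex) (auto simp: inj_on_def)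
qed

lemma division_interval:
  fixes K :: "real set"
  assumes D: "D division_of {a..b}" "K \<in> D"
  shows "Inf K \<le> Sup K" "Inf K \<in> {a..b}" "Sup K \<in> {a..b}"
proof -
  obtain c d where "K = cbox c d" using division_ofD(4)[OF D(1) D(2)] by blast
  with division_ofD(2,3)[OF D(1) D(2)] have K: "K = cbox c d" "K \<noteq> {}" "K \<subseteq> {a..b}" by auto
  then have "c \<le> d" by auto
  then have "c \<in> K" "d \<in> K" "Sup K = d" "Inf K = c" using K by auto
  then show "Inf K \<le> Sup K" "Inf K \<in> {a..b}" "Sup K \<in> {a..b}" using K \<open>c \<le> d\<close> by auto
qed

lemma (in finite_measure) tendsto_measure_of_pointwise:
  fixes X :: "nat \<Rightarrow> 'a \<Rightarrow> real"
  assumes [measurable]: "\<And>k. X k \<in> borel_measurable M"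
    and lim: "\<And>x. x \<in> space M \<Longrightarrow> (\<lambda>k. X k x) \<longlonglongrightarrow> 0" and a: "a > 0"
  shows "(\<lambda>k. measure M {x \<in> space M. a \<le> X k x}) \<longlonglongrightarrow> 0"
proof -
  have "(\<lambda>k. \<integral>x. indicator {x \<in> space M. a \<le> X k x} x \<partial>M :: real) \<longlonglongrightarrow> (\<integral>x. 0 \<partial>M)"
  proof (rule integral_dominated_convergence[where w = "\<lambda>_. 1"])
    show "AE x in M. (\<lambda>k. indicator {x \<in> space M. a \<le> X k x} x :: real) \<longlonglongrightarrow> 0"
    proof (rule AE_I2)
      fix x assume x: "x \<in> space M"
      have "eventually (\<lambda>k. X k x < a) sequentially" using order_tendstoD(2)[OF lim[OF x] a] .
      then have "eventually (\<lambda>k. indicator {x \<in> space M. a \<le> X k x} x = (0::real)) sequentially"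
        by eventually_elim auto
      then show "(\<lambda>k. indicator {x \<in> space M. a \<le> X k x} x :: real) \<longlonglongrightarrow> 0" by (rule tendsto_eventually)
    qed
  qed (auto simp: indicator_def)
  then show ?thesis by simp
qed

text \<open>\<open>sq_exp\<close> is how orthogonality of increments enters: sums of squared
  increments have the same expectation for every division. Continuity is required at every point of
  the space, so that the pathwise estimates hold without exceptional sets.\<close>

locale increment_process = prob_space P for P :: "'a measure" +
  fixes N :: "real \<Rightarrow> 'a \<Rightarrow> real" and s t :: real and V :: "real \<Rightarrow> real"
  assumes st: "s \<le> t"
    and meas: "r \<in> {s..t} \<Longrightarrow> N r \<in> borel_measurable P"
    and cont: "x \<in> space P \<Longrightarrow> continuous_on {s..t} (\<lambda>r. N r x)"
    and sq_int: "u \<in> {s..t} \<Longrightarrow> v \<in> {s..t} \<Longrightarrow> integrable P (\<lambda>x. (N v x - N u x)\<^sup>2)"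
    and sq_exp: "s \<le> u \<Longrightarrow> u \<le> v \<Longrightarrow> v \<le> t \<Longrightarrow> expectation (\<lambda>x. (N v x - N u x)\<^sup>2) = V v - V u"
begin

text \<open>On each path the error \<open>R\<close> is eventually at most any small multiple of
  \<open>q\<close>, the length plus the sum of squared increments. Along a sequence of divisions
  \<open>q\<close> may be unbounded on a path, but its expectation is the same for all of them. So
  \<open>R / (1 + q)\<close> tends to 0 pointwise, \<open>q\<close> is controlled by Markov's
  inequality, and where both are small so is \<open>R\<close>.\<close>

lemma mesh_limit_trapezoid:
  assumes f: "\<And>r. r \<in> {s..t} \<Longrightarrow> f r \<in> borel_measurable P"
    and g: "\<And>r. r \<in> {s..t} \<Longrightarrow> g r \<in> borel_measurable P"
    and h: "\<And>r. r \<in> {s..t} \<Longrightarrow> h r \<in> borel_measurable P"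
    and tr: "\<And>x. x \<in> space P \<Longrightarrow>
      trapezoid (\<lambda>r. N r x) s t (\<lambda>r. f r x) (\<lambda>r. g r x) (\<lambda>r. h r x)"
    and u: "u \<in> {s..t}"
  shows "mesh_limit_in_prob P s u
    (\<lambda>D x. \<Sum>K\<in>D. (f (Inf K) x + f (Sup K) x) / 2 * (g (Sup K) x - g (Inf K) x)) (\<lambda>x. h u x - h s x)"
    (is "mesh_limit_in_prob P s u ?S ?L")
  unfolding mesh_limit_in_prob_def
proof (intro allI impI, rule ccontr)
  fix e y :: real assume e: "e > 0" and y: "y > 0"
  \<comment> \<open>A sequence of divisions avoids the non-measurable supremum of the error over all fine divisions.\<close>
  define ok where "ok D \<longleftrightarrow> measure P {x \<in> space P. e \<le> \<bar>?S D x - ?L x\<bar>} < y" for D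
  assume nex: "\<not> (\<exists>d>0. \<forall>D. D division_of {s..u} \<and> (\<forall>K\<in>D. Sup K - Inf K < d) \<longrightarrow>
       measure P {x \<in> space P. e \<le> \<bar>?S D x - ?L x\<bar>} < y)"
  have "\<forall>k. \<exists>D. D division_of {s..u} \<and> (\<forall>K\<in>D. Sup K - Inf K < 1 / Suc k) \<and> \<not> ok D"
  proof
    fix k :: nat
    have "(0::real) < 1 / Suc k" by simp
    with nex[folded ok_def] show "\<exists>D. D division_of {s..u} \<and> (\<forall>K\<in>D. Sup K - Inf K < 1 / Suc k) \<and> \<not> ok D"
      by blast
  qed
  from choice[OF this] obtain D where D': "\<forall>k. D k division_of {s..u} \<and> (\<forall>K\<in>D k. Sup K - Inf K < 1 / Suc k) \<and> \<not> ok (D k)"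
    by blast
  then have D: "\<And>k. D k division_of {s..u}" "\<And>k K. K \<in> D k \<Longrightarrow> Sup K - Inf K < 1 / Suc k"
    by blast+
  have big: "y \<le> measure P {x \<in> space P. e \<le> \<bar>?S (D k) x - ?L x\<bar>}" for k
    using D' unfolding ok_def not_less by blast
  have su: "s \<le> u" using u by auto
  have mem: "Inf K \<le> Sup K" "Inf K \<in> {s..t}" "Sup K \<in> {s..t}" if "K \<in> D k" for K k
    using division_interval[OF D(1) that] u by auto
  define R where "R k x = \<bar>?S (D k) x - ?L x\<bar>" for k x
  define q where "q k x = (u - s) + (\<Sum>K\<in>D k. (N (Sup K) x - N (Inf K) x)\<^sup>2)" for k x
  have q0: "0 \<le> q k x" for k x using su by (auto simp: q_def intro!: add_nonneg_nonneg sum_nonneg)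
  have Sm: "?S (D k) \<in> borel_measurable P" for k
    by (intro borel_measurable_sum borel_measurable_times borel_measurable_divide borel_measurable_add
        borel_measurable_diff f g mem) auto
  have Rm[measurable]: "R k \<in> borel_measurable P" for k
  proof -
    have [measurable]: "h u \<in> borel_measurable P" "h s \<in> borel_measurable P" "?S (D k) \<in> borel_measurable P"
      using h[OF u] h[of s] Sm[of k] st by auto
    show ?thesis unfolding R_def by (intro borel_measurable_abs borel_measurable_diff) fact+
  qed
  have qi: "integrable P (q k)" for k
    unfolding q_def by (intro Bochner_Integration.integrable_add Bochner_Integration.integrable_sum sq_int mem) auto
  have qm[measurable]: "q k \<in> borel_measurable P" for k using qi by auto
  have Eq: "expectation (q k) = (u - s) + (V u - V s)" for k
  proof -
    have "expectation (q k) = (u - s) + (\<Sum>K\<in>D k. expectation (\<lambda>x. (N (Sup K) x - N (Inf K) x)\<^sup>2))"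
      unfolding q_def using sq_int[OF mem(2,3)]
      by (subst Bochner_Integration.integral_add) (auto simp: prob_space Bochner_Integration.integral_sum)
    also have "(\<Sum>K\<in>D k. expectation (\<lambda>x. (N (Sup K) x - N (Inf K) x)\<^sup>2)) = (\<Sum>K\<in>D k. V (Sup K) - V (Inf K))"
      using mem by (intro sum.cong sq_exp) auto
    finally show ?thesis by (simp add: division_telescope[OF D(1) su])
  qed
  have R_le: "\<exists>k0. \<forall>k\<ge>k0. R k x \<le> e' * q k x" if x: "x \<in> space P" and e': "e' > 0" for x e'
  proof -
    obtain d where d: "d > 0" "\<And>a b. s \<le> a \<Longrightarrow> a \<le> b \<Longrightarrow> b \<le> t \<Longrightarrow> b - a < d \<Longrightarrow>
        \<bar>h b x - h a x - (f a x + f b x) / 2 * (g b x - g a x)\<bar> \<le> e' * ((b - a) + (N b x - N a x)\<^sup>2)"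
      using tr[OF x, unfolded trapezoid_def, rule_format, OF e'] by blast
    obtain k0 where k0: "inverse (real (Suc k0)) < d" using reals_Archimedean[OF d(1)] by blast
    show ?thesis
    proof (intro exI[of _ k0] allI impI)
      fix k assume k: "k0 \<le> k"
      have "1 / real (Suc k) \<le> inverse (real (Suc k0))" using k by (simp add: inverse_eq_divide frac_le)
      then have mesh: "Sup K - Inf K < d" if "K \<in> D k" for K using D(2)[OF that] k0 by linarith
      have "R k x = \<bar>\<Sum>K\<in>D k. (h (Sup K) x - h (Inf K) x)
          - (f (Inf K) x + f (Sup K) x) / 2 * (g (Sup K) x - g (Inf K) x)\<bar>"
        unfolding R_def sum_subtractf[of "\<lambda>K. h (Sup K) x - h (Inf K) x"] division_telescope[OF D(1) su, of "\<lambda>r. h r x"]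
        by (rule abs_minus_commute)
      also have "\<dots> \<le> (\<Sum>K\<in>D k. e' * ((Sup K - Inf K) + (N (Sup K) x - N (Inf K) x)\<^sup>2))"
        by (rule order_trans[OF sum_abs sum_mono], rule d(2)) (use mem mesh in auto)
      also have "\<dots> = e' * q k x"
        unfolding q_def sum_distrib_left[symmetric] sum.distrib division_telescope[OF D(1) su, of "\<lambda>r. r"] ..
      finally show "R k x \<le> e' * q k x" .
    qed
  qed
  have lim: "(\<lambda>k. R k x / (1 + q k x)) \<longlonglongrightarrow> 0" if x: "x \<in> space P" for x
  proof (rule LIMSEQ_I)
    fix e' :: real assume e': "e' > 0"
    then obtain k0 where k0: "\<And>k. k \<ge> k0 \<Longrightarrow> R k x \<le> e' / 2 * q k x" using R_le[OF x, of "e' / 2"] by auto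
    show "\<exists>k0. \<forall>k\<ge>k0. norm (R k x / (1 + q k x) - 0) < e'"
    proof (intro exI[of _ k0] allI impI)
      fix k assume "k0 \<le> k"
      have "R k x \<le> e' / 2 * q k x" by (rule k0) fact
      also have "\<dots> \<le> e' * q k x" using e' q0[of k x] by (intro mult_right_mono) auto
      also have "\<dots> < e' * (1 + q k x)" using e' by simp
      finally have "R k x / (1 + q k x) < e'" using q0[of k x] by (simp add: divide_less_eq)
      moreover have "0 \<le> R k x / (1 + q k x)" using q0[of k x] by (simp add: R_def)
      ultimately show "norm (R k x / (1 + q k x) - 0) < e'"
        unfolding real_norm_def diff_0_right by (simp only: abs_of_nonneg)
    qed
  qed
  define m where "m = (u - s) + (V u - V s)"
  have m: "0 \<le> m" using integral_nonneg_AE[where M = P and f = "q 0"] q0 Eq[of 0] by (auto simp: m_def)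
  \<comment> \<open>Markov's inequality then gives \<open>m / c < y / 2\<close>, half of the
    admissible probability; the other half goes to \<open>R / (1 + q)\<close>.\<close>
  define c where "c = 2 * (m + 1) / y"
  have c: "c > 0" using m y by (simp add: c_def)
  have "(\<lambda>k. measure P {x \<in> space P. e / (1 + c) \<le> R k x / (1 + q k x)}) \<longlonglongrightarrow> 0"
    using c e lim by (intro tendsto_measure_of_pointwise) auto
  moreover have "0 < y / 2" using y by simp
  ultimately have "eventually (\<lambda>k. measure P {x \<in> space P. e / (1 + c) \<le> R k x / (1 + q k x)} < y / 2) sequentially"
    by (rule order_tendstoD(2))
  then obtain k where k: "measure P {x \<in> space P. e / (1 + c) \<le> R k x / (1 + q k x)} < y / 2"
    using eventually_happens'[OF sequentially_bot] by blast
  have "measure P {x \<in> space P. c \<le> q k x} \<le> m / c"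
    using integral_Markov_inequality_measure[OF qi sets.empty_sets _ c, of k] q0 by (simp add: Eq m_def)
  also have "\<dots> < y / 2" using m y unfolding c_def by (simp add: field_simps)
  finally have qk: "measure P {x \<in> space P. c \<le> q k x} < y / 2" .
  have "y \<le> measure P {x \<in> space P. e \<le> R k x}" using big[of k] by (simp add: R_def)
  also have "\<dots> \<le> measure P ({x \<in> space P. e / (1 + c) \<le> R k x / (1 + q k x)} \<union> {x \<in> space P. c \<le> q k x})"
  proof (rule finite_measure_mono)
    show "{x \<in> space P. e \<le> R k x} \<subseteq> {x \<in> space P. e / (1 + c) \<le> R k x / (1 + q k x)} \<union> {x \<in> space P. c \<le> q k x}"
    proof safe
      fix x assume x: "e \<le> R k x" "\<not> c \<le> q k x"
      show "e / (1 + c) \<le> R k x / (1 + q k x)" using x e q0[of k x] c by (intro frac_le) auto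
    qed
  qed measurable
  also have "\<dots> \<le> measure P {x \<in> space P. e / (1 + c) \<le> R k x / (1 + q k x)} + measure P {x \<in> space P. c \<le> q k x}"
    by (rule measure_Un_le) measurable
  finally show False using k qk by linarith
qed


end

section \<open>Integrals of continuous processes\<close>

text \<open>A process with continuous paths is the limit of its values at grid times, and each
  approximation consists of countably many measurable pieces. Clipping the time extends the process
  to the whole line, and the joint measurability is what Fubini asks for.\<close>

lemma (in prob_space) clipped_process_measurable:
  fixes g :: "real \<Rightarrow> 'a \<Rightarrow> real"
  assumes c: "\<And>x. x \<in> space M \<Longrightarrow> continuous_on {s..t} (\<lambda>r. g r x)"
    and m: "\<And>r. r \<in> {s..t} \<Longrightarrow> g r \<in> borel_measurable M" and st: "s \<le> t"
  shows "(\<lambda>(r, x). g (max s (min t r)) x) \<in> borel_measurable (borel \<Otimes>\<^sub>M M)"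
proof (rule borel_measurable_LIMSEQ_metric)
  define z where "z k i = max s (min t (real_of_int i / real (Suc k)))" for k i
  show "(\<lambda>(r, x). g (z k \<lfloor>r * real (Suc k)\<rfloor>) x) \<in> borel_measurable (borel \<Otimes>\<^sub>M M)" for k
  proof -
    have "(\<lambda>p. (\<lambda>i p. g (z k i) (snd p)) \<lfloor>fst p * real (Suc k)\<rfloor> p) \<in> borel_measurable (borel \<Otimes>\<^sub>M M)"
    proof (rule measurable_compose_countable)
      fix i
      have [measurable]: "g (z k i) \<in> borel_measurable M" using st by (intro m) (auto simp: z_def)
      show "(\<lambda>p. g (z k i) (snd p)) \<in> borel_measurable (borel \<Otimes>\<^sub>M M)" by measurable
    qed measurable
    then show ?thesis by (simp add: split_def)
  qed
  fix p :: "real \<times> 'a" assume "p \<in> space (borel \<Otimes>\<^sub>M M)"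
  then obtain r x where p: "p = (r, x)" and x: "x \<in> space M" by (auto simp: space_pair_measure)
  have "(\<lambda>k. real_of_int \<lfloor>r * real (Suc k)\<rfloor> / real (Suc k)) \<longlonglongrightarrow> r"
  proof (rule tendsto_sandwich)
    show "\<forall>\<^sub>F k in sequentially. r - 1 / real (Suc k) \<le> real_of_int \<lfloor>r * real (Suc k)\<rfloor> / real (Suc k)"
    proof (rule always_eventually, rule allI)
      fix k
      have "r * real (Suc k) - 1 \<le> real_of_int \<lfloor>r * real (Suc k)\<rfloor>" by linarith
      then have "(r * real (Suc k) - 1) / real (Suc k) \<le> real_of_int \<lfloor>r * real (Suc k)\<rfloor> / real (Suc k)"
        by (rule divide_right_mono) simp
      then show "r - 1 / real (Suc k) \<le> real_of_int \<lfloor>r * real (Suc k)\<rfloor> / real (Suc k)"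
        by (simp only: diff_divide_distrib) simp
    qed
    show "\<forall>\<^sub>F k in sequentially. real_of_int \<lfloor>r * real (Suc k)\<rfloor> / real (Suc k) \<le> r"
    proof (rule always_eventually, rule allI)
      fix k
      have "real_of_int \<lfloor>r * real (Suc k)\<rfloor> \<le> r * real (Suc k)" by linarith
      then show "real_of_int \<lfloor>r * real (Suc k)\<rfloor> / real (Suc k) \<le> r"
        by (simp only: pos_divide_le_eq of_nat_0_less_iff zero_less_Suc)
    qed
    have "(\<lambda>k. r - 1 / real (Suc k)) \<longlonglongrightarrow> r - 0"
      using LIMSEQ_inverse_real_of_nat by (intro tendsto_intros) (simp add: inverse_eq_divide)
    then show "(\<lambda>k. r - 1 / real (Suc k)) \<longlonglongrightarrow> r" by simp
  qed auto
  then have "(\<lambda>k. z k \<lfloor>r * real (Suc k)\<rfloor>) \<longlonglongrightarrow> max s (min t r)"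
    unfolding z_def by (intro tendsto_intros)
  moreover have "z k i \<in> {s..t}" for k i using st by (auto simp: z_def)
  moreover have "max s (min t r) \<in> {s..t}" using st by auto
  ultimately have "(\<lambda>k. g (z k \<lfloor>r * real (Suc k)\<rfloor>) x) \<longlonglongrightarrow> g (max s (min t r)) x"
    by (intro continuous_on_tendsto_compose[OF c[OF x]] always_eventually allI)
  then show "(\<lambda>k. (\<lambda>(r, x). g (z k \<lfloor>r * real (Suc k)\<rfloor>) x) p) \<longlonglongrightarrow> (\<lambda>(r, x). g (max s (min t r)) x) p"
    by (simp add: p)
qed

lemma integral_eq_lebesgue_clipped:
  fixes f :: "real \<Rightarrow> real"
  assumes c: "continuous_on {s..t} f"
  shows "integral {s..t} f = (\<integral>r. indicator {s..t} r * f (max s (min t r)) \<partial>lborel)"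
proof -
  have "set_integrable lborel {s..t} f" using c by (rule borel_integrable_atLeastAtMost')
  from set_borel_integral_eq_integral(2)[OF this] have "integral {s..t} f = (\<integral>r. indicator {s..t} r *\<^sub>R f r \<partial>lborel)"
    by (simp add: set_lebesgue_integral_def)
  also have "\<dots> = (\<integral>r. indicator {s..t} r * f (max s (min t r)) \<partial>lborel)"
    by (intro Bochner_Integration.integral_cong) (auto simp: indicator_def)
  finally show ?thesis .
qed

lemma (in prob_space) measurable_integral_process:
  fixes g :: "real \<Rightarrow> 'a \<Rightarrow> real"
  assumes c: "\<And>x. x \<in> space M \<Longrightarrow> continuous_on {s..t} (\<lambda>r. g r x)"
    and m: "\<And>r. r \<in> {s..t} \<Longrightarrow> g r \<in> borel_measurable M" and st: "s \<le> t"
  shows "(\<lambda>x. integral {s..t} (\<lambda>r. g r x)) \<in> borel_measurable M"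
proof -
  have [measurable]: "(\<lambda>(r, x). g (max s (min t r)) x) \<in> borel_measurable (lborel \<Otimes>\<^sub>M M)"
    using clipped_process_measurable[OF c m st] by simp
  have "(\<lambda>(x, r). g (max s (min t r)) x) \<in> borel_measurable (M \<Otimes>\<^sub>M lborel)"
    using measurable_compose[OF measurable_pair_swap'[of M lborel], of "\<lambda>(r, x). g (max s (min t r)) x" borel] by (simp add: split_def)
  then have [measurable]: "(\<lambda>p. g (max s (min t (snd p))) (fst p)) \<in> borel_measurable (M \<Otimes>\<^sub>M lborel)"
    by (simp add: split_def)
  have "(\<lambda>x. \<integral>r. indicator {s..t} r * g (max s (min t r)) x \<partial>lborel) \<in> borel_measurable M"
    by (rule lborel.borel_measurable_lebesgue_integral) (simp add: split_def)
  moreover have "integral {s..t} (\<lambda>r. g r x) = (\<integral>r. indicator {s..t} r * g (max s (min t r)) x \<partial>lborel)" if "x \<in> space M" for x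
    by (rule integral_eq_lebesgue_clipped[OF c[OF that]])
  ultimately show ?thesis by (simp cong: measurable_cong)
qed

text \<open>The bound \<open>C\<close>, uniform in \<open>r\<close>, gives integrability on the
  product space and hence Fubini. The last conclusion has the shape of the hypothesis on
  \<open>C\<close>, so the lemma can be applied again to nested time integrals.\<close>

lemma (in prob_space) expectation_integral_process:
  fixes g :: "real \<Rightarrow> 'a \<Rightarrow> real"
  assumes c: "\<And>x. x \<in> space M \<Longrightarrow> continuous_on {s..t} (\<lambda>r. g r x)"
    and st: "s \<le> t"
    and i: "\<And>r. r \<in> {s..t} \<Longrightarrow> integrable M (g r)"
    and b: "\<And>r. r \<in> {s..t} \<Longrightarrow> expectation (\<lambda>x. \<bar>g r x\<bar>) \<le> C"
  shows "integrable M (\<lambda>x. integral {s..t} (\<lambda>r. g r x))"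
    and "expectation (\<lambda>x. integral {s..t} (\<lambda>r. g r x)) = integral {s..t} (\<lambda>r. expectation (g r))"
    and "expectation (\<lambda>x. \<bar>integral {s..t} (\<lambda>r. g r x)\<bar>) \<le> C * (t - s)"
proof -
  interpret pair: pair_sigma_finite lborel M ..
  have gm: "(\<lambda>(r, x). g (max s (min t r)) x) \<in> borel_measurable (lborel \<Otimes>\<^sub>M M)"
    using clipped_process_measurable[OF c borel_measurable_integrable[OF i] st] by simp
  then have [measurable]: "(\<lambda>p. g (max s (min t (fst p))) (snd p)) \<in> borel_measurable (lborel \<Otimes>\<^sub>M M)"
    by (simp add: split_def)
  define G where "G r x = indicator {s..t} r * g (max s (min t r)) x" for r x
  have Gm[measurable]: "case_prod G \<in> borel_measurable (lborel \<Otimes>\<^sub>M M)"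
    unfolding G_def split_def by measurable
  have clip: "max s (min t r) \<in> {s..t}" for r using st by auto
  have Gi: "integrable M (G r)" for r unfolding G_def using i[OF clip] by auto
  have EGr: "expectation (G r) = indicator {s..t} r *\<^sub>R expectation (g r)" for r
  proof (cases "r \<in> {s..t}")
    case True
    then have "G r = g r" by (auto simp: G_def fun_eq_iff)
    then show ?thesis using True by simp
  next
    case False
    then have "G r = (\<lambda>_. 0)" by (auto simp: G_def fun_eq_iff)
    then show ?thesis using False by simp
  qed
  have EG: "expectation (\<lambda>x. \<bar>G r x\<bar>) = indicator {s..t} r * expectation (\<lambda>x. \<bar>g (max s (min t r)) x\<bar>)" for r
    by (simp add: G_def abs_mult)
  have int: "integrable lborel (\<lambda>r. \<integral>x. norm (case_prod G (r, x)) \<partial>M)"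
  proof (rule Bochner_Integration.integrable_bound[where f = "\<lambda>r. indicator {s..t} r * C"])
    show "integrable lborel (\<lambda>r. indicator {s..t} r * C)"
      by (intro integrable_mult_left integrable_real_indicator) (auto simp: emeasure_lborel_Icc_eq)
    show "(\<lambda>r. \<integral>x. norm (case_prod G (r, x)) \<partial>M) \<in> borel_measurable lborel"
      by measurable
    show "AE r in lborel. norm (\<integral>x. norm (case_prod G (r, x)) \<partial>M) \<le> norm (indicator {s..t} r * C)"
    proof (rule AE_I2)
      fix r
      have "0 \<le> expectation (\<lambda>x. \<bar>g (max s (min t r)) x\<bar>)" by simp
      then show "norm (\<integral>x. norm (case_prod G (r, x)) \<partial>M) \<le> norm (indicator {s..t} r * C)"
        using b[OF clip, of r] by (auto simp: EG abs_mult indicator_def)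
    qed
  qed
  have GI: "integrable (lborel \<Otimes>\<^sub>M M) (case_prod G)"
    by (rule pair.Fubini_integrable[OF Gm int]) (simp add: Gi)
  have eq: "integral {s..t} (\<lambda>r. g r x) = (\<integral>r. G r x \<partial>lborel)" if "x \<in> space M" for x
    unfolding G_def by (rule integral_eq_lebesgue_clipped[OF c[OF that]])
  have I: "integrable M (\<lambda>x. \<integral>r. G r x \<partial>lborel)" by (rule pair.integrable_snd[OF GI])
  show I': "integrable M (\<lambda>x. integral {s..t} (\<lambda>r. g r x))"
    using I eq by (simp cong: Bochner_Integration.integrable_cong)
  have Eset: "set_integrable lborel {s..t} (\<lambda>r. expectation (g r))"
  proof -
    have "integrable lborel (\<lambda>r. expectation (G r))" by (rule pair.integrable_fst[OF GI])
    then show ?thesis by (simp add: set_integrable_def EGr)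
  qed
  have "expectation (\<lambda>x. integral {s..t} (\<lambda>r. g r x)) = expectation (\<lambda>x. \<integral>r. G r x \<partial>lborel)"
    using eq by (simp cong: Bochner_Integration.integral_cong)
  also have "\<dots> = (\<integral>r. expectation (G r) \<partial>lborel)" using pair.Fubini_integral[OF GI] by simp
  also have "\<dots> = (LINT r:{s..t}|lborel. expectation (g r))"
    unfolding set_lebesgue_integral_def EGr ..
  also have "\<dots> = integral {s..t} (\<lambda>r. expectation (g r))" by (rule set_borel_integral_eq_integral(2)[OF Eset])
  finally show "expectation (\<lambda>x. integral {s..t} (\<lambda>r. g r x)) = integral {s..t} (\<lambda>r. expectation (g r))" .
  have GA: "integrable (lborel \<Otimes>\<^sub>M M) (\<lambda>(r, x). \<bar>G r x\<bar>)" using integrable_abs[OF GI] by (simp add: split_def)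
  have "expectation (\<lambda>x. \<bar>integral {s..t} (\<lambda>r. g r x)\<bar>) = expectation (\<lambda>x. \<bar>\<integral>r. G r x \<partial>lborel\<bar>)"
    using eq by (simp cong: Bochner_Integration.integral_cong)
  also have "\<dots> \<le> expectation (\<lambda>x. \<integral>r. \<bar>G r x\<bar> \<partial>lborel)"
  proof (rule integral_mono)
    show "integrable M (\<lambda>x. \<integral>r. \<bar>G r x\<bar> \<partial>lborel)" using pair.integrable_snd[OF GA] .
    show "\<bar>\<integral>r. G r x \<partial>lborel\<bar> \<le> (\<integral>r. \<bar>G r x\<bar> \<partial>lborel)" for x by (rule integral_abs_bound)
  qed (use I in auto)
  also have "\<dots> = (\<integral>r. expectation (\<lambda>x. \<bar>G r x\<bar>) \<partial>lborel)" using pair.Fubini_integral[OF GA] by simp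
  also have "\<dots> \<le> (\<integral>r. indicator {s..t} r * C \<partial>lborel)"
  proof (rule integral_mono)
    show "integrable lborel (\<lambda>r. expectation (\<lambda>x. \<bar>G r x\<bar>))" using int by simp
    show "expectation (\<lambda>x. \<bar>G r x\<bar>) \<le> indicator {s..t} r * C" for r
      unfolding EG using b[OF clip, of r] by (auto simp: indicator_def)
    show "integrable lborel (\<lambda>r. indicator {s..t} r * C)"
      by (intro integrable_mult_left integrable_real_indicator) (auto simp: emeasure_lborel_Icc_eq)
  qed
  also have "\<dots> = C * (t - s)" using st by simp
  finally show "expectation (\<lambda>x. \<bar>integral {s..t} (\<lambda>r. g r x)\<bar>) \<le> C * (t - s)" .
qed

section \<open>Iterated Stratonovich integrals\<close>

lemma (in prob_space) mesh_limit_cong_AE: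
  assumes S[measurable]: "\<And>D. D division_of {s..u} \<Longrightarrow> S D \<in> borel_measurable M"
      "\<And>D. D division_of {s..u} \<Longrightarrow> S' D \<in> borel_measurable M"
    and L[measurable]: "L \<in> borel_measurable M"
    and eq: "\<And>D. D division_of {s..u} \<Longrightarrow> AE x in M. S D x = S' D x"
    and lim: "mesh_limit_in_prob M s u S L"
  shows "mesh_limit_in_prob M s u S' L"
  unfolding mesh_limit_in_prob_def
proof (intro allI impI)
  fix e y :: real assume ey: "e > 0" "y > 0"
  obtain d where d: "d > 0" "\<And>D. D division_of {s..u} \<Longrightarrow> (\<forall>K\<in>D. Sup K - Inf K < d) \<Longrightarrow>
     measure M {x \<in> space M. e \<le> \<bar>S D x - L x\<bar>} < y"
    using lim[unfolded mesh_limit_in_prob_def, rule_format, OF ey] by blast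
  have "measure M {x \<in> space M. e \<le> \<bar>S' D x - L x\<bar>} = measure M {x \<in> space M. e \<le> \<bar>S D x - L x\<bar>}"
    if D: "D division_of {s..u}" for D
  proof (rule finite_measure_eq_AE)
    show "AE x in M. x \<in> {x \<in> space M. e \<le> \<bar>S' D x - L x\<bar>} \<longleftrightarrow> x \<in> {x \<in> space M. e \<le> \<bar>S D x - L x\<bar>}"
      using eq[OF D] by eventually_elim auto
  qed (use S(1)[OF D] S(2)[OF D] in \<open>measurable\<close>)
  with d show "\<exists>d>0. \<forall>D. D division_of {s..u} \<and> (\<forall>K\<in>D. Sup K - Inf K < d) \<longrightarrow>
      measure M {x \<in> space M. e \<le> \<bar>S' D x - L x\<bar>} < y"
    by (intro exI[of _ d]) simp
qed

context increment_process
begin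

lemma jint_measurable:
  "u \<in> {s..t} \<Longrightarrow> (\<lambda>x. jint (\<lambda>r. N r x) s w k u) \<in> borel_measurable P"
proof (induction w arbitrary: k u)
  case Nil
  then have [measurable]: "N u \<in> borel_measurable P" "N s \<in> borel_measurable P" using st meas by auto
  show ?case by simp
next
  case (Cons i w)
  show ?case
  proof (cases "i = 0")
    case True
    have "(\<lambda>x. integral {s..u} (\<lambda>r. jint (\<lambda>r. N r x) s w 0 r * ((N u x - N r x) ^ k / fact k))) \<in> borel_measurable P"
    proof (rule measurable_integral_process)
      fix x assume x: "x \<in> space P"
      have "{s..u} \<subseteq> {s..t}" using Cons.prems by auto
      then show "continuous_on {s..u} (\<lambda>r. jint (\<lambda>r. N r x) s w 0 r * ((N u x - N r x) ^ k / fact k))"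
        using continuous_on_subset[OF cont[OF x]] continuous_on_subset[OF continuous_on_jint[OF cont[OF x]]]
        by (intro continuous_intros) auto
    next
      fix r assume r: "r \<in> {s..u}"
      then have [measurable]: "N u \<in> borel_measurable P" "N r \<in> borel_measurable P"
        "(\<lambda>x. jint (\<lambda>r. N r x) s w 0 r) \<in> borel_measurable P"
        using Cons by (auto intro: meas)
      show "(\<lambda>x. jint (\<lambda>r. N r x) s w 0 r * ((N u x - N r x) ^ k / fact k)) \<in> borel_measurable P"
        by measurable
    qed (use Cons.prems in auto)
    then show ?thesis using True by simp
  next
    case False
    then show ?thesis using Cons.IH[OF Cons.prems, of "Suc k"] by simp
  qed
qed

text \<open>Since \<open>stratonovich\<close> is a choice, a process with the defining properties
  must first be exhibited: the functional \<open>Y'\<close> of the everywhere continuous process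
  \<open>N\<close>. The chosen process is a limit of the same sums, so it agrees with
  \<open>Y'\<close> almost surely at each time. Equality at fixed times is enough for the induction,
  as a trapezoidal sum involves only finitely many of them.\<close>

lemma iter_strat_rev_AE:
  assumes M: "\<And>r. r \<in> {s..t} \<Longrightarrow> M r \<in> borel_measurable P" "\<And>r. r \<in> {s..t} \<Longrightarrow> AE x in P. M r x = N r x"
  assumes "u \<in> {s..t}"
  shows "iter_strat_rev P M s t w u \<in> borel_measurable P \<and>
    (AE x in P. iter_strat_rev P M s t w u x = jint (\<lambda>r. N r x) s w 0 u)"
  using \<open>u \<in> {s..t}\<close>
proof (induction w arbitrary: u)
  case Nil
  show ?case by simp
next
  case (Cons i w)
  define X Z Z' X' Y' where "X = iter_strat_rev P M s t w" and "Z = letter_process M i" and "Z' = letter_process N i"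
    and "X' = (\<lambda>r x. jint (\<lambda>r. N r x) s w 0 r)" and "Y' = (\<lambda>r x. jint (\<lambda>r. N r x) s (i # w) 0 r)"
  have X: "X r \<in> borel_measurable P" "AE x in P. X' r x = X r x" if "r \<in> {s..t}" for r
    using Cons.IH[OF that] by (auto simp: X_def X'_def)
  have Z: "Z r \<in> borel_measurable P" "Z' r \<in> borel_measurable P" "AE x in P. Z' r x = Z r x" if "r \<in> {s..t}" for r
    using M[OF that] meas[OF that] by (auto simp: Z_def Z'_def letter_process_def)
  have X'm: "X' r \<in> borel_measurable P" and Y'm: "Y' r \<in> borel_measurable P" if "r \<in> {s..t}" for r
    using jint_measurable[OF that] by (simp_all only: X'_def Y'_def)
  have Ym: "mesh_limit_in_prob P s u
      (\<lambda>D x. \<Sum>K\<in>D. (X (Inf K) x + X (Sup K) x) / 2 * (Z (Sup K) x - Z (Inf K) x)) (Y' u)"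
    if u: "u \<in> {s..t}" for u
  proof (rule mesh_limit_cong_AE)
    have "mesh_limit_in_prob P s u
      (\<lambda>D x. \<Sum>K\<in>D. (X' (Inf K) x + X' (Sup K) x) / 2 * (Z' (Sup K) x - Z' (Inf K) x)) (\<lambda>x. Y' u x - Y' s x)"
    proof (rule mesh_limit_trapezoid[OF X'm Z(2) Y'm _ u])
      fix x assume x: "x \<in> space P"
      have "(\<lambda>r. Z' r x) = letter_path (\<lambda>r. N r x) i" by (auto simp: Z'_def letter_process_def letter_path_def)
      then show "trapezoid (\<lambda>r. N r x) s t (\<lambda>r. X' r x) (\<lambda>r. Z' r x) (\<lambda>r. Y' r x)"
        using trapezoid_jint_Cons[OF cont[OF x]] by (simp only: X'_def Y'_def eta_contract_eq)
    qed
    then show "mesh_limit_in_prob P s u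
      (\<lambda>D x. \<Sum>K\<in>D. (X' (Inf K) x + X' (Sup K) x) / 2 * (Z' (Sup K) x - Z' (Inf K) x)) (Y' u)"
      by (simp only: Y'_def jint_Cons_start diff_zero)
    show "Y' u \<in> borel_measurable P" by (rule Y'm[OF u])
    fix D assume D: "D division_of {s..u}"
    have mem: "Inf K \<in> {s..t}" "Sup K \<in> {s..t}" if "K \<in> D" for K using division_interval[OF D that] u by auto
    show "(\<lambda>x. \<Sum>K\<in>D. (X' (Inf K) x + X' (Sup K) x) / 2 * (Z' (Sup K) x - Z' (Inf K) x)) \<in> borel_measurable P"
      by (intro borel_measurable_sum borel_measurable_times borel_measurable_divide borel_measurable_add
          borel_measurable_diff X'm Z mem) auto
    show "(\<lambda>x. \<Sum>K\<in>D. (X (Inf K) x + X (Sup K) x) / 2 * (Z (Sup K) x - Z (Inf K) x)) \<in> borel_measurable P"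
      by (intro borel_measurable_sum borel_measurable_times borel_measurable_divide borel_measurable_add
          borel_measurable_diff X Z mem) auto
    have "AE x in P. \<forall>K\<in>D. X' (Inf K) x = X (Inf K) x \<and> X' (Sup K) x = X (Sup K) x
        \<and> Z' (Inf K) x = Z (Inf K) x \<and> Z' (Sup K) x = Z (Sup K) x"
      using division_of_finite[OF D] by (intro AE_finite_allI AE_conjI X Z mem)
    then show "AE x in P. (\<Sum>K\<in>D. (X' (Inf K) x + X' (Sup K) x) / 2 * (Z' (Sup K) x - Z' (Inf K) x))
        = (\<Sum>K\<in>D. (X (Inf K) x + X (Sup K) x) / 2 * (Z (Sup K) x - Z (Inf K) x))"
      by eventually_elim (auto intro: sum.cong)
  qed
  have "is_stratonovich P s t X Z Y'"
    unfolding is_stratonovich_def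
  proof (intro conjI ballI)
    show "continuous_on {s..t} (\<lambda>u. Y' u x)" if "x \<in> space P" for x
      using continuous_on_jint[OF cont[OF that], of "i # w" 0] by (simp only: Y'_def eta_contract_eq)
  qed (use Y'm Ym in blast)+
  then have "is_stratonovich P s t X Z (stratonovich P s t X Z)"
    unfolding stratonovich_def by (rule someI[of "is_stratonovich P s t X Z"])
  then have Y: "stratonovich P s t X Z u \<in> borel_measurable P" "mesh_limit_in_prob P s u
      (\<lambda>D x. \<Sum>K\<in>D. (X (Inf K) x + X (Sup K) x) / 2 * (Z (Sup K) x - Z (Inf K) x)) (stratonovich P s t X Z u)"
    using Cons.prems unfolding is_stratonovich_def by blast+
  have "AE x in P. stratonovich P s t X Z u x = Y' u x"
  proof (rule mesh_limit_unique[OF prob_space_axioms _ _ Y(1) Y'm Y(2) Ym])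
    fix D assume D: "D division_of {s..u}"
    have mem: "Inf K \<in> {s..t}" "Sup K \<in> {s..t}" if "K \<in> D" for K
      using division_interval[OF D that] Cons.prems by auto
    show "(\<lambda>x. \<Sum>K\<in>D. (X (Inf K) x + X (Sup K) x) / 2 * (Z (Sup K) x - Z (Inf K) x)) \<in> borel_measurable P"
      by (intro borel_measurable_sum borel_measurable_times borel_measurable_divide borel_measurable_add
          borel_measurable_diff X Z mem) auto
  qed (use Cons.prems in auto)
  then show ?case using Y(1) by (simp add: X_def Z_def Y'_def del: jint.simps)
qed

end

section \<open>Moments of the martingale side\<close>

lemma words_upto_0: "words_upto 0 = {[]}"
  by (auto simp: words_upto_def word_weight_def)

lemma words_upto_1: "words_upto (Suc 0) = {[], [1]}"
proof -
  have "\<alpha> = [] \<or> \<alpha> = [1]" if "\<alpha> \<in> words_upto (Suc 0)" for \<alpha>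
    using that by (cases \<alpha>) (auto simp: words_upto_def word_weight_def split: if_splits)
  then show ?thesis by (auto simp: words_upto_def word_weight_def)
qed

text \<open>A leading 1 uses up one unit of weight and a leading 0 two.\<close>

lemma words_upto_Suc_Suc:
  "words_upto (Suc (Suc n)) = {[]} \<union> Cons 1 ` words_upto (Suc n) \<union> Cons 0 ` words_upto n"
proof -
  have "\<alpha> \<in> words_upto (Suc (Suc n)) \<longleftrightarrow>
      \<alpha> \<in> {[]} \<union> Cons 1 ` words_upto (Suc n) \<union> Cons 0 ` words_upto n" for \<alpha>
    by (cases \<alpha>) (auto simp: words_upto_def word_weight_def image_iff)
  then show ?thesis by blast
qed

lemma words_upto_5:
  "words_upto 5 = {[], [1], [0], [1,1], [0,1], [1,0], [1,1,1], [0,0], [0,1,1], [1,0,1], [1,1,0], [1,1,1,1],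
     [0,0,1], [0,1,0], [1,0,0], [0,1,1,1], [1,0,1,1], [1,1,0,1], [1,1,1,0], [1,1,1,1,1]}"
proof -
  have "5 = Suc (Suc (Suc (Suc (Suc 0))))" by simp
  then show ?thesis
    by (simp only: words_upto_Suc_Suc words_upto_1 words_upto_0) auto
qed

section \<open>Moments of adjacent Gaussian increments\<close>

text \<open>Arbitrary coefficients \<open>a\<close>, \<open>b\<close> for two adjacent increments
  are what joint Gaussianity offers and what polarization consumes. \<open>mean\<close> covers all
  subintervals, because nested time integrals contain increments between two variable times.\<close>

locale gaussian_increments = increment_process +
  assumes pow_int: "s \<le> r \<Longrightarrow> r \<le> t \<Longrightarrow> integrable P (\<lambda>x. (a * (N r x - N s x) + b * (N t x - N r x)) ^ k)"
    and pow_odd: "s \<le> r \<Longrightarrow> r \<le> t \<Longrightarrow> odd k \<Longrightarrow>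
      expectation (\<lambda>x. (a * (N r x - N s x) + b * (N t x - N r x)) ^ k) = 0"
    and pow_4: "s \<le> u \<Longrightarrow> u \<le> v \<Longrightarrow> v \<le> t \<Longrightarrow> expectation (\<lambda>x. (N v x - N u x) ^ 4) = 3 * (V v - V u)\<^sup>2"
    and mean: "s \<le> u \<Longrightarrow> u \<le> v \<Longrightarrow> v \<le> t \<Longrightarrow>
      integrable P (\<lambda>x. N v x - N u x) \<and> expectation (\<lambda>x. N v x - N u x) = 0"
begin

lemma V_mono:
  assumes "s \<le> u" "u \<le> v" "v \<le> t" shows "V u \<le> V v"
proof -
  have "0 \<le> expectation (\<lambda>x. (N v x - N u x)\<^sup>2)" by simp
  then show ?thesis using sq_exp[OF assms] by simp
qed

lemma pow_int_left: "s \<le> r \<Longrightarrow> r \<le> t \<Longrightarrow> integrable P (\<lambda>x. (N r x - N s x) ^ k)"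
  using pow_int[of r 1 0 k] by simp

lemma pow_int_right: "s \<le> r \<Longrightarrow> r \<le> t \<Longrightarrow> integrable P (\<lambda>x. (N t x - N r x) ^ k)"
  using pow_int[of r 0 1 k] by simp

text \<open>With \<open>w\<close> the largest of 1 and the two absolute values, the monomial is at
  most \<open>w ^ 4\<close>, which equals one of the three summands.\<close>

lemma abs_prod_powers_le:
  fixes y z :: real
  assumes "i + j \<le> 4"
  shows "\<bar>y ^ i * z ^ j\<bar> \<le> 1 + y ^ 4 + z ^ 4"
proof -
  define w where "w = max 1 (max \<bar>y\<bar> \<bar>z\<bar>)"
  have w: "1 \<le> w" "\<bar>y\<bar> \<le> w" "\<bar>z\<bar> \<le> w" by (auto simp: w_def)
  have "\<bar>y ^ i * z ^ j\<bar> \<le> w ^ i * w ^ j"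
    unfolding abs_mult power_abs using w by (intro mult_mono power_mono) auto
  also have "\<dots> \<le> w ^ 4" unfolding power_add[symmetric] using w assms by (intro power_increasing) auto
  also have "\<dots> \<le> 1 + y ^ 4 + z ^ 4"
    unfolding w_def max_def by (auto simp: power_even_abs)
  finally show ?thesis .
qed

text \<open>Fourth moments dominate all monomials of degree at most four. The bound is uniform in
  \<open>r\<close>, as Fubini requires.\<close>

lemma product_moment_bound:
  assumes "i + j \<le> 4" "s \<le> r" "r \<le> t"
  shows "integrable P (\<lambda>x. (N r x - N s x) ^ i * (N t x - N r x) ^ j)"
    and "expectation (\<lambda>x. \<bar>(N r x - N s x) ^ i * (N t x - N r x) ^ j\<bar>) \<le> 1 + 6 * (V t - V s)\<^sup>2"
proof -
  let ?w = "\<lambda>x. 1 + (N r x - N s x) ^ 4 + (N t x - N r x) ^ 4"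
  have w: "integrable P ?w"
    using assms by (intro Bochner_Integration.integrable_add pow_int_left pow_int_right) auto
  have [measurable]: "N r \<in> borel_measurable P" "N s \<in> borel_measurable P" "N t \<in> borel_measurable P"
    using st assms by (auto intro!: meas)
  have le: "\<bar>(N r x - N s x) ^ i * (N t x - N r x) ^ j\<bar> \<le> ?w x" for x
    by (rule abs_prod_powers_le[OF assms(1)])
  show int: "integrable P (\<lambda>x. (N r x - N s x) ^ i * (N t x - N r x) ^ j)"
    by (rule Bochner_Integration.integrable_bound[OF w])
      (use le in \<open>auto intro!: AE_I2 intro: order_trans[OF _ abs_ge_self]\<close>)
  have "expectation (\<lambda>x. \<bar>(N r x - N s x) ^ i * (N t x - N r x) ^ j\<bar>) \<le> expectation ?w"
    by (rule integral_mono[OF integrable_abs[OF int] w le])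
  also have "\<dots> = 1 + 3 * (V r - V s)\<^sup>2 + 3 * (V t - V r)\<^sup>2"
    using assms pow_int_left[of r 4] pow_int_right[of r 4]
    by (simp add: pow_4 prob_space)
  also have "\<dots> \<le> 1 + 6 * (V t - V s)\<^sup>2"
  proof -
    have "(V r - V s)\<^sup>2 \<le> (V t - V s)\<^sup>2" "(V t - V r)\<^sup>2 \<le> (V t - V s)\<^sup>2"
      using V_mono[of s r] V_mono[of r t] V_mono[of s t] assms by (intro power_mono; simp)+
    then show ?thesis by simp
  qed
  finally show "expectation (\<lambda>x. \<bar>(N r x - N s x) ^ i * (N t x - N r x) ^ j\<bar>) \<le> 1 + 6 * (V t - V s)\<^sup>2" .
qed

text \<open>The mixed moments follow by polarization, so no independence of increments is needed.\<close>

lemma product_moment_odd: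
  assumes "i + j \<le> 3" "odd (i + j)" "s \<le> r" "r \<le> t"
  shows "expectation (\<lambda>x. (N r x - N s x) ^ i * (N t x - N r x) ^ j) = 0"
proof -
  define A where "A x = N r x - N s x" for x
  define D where "D x = N t x - N r x" for x
  have I: "integrable P (\<lambda>x. (a * A x + b * D x) ^ k)" for a b k
    unfolding A_def D_def using pow_int[OF assms(3,4)] .
  have O: "expectation (\<lambda>x. (a * A x + b * D x) ^ k) = 0" if "odd k" for a b k
    unfolding A_def D_def using pow_odd[OF assms(3,4) that] .
  have one: "expectation A = 0" "expectation D = 0" using O[of 1 1 0] O[of 1 0 1] by simp_all
  have three: "expectation (\<lambda>x. A x ^ 3) = 0" "expectation (\<lambda>x. D x ^ 3) = 0"
    using O[of 3 1 0] O[of 3 0 1] by simp_all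
  have "(A x)\<^sup>2 * D x = ((1 * A x + 1 * D x) ^ 3 - (1 * A x + (-1) * D x) ^ 3 - 2 * (0 * A x + 1 * D x) ^ 3) / 6" for x
    by (simp add: power2_eq_square power3_eq_cube algebra_simps)
  then have 21: "expectation (\<lambda>x. (A x)\<^sup>2 * D x) = 0"
    using I[of _ _ 3] O[of 3] O[of 3 1 1] O[of 3 1 "-1"] three by (simp only: integral_divide_zero Bochner_Integration.integral_diff
      Bochner_Integration.integrable_diff integrable_mult_right integral_mult_right_zero) simp
  have "A x * (D x)\<^sup>2 = ((1 * A x + 1 * D x) ^ 3 + (1 * A x + (-1) * D x) ^ 3 - 2 * (1 * A x + 0 * D x) ^ 3) / 6" for x
    by (simp add: power2_eq_square power3_eq_cube algebra_simps)
  then have 12: "expectation (\<lambda>x. A x * (D x)\<^sup>2) = 0"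
    using I[of _ _ 3] O[of 3] O[of 3 1 1] O[of 3 1 "-1"] three by (simp only: integral_divide_zero Bochner_Integration.integral_diff
      Bochner_Integration.integral_add Bochner_Integration.integrable_add
      Bochner_Integration.integrable_diff integrable_mult_right integral_mult_right_zero) simp
  have "(i, j) \<in> {(1,0), (0,1), (3,0), (0,3), (2,1), (1,2)}"
  proof -
    have "i \<le> 3" "j \<le> 3" using assms by auto
    then have "i \<in> {0,1,2,3}" "j \<in> {0,1,2,3}" by auto
    then show ?thesis using assms(1,2) by auto
  qed
  then show ?thesis using one three 21 12 by (auto simp: A_def[symmetric] D_def[symmetric])
qed

text \<open>Second moments of adjacent increments are additive, so the cross term vanishes.\<close>

lemma product_moment_11:
  assumes "s \<le> r" "r \<le> t"
  shows "expectation (\<lambda>x. (N r x - N s x) * (N t x - N r x)) = 0"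
proof -
  have mem: "s \<in> {s..t}" "r \<in> {s..t}" "t \<in> {s..t}" using assms by auto
  have "(\<lambda>x. (N r x - N s x) * (N t x - N r x)) =
     (\<lambda>x. ((N t x - N s x)\<^sup>2 - (N r x - N s x)\<^sup>2 - (N t x - N r x)\<^sup>2) / 2)"
    by (auto simp: fun_eq_iff power2_eq_square field_simps)
  then show ?thesis
    using assms st sq_int[OF mem(1,3)] sq_int[OF mem(1,2)] sq_int[OF mem(2,3)]
    by (simp add: sq_exp)
qed

lemma expectation_integral_on:
  fixes g :: "real \<Rightarrow> 'a \<Rightarrow> real"
  assumes "u \<le> v"
    and "\<And>x. x \<in> space P \<Longrightarrow> continuous_on {u..v} (\<lambda>r. g r x)"
    and "\<And>r. r \<in> {u..v} \<Longrightarrow> integrable P (g r) \<and> expectation (g r) = e r \<and> expectation (\<lambda>x. \<bar>g r x\<bar>) \<le> C"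
  shows "integrable P (\<lambda>x. integral {u..v} (\<lambda>r. g r x)) \<and>
    expectation (\<lambda>x. integral {u..v} (\<lambda>r. g r x)) = integral {u..v} e \<and>
    expectation (\<lambda>x. \<bar>integral {u..v} (\<lambda>r. g r x)\<bar>) \<le> C * (v - u)"
proof -
  have "integral {u..v} (\<lambda>r. expectation (g r)) = integral {u..v} e"
    using assms(3) by (intro Henstock_Kurzweil_Integration.integral_cong) auto
  then show ?thesis using expectation_integral_process[of u v g C] assms by auto
qed

text \<open>A single letter 0 preceded by \<open>i\<close> and followed by \<open>j\<close> letters
  1 leads to such a time integral, with \<open>p\<close> collecting the factorials;
  \<open>p r = r - s\<close> serves the word \<open>[0,0,1]\<close>.\<close>

lemma expectation_integral_moment:
  assumes ij: "i + j \<le> 3" and p: "continuous_on {s..t} p"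
    and e: "\<And>r. s \<le> r \<Longrightarrow> r \<le> t \<Longrightarrow> expectation (\<lambda>x. (N r x - N s x) ^ i * (N t x - N r x) ^ j) = e r"
  shows "integrable P (\<lambda>x. integral {s..t} (\<lambda>r. p r * ((N r x - N s x) ^ i * (N t x - N r x) ^ j))) \<and>
    expectation (\<lambda>x. integral {s..t} (\<lambda>r. p r * ((N r x - N s x) ^ i * (N t x - N r x) ^ j)))
      = integral {s..t} (\<lambda>r. p r * e r)"
proof -
  obtain B where B: "B \<ge> 1" "\<And>r. r \<in> {s..t} \<Longrightarrow> \<bar>p r\<bar> \<le> B" using continuous_bounded[OF p] by blast
  have ij4: "i + j \<le> 4" using ij by simp
  show ?thesis
  proof (rule conjE[OF expectation_integral_on[OF st, where C = "B * (1 + 6 * (V t - V s)\<^sup>2)"]])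
    fix x assume "x \<in> space P"
    then show "continuous_on {s..t} (\<lambda>r. p r * ((N r x - N s x) ^ i * (N t x - N r x) ^ j))"
      using p cont by (intro continuous_intros) auto
  next
    fix r assume r: "r \<in> {s..t}"
    then have sr: "s \<le> r" "r \<le> t" by auto
    have "expectation (\<lambda>x. \<bar>p r * ((N r x - N s x) ^ i * (N t x - N r x) ^ j)\<bar>) =
       \<bar>p r\<bar> * expectation (\<lambda>x. \<bar>(N r x - N s x) ^ i * (N t x - N r x) ^ j\<bar>)"
      unfolding abs_mult[of "p r"] by simp
    also have "\<dots> \<le> B * (1 + 6 * (V t - V s)\<^sup>2)"
      using B r product_moment_bound(2)[OF ij4 sr] by (intro mult_mono) auto
    finally show "integrable P (\<lambda>x. p r * ((N r x - N s x) ^ i * (N t x - N r x) ^ j)) \<and>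
        expectation (\<lambda>x. p r * ((N r x - N s x) ^ i * (N t x - N r x) ^ j)) = p r * e r \<and>
        expectation (\<lambda>x. \<bar>p r * ((N r x - N s x) ^ i * (N t x - N r x) ^ j)\<bar>) \<le> B * (1 + 6 * (V t - V s)\<^sup>2)"
      using product_moment_bound(1)[OF ij4 sr] e[OF sr] by simp
  qed blast
qed

end

section \<open>Expectations over the process, word by word\<close>

text \<open>The two sides are evaluated separately and meet in this value. Among the words of weight
  at most five with an even number of letters 1, only \<open>[1,0,1]\<close> reaches the final
  0.\<close>

definition moment_value :: "(real \<Rightarrow> real) \<Rightarrow> real \<Rightarrow> real \<Rightarrow> nat list \<Rightarrow> real" where
  "moment_value V s t \<alpha> =
     (if odd (count_list \<alpha> 1) then 0
      else if \<alpha> = [] then 1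
      else if \<alpha> = [0] then t - s
      else if \<alpha> = [0, 0] then (t - s)\<^sup>2 / 2
      else if \<alpha> = [1, 1] then (V t - V s) / 2
      else if \<alpha> = [1, 1, 1, 1] then (V t - V s)\<^sup>2 / 8
      else if \<alpha> = [1, 1, 0] then integral {s..t} (\<lambda>r. V r - V s) / 2
      else if \<alpha> = [0, 1, 1] then ((t - s) * (V t - V s) - integral {s..t} (\<lambda>r. V r - V s)) / 2
      else 0)"

lemma integral_start_diff:
  fixes s t :: real
  assumes "s \<le> t" shows "integral {s..t} (\<lambda>r. r - s) = (t - s)\<^sup>2 / 2"
proof (rule integral_unique)
  have "((\<lambda>r. r - s) has_integral (t - s)\<^sup>2 / 2 - (s - s)\<^sup>2 / 2) {s..t}"
    using assms by (intro fundamental_theorem_of_calculus)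
      (auto intro!: derivative_eq_intros simp: has_real_derivative_iff_has_vector_derivative[symmetric])
  then show "((\<lambda>r. r - s) has_integral (t - s)\<^sup>2 / 2) {s..t}" by simp
qed

lemma integral_end_diff:
  fixes V :: "real \<Rightarrow> real"
  assumes "s \<le> t" "continuous_on {s..t} V"
  shows "integral {s..t} (\<lambda>r. V t - V r) = (t - s) * (V t - V s) - integral {s..t} (\<lambda>r. V r - V s)"
proof -
  have "integral {s..t} (\<lambda>r. (V t - V s) - (V r - V s)) = integral {s..t} (\<lambda>r. V t - V s) - integral {s..t} (\<lambda>r. V r - V s)"
    using assms by (intro integral_diff integrable_continuous_real continuous_intros) auto
  then show ?thesis using assms by simp
qed

context gaussian_increments
begin

text \<open>A bound independent of \<open>u\<close> and \<open>v\<close>, for the inner integrals of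
  \<open>[0,1,0]\<close> and \<open>[1,0,0]\<close>.\<close>

lemma abs_increment_bound:
  assumes "s \<le> u" "u \<le> v" "v \<le> t"
  shows "expectation (\<lambda>x. \<bar>N v x - N u x\<bar>) \<le> 1 + (V t - V s)"
proof -
  have i: "integrable P (\<lambda>x. (N v x - N u x)\<^sup>2)" using assms by (intro sq_int) auto
  have "expectation (\<lambda>x. \<bar>N v x - N u x\<bar>) \<le> expectation (\<lambda>x. 1 + (N v x - N u x)\<^sup>2)"
  proof (rule integral_mono)
    show "\<bar>N v x - N u x\<bar> \<le> 1 + (N v x - N u x)\<^sup>2" for x
    proof -
      have "2 * \<bar>N v x - N u x\<bar> \<le> 1 + (N v x - N u x)\<^sup>2"
        using sum_squares_bound[of 1 "\<bar>N v x - N u x\<bar>"] by simp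
      moreover have "y \<le> 1 + z" if "2 * y \<le> 1 + z" "0 \<le> y" for y z :: real using that by linarith
      ultimately show ?thesis using abs_ge_zero by blast
    qed
  qed (use i mean[OF assms] in auto)
  also have "\<dots> = 1 + (V v - V u)" using i sq_exp[OF assms] by (simp add: prob_space)
  also have "\<dots> \<le> 1 + (V t - V s)" using V_mono[of s u] V_mono[of v t] assms by auto
  finally show ?thesis .
qed

text \<open>The letters 0 decide the method. Without them only moments of \<open>N t - N s\<close>
  occur; one of them, or the word \<open>[0,0,1]\<close>, leaves integrated product moments;
  \<open>[0,1,0]\<close> and \<open>[1,0,0]\<close> take two rounds of Fubini.\<close>

lemma expectation_jint:
  assumes V: "continuous_on {s..t} V" and \<alpha>: "\<alpha> \<in> words_upto 5"
  shows "integrable P (\<lambda>x. jint (\<lambda>r. N r x) s (rev \<alpha>) 0 t) \<and>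
    expectation (\<lambda>x. jint (\<lambda>r. N r x) s (rev \<alpha>) 0 t) = moment_value V s t \<alpha>"
proof -
  let ?R = "\<lambda>\<alpha>. integrable P (\<lambda>x. jint (\<lambda>r. N r x) s (rev \<alpha>) 0 t) \<and>
    expectation (\<lambda>x. jint (\<lambda>r. N r x) s (rev \<alpha>) 0 t) = moment_value V s t \<alpha>"
  have pow: "integrable P (\<lambda>x. (N t x - N s x) ^ k)" for k
    using st by (intro pow_int_left) auto
  have odd: "expectation (\<lambda>x. (N t x - N s x) ^ k) = 0" if "odd k" for k
    using pow_odd[of t k 1 0] st that by simp
  note mom = expectation_integral_moment
  have mv: "moment_value V s t [] = 1" "moment_value V s t [0] = t - s" "moment_value V s t [0, 0] = (t - s)\<^sup>2 / 2"
    "moment_value V s t [1, 1] = (V t - V s) / 2" "moment_value V s t [1, 1, 1, 1] = (V t - V s)\<^sup>2 / 8"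
    "moment_value V s t [1, 1, 0] = integral {s..t} (\<lambda>r. V r - V s) / 2" "moment_value V s t [1, 0, 1] = 0"
    "moment_value V s t [0, 1, 1] = ((t - s) * (V t - V s) - integral {s..t} (\<lambda>r. V r - V s)) / 2"
    by (simp_all add: moment_value_def)
  have mv0: "moment_value V s t \<beta> = 0" if "odd (count_list \<beta> 1)" for \<beta>
    using that by (simp add: moment_value_def)
  have mv1: "moment_value V s t [1] = 0" "moment_value V s t [1,1,1] = 0" "moment_value V s t [1,1,1,1,1] = 0"
    "moment_value V s t [0,1] = 0" "moment_value V s t [1,0] = 0" "moment_value V s t [0,0,1] = 0"
    "moment_value V s t [0,1,0] = 0" "moment_value V s t [1,0,0] = 0" "moment_value V s t [0,1,1,1] = 0"
    "moment_value V s t [1,0,1,1] = 0" "moment_value V s t [1,1,0,1] = 0" "moment_value V s t [1,1,1,0] = 0"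
    by (rule mv0, simp)+
  \<comment> \<open>The integral of 1 over \<open>{s..r}\<close> is evaluated with a conditional on
    \<open>s \<le> r\<close>, which always holds on \<open>{s..t}\<close>.\<close>
  have lin: "integral {s..t} (\<lambda>r. (if s \<le> r then r - s else 0) * c r) = integral {s..t} (\<lambda>r. (r - s) * c r)"
    for c :: "real \<Rightarrow> real" by (intro Henstock_Kurzweil_Integration.integral_cong) auto
  note mv = mv[unfolded One_nat_def] and mv1 = mv1[unfolded One_nat_def]
  have w0: "?R []" "?R [0]" "?R [0,0]"
    using st lin[of "\<lambda>_. 1"] by (simp_all add: mv mv1 prob_space integral_start_diff)
  have odd1: "expectation (\<lambda>x. (N t x - N s x) ^ 1) = 0" and odd3: "expectation (\<lambda>x. (N t x - N s x) ^ 3) = 0"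
    and odd5: "expectation (\<lambda>x. (N t x - N s x) ^ 5) = 0"
    by (rule odd, simp)+
  have w1: "?R [1]" "?R [1,1,1]" "?R [1,1,1,1,1]"
    using pow[of 1] pow[of 3] pow[of 5] odd1 odd3 odd5
    by (simp_all add: mv1 numeral_eq_Suc)
  have w2: "?R [1,1]"
    using pow[of 2] st by (simp add: mv mv1 sq_exp numeral_2_eq_2[symmetric])
  have w4: "?R [1,1,1,1]"
    using pow[of 4] st pow_4[of s t] by (simp add: mv mv1 fact_numeral numeral_eq_Suc)
  have mom0: "integrable P (\<lambda>x. integral {s..t} (\<lambda>r. p r * ((N r x - N s x) ^ i * (N t x - N r x) ^ j))) \<and>
      expectation (\<lambda>x. integral {s..t} (\<lambda>r. p r * ((N r x - N s x) ^ i * (N t x - N r x) ^ j))) = 0"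
    if "i + j \<le> 3" "odd (i + j)" "continuous_on {s..t} p" for i j and p :: "real \<Rightarrow> real"
    using mom[OF that(1,3), of "\<lambda>_. 0"] product_moment_odd[OF that(1,2)] by simp
  have o1: "?R [0,1]" "?R [0,1,1,1]" "?R [1,0]" "?R [1,1,1,0]" "?R [1,1,0,1]" "?R [1,0,1,1]"
    using mom0[of 0 1 "\<lambda>_. 1", simplified] mom0[of 0 3 "\<lambda>_. 1/6", simplified] mom0[of 1 0 "\<lambda>_. 1", simplified]
      mom0[of 3 0 "\<lambda>_. 1/6", simplified] mom0[of 2 1 "\<lambda>_. 1/2", simplified] mom0[of 1 2 "\<lambda>_. 1/2", simplified]
    by (simp_all add: mv1 numeral_eq_Suc)
  have o2: "?R [0,0,1]"
    using mom0[of 0 1 "\<lambda>r. r - s"] by (simp add: mv1 lin continuous_intros)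
  have e1: "?R [1,0,1]"
    using mom[of 1 1 "\<lambda>_. 1" "\<lambda>_. 0"] product_moment_11 by (simp add: mv mv1)
  have e2: "?R [1,1,0]"
    using mom[of 2 0 "\<lambda>_. 1/2" "\<lambda>r. V r - V s"] sq_exp[of s] st
    by (simp add: mv mv1 numeral_eq_Suc)
  have e3: "?R [0,1,1]"
    using mom[of 0 2 "\<lambda>_. 1/2" "\<lambda>r. V t - V r"] sq_exp[of _ t] integral_end_diff[OF st V]
    by (simp add: mv mv1 numeral_eq_Suc)
  define C where "C = (1 + (V t - V s)) * (t - s)"
  \<comment> \<open>For \<open>[0,1,0]\<close> and \<open>[1,0,0]\<close> the outermost integral
    runs over \<open>r\<close>, and \<open>w\<close> is the reversed rest of the word. Its
    functional has mean 0 and an absolute moment bounded uniformly in \<open>r\<close>, so Fubini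
    applies once more.\<close>
  have inner: "integrable P (\<lambda>x. jint (\<lambda>r. N r x) s w 0 r) \<and> expectation (\<lambda>x. jint (\<lambda>r. N r x) s w 0 r) = 0 \<and>
      expectation (\<lambda>x. \<bar>jint (\<lambda>r. N r x) s w 0 r\<bar>) \<le> C" if r: "r \<in> {s..t}" and w: "w = [1, 0] \<or> w = [0, 1]" for r w
  proof -
    have C: "(1 + (V t - V s)) * (r - s) \<le> C"
      unfolding C_def using r V_mono[of s t] by (intro mult_left_mono) auto
    have "integrable P (\<lambda>x. integral {s..r} (\<lambda>q. N r x - N q x)) \<and>
      expectation (\<lambda>x. integral {s..r} (\<lambda>q. N r x - N q x)) = integral {s..r} (\<lambda>_. 0) \<and>
      expectation (\<lambda>x. \<bar>integral {s..r} (\<lambda>q. N r x - N q x)\<bar>) \<le> (1 + (V t - V s)) * (r - s)"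
      using r mean abs_increment_bound
      by (intro expectation_integral_on continuous_intros continuous_on_subset[OF cont]) auto
    moreover have "integrable P (\<lambda>x. integral {s..r} (\<lambda>q. N q x - N s x)) \<and>
      expectation (\<lambda>x. integral {s..r} (\<lambda>q. N q x - N s x)) = integral {s..r} (\<lambda>_. 0) \<and>
      expectation (\<lambda>x. \<bar>integral {s..r} (\<lambda>q. N q x - N s x)\<bar>) \<le> (1 + (V t - V s)) * (r - s)"
      using r mean abs_increment_bound
      by (intro expectation_integral_on continuous_intros continuous_on_subset[OF cont]) auto
    ultimately show ?thesis using w C by auto
  qed
  have d: "?R [0,1,0]" "?R [1,0,0]"
  proof -
    have "integrable P (\<lambda>x. integral {s..t} (jint (\<lambda>r. N r x) s w 0)) \<and>
        expectation (\<lambda>x. integral {s..t} (jint (\<lambda>r. N r x) s w 0)) = integral {s..t} (\<lambda>_. 0)"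
      if w: "w = [1, 0] \<or> w = [0, 1]" for w
      using expectation_integral_on[OF st, of "\<lambda>r x. jint (\<lambda>r. N r x) s w 0 r" "\<lambda>_. 0" C]
        continuous_on_jint[OF cont, of _ w 0] inner[OF _ w] by blast
    then have "integrable P (\<lambda>x. jint (\<lambda>r. N r x) s (0 # w) 0 t) \<and>
        expectation (\<lambda>x. jint (\<lambda>r. N r x) s (0 # w) 0 t) = 0" if w: "w = [1, 0] \<or> w = [0, 1]" for w
      using w by (simp only: jint.simps simp_thms if_True power_0 fact_0 div_by_1 mult_1_right integral_0)
    from this[of "[1, 0]"] this[of "[0, 1]"] show "?R [0,1,0]" "?R [1,0,0]"
      by (simp_all add: mv mv1 del: jint.simps)
  qed
  show ?thesis using \<alpha> unfolding words_upto_5 using w0 w1 w2 w4 o1 o2 e1 e2 e3 d by blast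
qed

end

section \<open>From a Gaussian martingale to a continuous version with the required moments\<close>

text \<open>Vanishing expectation forces the mean parameter to be 0, which leaves the moments of a
  centred normal law; a point mass at 0 satisfies the same formulas. Expressing the fourth moment
  through the second removes \<sigma>.\<close>

lemma (in prob_space) centered_gaussian_moments:
  assumes X: "gaussian_rv M X" "X \<in> borel_measurable M" "expectation X = 0"
  shows "integrable M (\<lambda>x. X x ^ k)"
    and "odd k \<Longrightarrow> expectation (\<lambda>x. X x ^ k) = 0"
    and "expectation (\<lambda>x. X x ^ 4) = 3 * (expectation (\<lambda>x. (X x)\<^sup>2))\<^sup>2"
proof -
  have "integrable M (\<lambda>x. X x ^ k) \<and> (odd k \<longrightarrow> expectation (\<lambda>x. X x ^ k) = 0) \<and>
      expectation (\<lambda>x. X x ^ 4) = 3 * (expectation (\<lambda>x. (X x)\<^sup>2))\<^sup>2"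
    using X(1) unfolding gaussian_rv_def
  proof (elim disjE exE conjE)
    fix m \<sigma> assume \<sigma>: "0 < \<sigma>" and D: "distributed M lborel X (normal_density m \<sigma>)"
    have "m = 0" using normal_distributed_expectation[OF \<sigma> D] X(3) by simp
    with D have D: "distributed M lborel X (normal_density 0 \<sigma>)" by simp
    have eq: "expectation (\<lambda>x. X x ^ k) = (\<integral>x. normal_density 0 \<sigma> x * (x - 0) ^ k \<partial>lborel)" for k
      using distributed_integral[OF D, of "\<lambda>x. x ^ k"] by simp
    have "integrable M (\<lambda>x. X x ^ k)"
      using distributed_integrable[OF D, of "\<lambda>x. x ^ k"] integrable_normal_moment[OF \<sigma>, of 0 k] by simp
    moreover have "expectation (\<lambda>x. X x ^ k) = 0" if "odd k"
      using that integral_normal_moment_odd[OF \<sigma>, of 0] unfolding eq by (auto elim: oddE)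
    moreover have "expectation (\<lambda>x. (X x)\<^sup>2) = \<sigma>\<^sup>2"
      using integral_normal_moment_even[OF \<sigma>, of 0 1] unfolding eq by simp
    moreover have "expectation (\<lambda>x. X x ^ 4) = 3 * \<sigma> ^ 4"
      using integral_normal_moment_even[OF \<sigma>, of 0 2] unfolding eq
      by (simp add: fact_numeral power_divide)
    ultimately show ?thesis by (simp add: power_mult[symmetric])
  next
    fix m assume m: "AE x in M. X x = m"
    then have "expectation X = expectation (\<lambda>_. m)" using X(2) by (intro integral_cong_AE) auto
    then have "m = 0" using X(3) by (simp add: prob_space)
    with m have X0: "AE x in M. X x = 0" by simp
    have *: "integrable M (\<lambda>x. X x ^ k) \<and> expectation (\<lambda>x. X x ^ k) = 0 ^ k" for k
    proof -
      have "AE x in M. X x ^ k = 0 ^ k" using X0 by eventually_elim simp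
      then have "integrable M (\<lambda>x. X x ^ k) \<longleftrightarrow> integrable M (\<lambda>_. 0 ^ k :: real)"
        "expectation (\<lambda>x. X x ^ k) = expectation (\<lambda>_. 0 ^ k)"
        using X(2) by (intro integrable_cong_AE integral_cong_AE; simp)+
      then show ?thesis by (simp add: prob_space)
    qed
    show ?thesis using *[of k] *[of 2] *[of 4] by (auto simp: power_0_left)
  qed
  then show "integrable M (\<lambda>x. X x ^ k)" "odd k \<Longrightarrow> expectation (\<lambda>x. X x ^ k) = 0"
    "expectation (\<lambda>x. X x ^ 4) = 3 * (expectation (\<lambda>x. (X x)\<^sup>2))\<^sup>2" by auto
qed

text \<open>The mean is arbitrary here, so the square is expanded around \<open>m\<close>. Square
  integrability of single values makes their products integrable, as the covariance computation for
  the martingale demands.\<close>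

lemma (in prob_space) gaussian_square_integrable:
  assumes X: "gaussian_rv M X" "X \<in> borel_measurable M"
  shows "integrable M (\<lambda>x. (X x)\<^sup>2)"
  using X(1) unfolding gaussian_rv_def
proof (elim disjE exE conjE)
  fix m \<sigma> assume \<sigma>: "0 < \<sigma>" and D: "distributed M lborel X (normal_density m \<sigma>)"
  have i: "integrable M (\<lambda>x. (X x - m) ^ k)" for k
    using distributed_integrable[OF D, of "\<lambda>x. (x - m) ^ k"] integrable_normal_moment[OF \<sigma>, of m k] by simp
  have "(\<lambda>x. (X x)\<^sup>2) = (\<lambda>x. (X x - m) ^ 2 + 2 * m * (X x - m) ^ 1 + m\<^sup>2)"
    by (auto simp: fun_eq_iff power2_eq_square algebra_simps)
  moreover have "integrable M (\<lambda>x. (X x - m) ^ 2 + 2 * m * (X x - m) ^ 1 + m\<^sup>2)"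
    by (intro Bochner_Integration.integrable_add integrable_mult_right i) simp
  ultimately show ?thesis by simp
next
  fix m assume "AE x in M. X x = m"
  then have "AE x in M. (X x)\<^sup>2 = m\<^sup>2" by eventually_elim simp
  then show ?thesis using integrable_cong_AE[of "\<lambda>x. (X x)\<^sup>2" M "\<lambda>_. m\<^sup>2"] X(2) by simp
qed

text \<open>\<open>N\<close> equals \<open>M\<close> off a null set and 0 on it, which makes all
  paths continuous. Conditioning on \<open>F u\<close> gives \<open>M u * M v\<close> the
  expectation \<open>V u\<close>, hence squared increments the expectation \<open>V v - V u\<close>;
  Gaussianity of linear combinations supplies the higher moments.\<close>

lemma gaussian_martingale_increments:
  assumes "prob_space P" and mart: "martingale_upto P F T M" and cont: "continuous_process_upto P T M"
    and gauss: "gaussian_process_upto P T M"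
    and V: "\<And>r. 0 \<le> r \<Longrightarrow> r \<le> T \<Longrightarrow> V r = prob_space.expectation P (\<lambda>x. (M r x)\<^sup>2)"
    and st: "0 \<le> s" "s \<le> t" "t \<le> T"
  obtains N where "gaussian_increments P N s t V"
    "\<And>r. r \<in> {s..t} \<Longrightarrow> AE x in P. M r x = N r x"
proof -
  interpret prob_space P by fact
  have Mm: "M r \<in> borel_measurable P" if "r \<in> {0..T}" for r
    using gauss that unfolding gaussian_process_upto_def by blast
  have comb: "gaussian_rv P (\<lambda>x. \<Sum>r\<in>R. c r * M r x)" if "finite R" "R \<subseteq> {0..T}" for R c
    using gauss that unfolding gaussian_process_upto_def by blast
  have sq: "integrable P (\<lambda>x. (M r x)\<^sup>2)" if r: "r \<in> {0..T}" for r
    using gaussian_square_integrable[OF _ Mm[OF r]] comb[of "{r}" "\<lambda>_. 1"] r by simp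
  have int: "integrable P (M r)" if "r \<in> {0..T}" for r
    using mart that unfolding martingale_upto_def by blast
  have prod: "integrable P (\<lambda>x. M u x * M v x)" if "u \<in> {0..T}" "v \<in> {0..T}" for u v
  proof (rule Bochner_Integration.integrable_bound)
    show "integrable P (\<lambda>x. (M u x)\<^sup>2 + (M v x)\<^sup>2)" using sq that by simp
    show "(\<lambda>x. M u x * M v x) \<in> borel_measurable P" using Mm[OF that(1)] Mm[OF that(2)] by measurable
    have "\<bar>a * b\<bar> \<le> a\<^sup>2 + b\<^sup>2" for a b :: real
    proof -
      have "2 * (\<bar>a\<bar> * \<bar>b\<bar>) \<le> a\<^sup>2 + b\<^sup>2" using sum_squares_bound[of "\<bar>a\<bar>" "\<bar>b\<bar>"] by simp
      moreover have "0 \<le> \<bar>a\<bar> * \<bar>b\<bar>" by simp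
      ultimately show ?thesis unfolding abs_mult by linarith
    qed
    then show "AE x in P. norm (M u x * M v x) \<le> norm ((M u x)\<^sup>2 + (M v x)\<^sup>2)" by simp
  qed
  have cond: "expectation (M v) = expectation (M u) \<and> expectation (\<lambda>x. M u x * M v x) = V u"
    if uv: "0 \<le> u" "u \<le> v" "v \<le> T" for u v
  proof -
    have mem: "u \<in> {0..T}" "v \<in> {u..T}" "v \<in> {0..T}" using uv by auto
    have sub: "subalgebra P (F u)" and MF: "M u \<in> borel_measurable (F u)"
      and ce: "AE x in P. real_cond_exp P (F u) (M v) x = M u x"
      using mart mem unfolding martingale_upto_def by blast+
    interpret S: finite_measure_subalgebra P "F u"
      using sub by unfold_locales
    have "expectation (M v) = expectation (real_cond_exp P (F u) (M v))"
      using S.real_cond_exp_int(2)[OF int[OF mem(3)]] by simp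
    also have "\<dots> = expectation (M u)" using ce Mm[OF mem(1)] by (intro integral_cong_AE) auto
    finally have 1: "expectation (M v) = expectation (M u)" .
    have "expectation (\<lambda>x. M u x * M v x) = expectation (\<lambda>x. M u x * real_cond_exp P (F u) (M v) x)"
      using S.real_cond_exp_intg(2)[OF prod[OF mem(1,3)] MF Mm[OF mem(3)]] by simp
    also have "\<dots> = expectation (\<lambda>x. (M u x)\<^sup>2)"
    proof (rule integral_cong_AE)
      show "AE x in P. M u x * real_cond_exp P (F u) (M v) x = (M u x)\<^sup>2"
        using ce by eventually_elim (simp add: power2_eq_square)
    qed (use Mm[OF mem(1)] in auto)
    finally show ?thesis using 1 V[of u] uv by simp
  qed
  have sq_M: "integrable P (\<lambda>x. (M v x - M u x)\<^sup>2)" if "u \<in> {0..T}" "v \<in> {0..T}" for u v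
    using sq[OF that(1)] sq[OF that(2)] prod[OF that(2,1)] by (simp add: power2_diff mult.assoc)
  have V_M: "expectation (\<lambda>x. (M v x - M u x)\<^sup>2) = V v - V u" if uv: "0 \<le> u" "u \<le> v" "v \<le> T" for u v
  proof -
    have mem: "u \<in> {0..T}" "v \<in> {0..T}" using uv by auto
    have "expectation (\<lambda>x. (M v x - M u x)\<^sup>2) = expectation (\<lambda>x. (M v x)\<^sup>2 + (M u x)\<^sup>2 - 2 * (M u x * M v x))"
      by (simp add: power2_diff mult_ac)
    also have "\<dots> = V v + V u - 2 * V u"
      using sq[OF mem(1)] sq[OF mem(2)] prod[OF mem] cond[OF uv] V[of u] V[of v] uv by simp
    finally show ?thesis by simp
  qed
  have mean_M: "expectation (\<lambda>x. M v x - M u x) = 0" if uv: "0 \<le> u" "u \<le> v" "v \<le> T" for u v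
    using int[of u] int[of v] cond[OF uv] uv by simp
  have Xg: "gaussian_rv P (\<lambda>x. a * (M r x - M s x) + b * (M t x - M r x))"
    if r: "s \<le> r" "r \<le> t" for a b r
  proof -
    \<comment> \<open>Times may coincide, and then the set \<open>{s, r, t}\<close> shrinks. A sum
      of three conditionals still collects the coefficients of equal times.\<close>
    define c where "c q = (if q = r then a - b else 0) + (if q = s then - a else 0) + (if q = t then b else 0)" for q
    have "(\<Sum>q\<in>{s, r, t}. c q * M q x) = a * (M r x - M s x) + b * (M t x - M r x)" for x
    proof -
      have "(\<Sum>q\<in>{s, r, t}. c q * M q x) = (\<Sum>q\<in>{s, r, t}. (if q = r then (a - b) * M q x else 0))
         + (\<Sum>q\<in>{s, r, t}. (if q = s then - a * M q x else 0)) + (\<Sum>q\<in>{s, r, t}. (if q = t then b * M q x else 0))"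
        unfolding sum.distrib[symmetric] c_def by (intro sum.cong) (auto simp: algebra_simps)
      also have "\<dots> = (a - b) * M r x + - a * M s x + b * M t x"
        by (auto simp: algebra_simps)
      finally show ?thesis by (simp add: algebra_simps)
    qed
    then show ?thesis using comb[of "{s, r, t}" c] r st by simp
  qed
  \<comment> \<open>The set of discontinuous paths may fail to be measurable, so it is covered by a
    measurable null set.\<close>
  obtain Z where Z: "{x \<in> space P. \<not> continuous_on {0..T} (\<lambda>r. M r x)} \<subseteq> Z" "Z \<in> null_sets P"
    using cont unfolding continuous_process_upto_def eventually_ae_filter by blast
  define N where "N r x = (if x \<in> Z then 0 else M r x)" for r x
  have AEN: "AE x in P. x \<notin> Z" by (rule AE_not_in[OF Z(2)])
  have MN: "AE x in P. M r x = N r x" for r using AEN by eventually_elim (simp add: N_def)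
  have sub: "r \<in> {0..T}" if "r \<in> {s..t}" for r using that st by auto
  have Nm[measurable]: "N r \<in> borel_measurable P" if "r \<in> {s..t}" for r
  proof -
    have [measurable]: "Z \<in> sets P" "M r \<in> borel_measurable P" using Z Mm[OF sub[OF that]] by auto
    show ?thesis unfolding N_def by measurable
  qed
  have tr: "(integrable P f \<longleftrightarrow> integrable P g) \<and> expectation f = expectation g"
    if "AE x in P. f x = g x" "f \<in> borel_measurable P" "g \<in> borel_measurable P" for f g :: "'a \<Rightarrow> real"
    using integrable_cong_AE[OF that(2,3,1)] integral_cong_AE[OF that(2,3,1)] by blast
  have tr_diff: "(integrable P (\<lambda>x. (N v x - N u x) ^ k) \<longleftrightarrow> integrable P (\<lambda>x. (M v x - M u x) ^ k)) \<and>
      expectation (\<lambda>x. (N v x - N u x) ^ k) = expectation (\<lambda>x. (M v x - M u x) ^ k)"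
    if uv: "u \<in> {s..t}" "v \<in> {s..t}" for u v k
  proof (rule tr)
    show "AE x in P. (N v x - N u x) ^ k = (M v x - M u x) ^ k"
      using MN[of u] MN[of v] by eventually_elim simp
    note [measurable] = Nm[OF uv(1)] Nm[OF uv(2)] Mm[OF sub[OF uv(1)]] Mm[OF sub[OF uv(2)]]
    show "(\<lambda>x. (N v x - N u x) ^ k) \<in> borel_measurable P" "(\<lambda>x. (M v x - M u x) ^ k) \<in> borel_measurable P"
      by measurable
  qed
  have tr_comb: "(integrable P (\<lambda>x. (a * (N r x - N s x) + b * (N t x - N r x)) ^ k) \<longleftrightarrow>
        integrable P (\<lambda>x. (a * (M r x - M s x) + b * (M t x - M r x)) ^ k)) \<and>
      expectation (\<lambda>x. (a * (N r x - N s x) + b * (N t x - N r x)) ^ k) =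
        expectation (\<lambda>x. (a * (M r x - M s x) + b * (M t x - M r x)) ^ k)"
    if r: "r \<in> {s..t}" for r k a b
  proof (rule tr)
    show "AE x in P. (a * (N r x - N s x) + b * (N t x - N r x)) ^ k = (a * (M r x - M s x) + b * (M t x - M r x)) ^ k"
      using MN[of s] MN[of r] MN[of t] by eventually_elim simp
    have "s \<in> {s..t}" "t \<in> {s..t}" using st by auto
    note [measurable] = Nm[OF this(1)] Nm[OF this(2)] Nm[OF r] Mm[OF sub[OF this(1)]] Mm[OF sub[OF this(2)]] Mm[OF sub[OF r]]
    show "(\<lambda>x. (a * (N r x - N s x) + b * (N t x - N r x)) ^ k) \<in> borel_measurable P"
      "(\<lambda>x. (a * (M r x - M s x) + b * (M t x - M r x)) ^ k) \<in> borel_measurable P"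
      by measurable
  qed
  have Xm: "(\<lambda>x. a * (M r x - M s x) + b * (M t x - M r x)) \<in> borel_measurable P"
    and X0: "expectation (\<lambda>x. a * (M r x - M s x) + b * (M t x - M r x)) = 0"
    if r: "s \<le> r" "r \<le> t" for a b r
  proof -
    have mem: "s \<in> {0..T}" "r \<in> {0..T}" "t \<in> {0..T}" using r st by auto
    show "(\<lambda>x. a * (M r x - M s x) + b * (M t x - M r x)) \<in> borel_measurable P"
      using Mm[OF mem(1)] Mm[OF mem(2)] Mm[OF mem(3)] by measurable
    show "expectation (\<lambda>x. a * (M r x - M s x) + b * (M t x - M r x)) = 0"
      using int[OF mem(1)] int[OF mem(2)] int[OF mem(3)] mean_M[of s r] mean_M[of r t] r st by simp
  qed
  note mom = centered_gaussian_moments[OF Xg Xm X0]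
  show ?thesis
  proof (rule that[of N])
    show "gaussian_increments P N s t V"
    proof unfold_locales
      show "continuous_on {s..t} (\<lambda>r. N r x)" if "x \<in> space P" for x
      proof (cases "x \<in> Z")
        case False
        then have "continuous_on {0..T} (\<lambda>r. M r x)" using Z(1) that by blast
        then have "continuous_on {s..t} (\<lambda>r. M r x)" using sub by (auto intro: continuous_on_subset)
        then show ?thesis using False by (simp add: N_def)
      qed (simp add: N_def)
      show "integrable P (\<lambda>x. (N v x - N u x)\<^sup>2)" if "u \<in> {s..t}" "v \<in> {s..t}" for u v
        using tr_diff[OF that, of 2] sq_M[OF sub[OF that(1)] sub[OF that(2)]] by blast
      show "expectation (\<lambda>x. (N v x - N u x)\<^sup>2) = V v - V u" if "s \<le> u" "u \<le> v" "v \<le> t" for u v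
        using tr_diff[of u v 2] V_M[of u v] that st by simp
      show "integrable P (\<lambda>x. (a * (N r x - N s x) + b * (N t x - N r x)) ^ k)" if "s \<le> r" "r \<le> t" for r a b k
        using tr_comb[of r a b k] mom(1)[OF that that that, of a b k] that by simp
      show "expectation (\<lambda>x. (a * (N r x - N s x) + b * (N t x - N r x)) ^ k) = 0" if "s \<le> r" "r \<le> t" "odd k" for r a b k
        using tr_comb[of r a b k] mom(2)[OF that(1,2) that(1,2) that(1,2,3), of a b] that by simp
      show "expectation (\<lambda>x. (N v x - N u x) ^ 4) = 3 * (V v - V u)\<^sup>2" if uv: "s \<le> u" "u \<le> v" "v \<le> t" for u v
      proof -
        \<comment> \<open>For \<open>u = v\<close> the two coefficients cancel at the single
          remaining time.\<close>
        have "(\<Sum>q\<in>{u, v}. ((if q = v then 1 else 0) + (if q = u then - 1 else 0)) * M q x) = M v x - M u x" for x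
          by (cases "u = v") auto
        then have "gaussian_rv P (\<lambda>x. M v x - M u x)"
          using comb[of "{u, v}" "\<lambda>q. (if q = v then 1 else 0) + (if q = u then - 1 else 0)"] uv st by simp
        moreover have "(\<lambda>x. M v x - M u x) \<in> borel_measurable P"
          using Mm[of u] Mm[of v] uv st by (intro borel_measurable_diff) auto
        ultimately have "expectation (\<lambda>x. (M v x - M u x) ^ 4) = 3 * (expectation (\<lambda>x. (M v x - M u x)\<^sup>2))\<^sup>2"
          using mean_M[of u v] uv st by (intro centered_gaussian_moments) auto
        then show ?thesis using tr_diff[of u v 4] V_M[of u v] uv st by simp
      qed
      show "integrable P (\<lambda>x. N v x - N u x) \<and> expectation (\<lambda>x. N v x - N u x) = 0" if "s \<le> u" "u \<le> v" "v \<le> t" for u v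
        using tr_diff[of u v 1] int[of u] int[of v] mean_M[of u v] that st by simp
    qed (use st Nm in auto)
  qed (rule MN)
qed

section \<open>The cubature path\<close>

text \<open>Written in the values at the two ends, so that a piecewise affine path enters only
  through its values at the nodes.\<close>

lemma has_integral_affine:
  fixes u v :: real
  assumes "u \<le> v"
  shows "((\<lambda>r. y + m * (r - u)) has_integral (v - u) * (y + (y + m * (v - u))) / 2) {u..v}"
    and "((\<lambda>r. (y + m * (r - u))\<^sup>2) has_integral
      (v - u) * (y\<^sup>2 + y * (y + m * (v - u)) + (y + m * (v - u))\<^sup>2) / 3) {u..v}"
proof -
  define F G where "F r = y * (r - u) + m * (r - u)\<^sup>2 / 2"
    and "G r = y\<^sup>2 * (r - u) + y * m * (r - u)\<^sup>2 + m\<^sup>2 * (r - u) ^ 3 / 3" for r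
  have "((\<lambda>r. y + m * (r - u)) has_integral F v - F u) {u..v}"
    using assms unfolding F_def by (intro fundamental_theorem_of_calculus)
      (auto intro!: derivative_eq_intros simp: has_real_derivative_iff_has_vector_derivative[symmetric])
  moreover have "F v - F u = (v - u) * (y + (y + m * (v - u))) / 2"
    by (simp add: F_def power2_eq_square field_simps)
  ultimately show "((\<lambda>r. y + m * (r - u)) has_integral (v - u) * (y + (y + m * (v - u))) / 2) {u..v}" by simp
  have "((\<lambda>r. (y + m * (r - u))\<^sup>2) has_integral G v - G u) {u..v}"
    using assms unfolding G_def by (intro fundamental_theorem_of_calculus)
      (auto intro!: derivative_eq_intros simp: has_real_derivative_iff_has_vector_derivative[symmetric]
        power2_eq_square field_simps)
  moreover have "G v - G u = (v - u) * (y\<^sup>2 + y * (y + m * (v - u)) + (y + m * (v - u))\<^sup>2) / 3"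
    by (simp add: G_def power2_eq_square power3_eq_cube field_simps)
  ultimately show "((\<lambda>r. (y + m * (r - u))\<^sup>2) has_integral
      (v - u) * (y\<^sup>2 + y * (y + m * (v - u)) + (y + m * (v - u))\<^sup>2) / 3) {u..v}" by simp
qed

text \<open>\<open>p\<close>, \<open>q\<close> and \<open>e\<close> are the values at the ends of
  the three pieces; the value at the start is 0.\<close>

lemma piecewise_affine_integrals:
  fixes n :: "real \<Rightarrow> real"
  assumes h: "h \<ge> 0"
    and 1: "\<And>r. r \<in> {s..s + h} \<Longrightarrow> n r = a * (r - s)"
    and 2: "\<And>r. r \<in> {s + h..s + 2 * h} \<Longrightarrow> n r = a * h + b * (r - (s + h))"
    and 3: "\<And>r. r \<in> {s + 2 * h..s + 3 * h} \<Longrightarrow> n r = (a + b) * h + c * (r - (s + 2 * h))"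
  defines "p \<equiv> a * h" and "q \<equiv> (a + b) * h" and "e \<equiv> (a + b + c) * h"
  shows "(n has_integral h * (2 * p + 2 * q + e) / 2) {s..s + 3 * h}"
    and "((\<lambda>r. (n r)\<^sup>2) has_integral h * (2 * p\<^sup>2 + p * q + 2 * q\<^sup>2 + q * e + e\<^sup>2) / 3) {s..s + 3 * h}"
proof -
  have I: "(f has_integral i1 + i2 + i3) {s..s + 3 * h}"
    if "(f has_integral i1) {s..s + h}" "(f has_integral i2) {s + h..s + 2 * h}" "(f has_integral i3) {s + 2 * h..s + 3 * h}"
    for f :: "real \<Rightarrow> real" and i1 i2 i3
    using has_integral_combine[OF _ _ has_integral_combine[OF _ _ that(1,2)] that(3)] h by simp
  have s: "s \<le> s + h" "s + h \<le> s + 2 * h" "s + 2 * h \<le> s + 3 * h" using h by auto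
  note A = has_integral_affine[OF s(1), of 0 a] has_integral_affine[OF s(2), of "a * h" b]
    has_integral_affine[OF s(3), of "(a + b) * h" c]
  have n1: "(n has_integral i) {s..s + h} \<longleftrightarrow> ((\<lambda>r. 0 + a * (r - s)) has_integral i) {s..s + h}"
    "((\<lambda>r. (n r)\<^sup>2) has_integral i) {s..s + h} \<longleftrightarrow> ((\<lambda>r. (0 + a * (r - s))\<^sup>2) has_integral i) {s..s + h}" for i
    using 1 by (intro has_integral_cong; simp)+
  have n2: "(n has_integral i) {s + h..s + 2 * h} \<longleftrightarrow> ((\<lambda>r. a * h + b * (r - (s + h))) has_integral i) {s + h..s + 2 * h}"
    "((\<lambda>r. (n r)\<^sup>2) has_integral i) {s + h..s + 2 * h} \<longleftrightarrow> ((\<lambda>r. (a * h + b * (r - (s + h)))\<^sup>2) has_integral i) {s + h..s + 2 * h}" for i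
    using 2 by (intro has_integral_cong; simp)+
  have n3: "(n has_integral i) {s + 2 * h..s + 3 * h} \<longleftrightarrow> ((\<lambda>r. (a + b) * h + c * (r - (s + 2 * h))) has_integral i) {s + 2 * h..s + 3 * h}"
    "((\<lambda>r. (n r)\<^sup>2) has_integral i) {s + 2 * h..s + 3 * h} \<longleftrightarrow> ((\<lambda>r. ((a + b) * h + c * (r - (s + 2 * h)))\<^sup>2) has_integral i) {s + 2 * h..s + 3 * h}" for i
    using 3 by (intro has_integral_cong; simp)+
  note J = I[OF n1(1)[THEN iffD2, OF A(1)] n2(1)[THEN iffD2, OF A(3)] n3(1)[THEN iffD2, OF A(5)]]
    I[OF n1(2)[THEN iffD2, OF A(2)] n2(2)[THEN iffD2, OF A(4)] n3(2)[THEN iffD2, OF A(6)]]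
  show "(n has_integral h * (2 * p + 2 * q + e) / 2) {s..s + 3 * h}"
    using J(1) by (rule back_subst[where P = "\<lambda>i. (n has_integral i) _"])
      (simp add: p_def q_def e_def algebra_simps add_divide_distrib)
  show "((\<lambda>r. (n r)\<^sup>2) has_integral h * (2 * p\<^sup>2 + p * q + 2 * q\<^sup>2 + q * e + e\<^sup>2) / 3) {s..s + 3 * h}"
    using J(2) by (rule back_subst[where P = "\<lambda>i. ((\<lambda>r. (n r)\<^sup>2) has_integral i) _"])
      (simp add: p_def q_def e_def power2_eq_square algebra_simps add_divide_distrib)
qed

section \<open>The coefficients of the path\<close>

text \<open>With denominators cleared, this is the condition that the squared path has integral
  \<open>J\<close>; the terms are the path values at the two inner nodes and at the end. The
  condition on the integral of the path fixes the sum of the inner values. Their difference is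
  parametrized by \<open>K\<close>, shifted so that no term linear in \<open>K\<close> survives, and
  22 and 135/88 are the numbers for which the rest cancels.\<close>

lemma cubature_identity:
  fixes J B K :: real
  assumes K: "K\<^sup>2 = 22 * ((2 * J - B)\<^sup>2 - 135 / 88 * B\<^sup>2)"
  shows "2 * (- K + B / 2 + 8 * J)\<^sup>2 + (- K + B / 2 + 8 * J) * (K + 5 / 2 * B + 4 * J)
      + 2 * (K + 5 / 2 * B + 4 * J)\<^sup>2 + (K + 5 / 2 * B + 4 * J) * (3 * (2 * (2 * J - B)))
      + (3 * (2 * (2 * J - B)))\<^sup>2 = 324 * (J * (2 * J - B))" (is "?L = _")
proof -
  have "?L = 3 * K\<^sup>2 + 384 * J\<^sup>2 - 60 * (B * J) + 141 / 4 * B\<^sup>2"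
    by (simp add: power2_eq_square algebra_simps)
  also have "\<dots> = 324 * (J * (2 * J - B))"
    unfolding K by (simp add: power2_eq_square algebra_simps)
  finally show ?thesis .
qed

text \<open>The bracket identity is an assumption here, so that what follows is algebra and
  elementary integration.\<close>

locale cubature_path =
  fixes V :: "real \<Rightarrow> real" and s t :: real
  assumes st: "s < t" and Vst: "V s < V t"
    and br: "br V s t = 2 * I10 V s t - (t - s) * (V t - V s)"
    and bound: "135 / 88 * (br V s t)\<^sup>2 \<le> (t - s)\<^sup>2 * (V t - V s)\<^sup>2"
begin

abbreviation "cpath \<equiv> \<lambda>r. omega V s t (phi s t r)"
abbreviation "A \<equiv> V t - V s"
abbreviation "a \<equiv> coeff_a V s t"
abbreviation "b \<equiv> coeff_b V s t"
abbreviation "c \<equiv> coeff_c V s t"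
abbreviation "K \<equiv> kappa V s t"
abbreviation "B \<equiv> br V s t"
abbreviation "J \<equiv> I10 V s t"

text \<open>The bracket bound enters here: it makes the radicand in \<open>kappa\<close>
  nonnegative.\<close>

lemma kappa_sq: "K\<^sup>2 = 22 * ((t - s)\<^sup>2 * A\<^sup>2 - 135 / 88 * B\<^sup>2)"
  using bound by (simp add: kappa_def power_mult_distrib)

lemma coeffs:
  obtains w where "w > 0" "a = - ((K - B / 2 - 8 * J) / (2 * w))" "b = (K + B - 2 * J) / w"
    "c = - ((K + 17 / 2 * B - 8 * J) / (2 * w))" "coeff_b0 V s t = - ((K + B / 2 - 4 * J) / (2 * w))"
    "coeff_c0 V s t = (K + 13 / 2 * B - 4 * J) / (2 * w)" "w = (t - s) * sqrt A"
  using st Vst by (intro that[of "(t - s) * sqrt A"])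
    (simp_all add: coeff_a_def coeff_b_def coeff_c_def coeff_b0_def coeff_c0_def mult.assoc)

text \<open>These values make the three affine pieces agree at 1/3 and 2/3, so the path is
  continuous.\<close>

lemma coeff_b0: "coeff_b0 V s t = (a - b) / 3"
  and coeff_c0: "coeff_c0 V s t = (a + b - 2 * c) / 3"
proof -
  obtain w where w: "w > 0" "a = - ((K - B / 2 - 8 * J) / (2 * w))" "b = (K + B - 2 * J) / w"
    "c = - ((K + 17 / 2 * B - 8 * J) / (2 * w))" "coeff_b0 V s t = - ((K + B / 2 - 4 * J) / (2 * w))"
    "coeff_c0 V s t = (K + 13 / 2 * B - 4 * J) / (2 * w)"
    by (rule coeffs)
  show "coeff_b0 V s t = (a - b) / 3" "coeff_c0 V s t = (a + b - 2 * c) / 3"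
    unfolding w(2-) using w(1) by (simp_all add: field_simps)
qed

lemma path_pieces:
  defines "h \<equiv> (t - s) / 3"
  shows "r \<in> {s..s + h} \<Longrightarrow> cpath r = a / (3 * h) * (r - s)"
    and "r \<in> {s + h..s + 2 * h} \<Longrightarrow> cpath r = a / (3 * h) * h + b / (3 * h) * (r - (s + h))"
    and "r \<in> {s + 2 * h..s + 3 * h} \<Longrightarrow>
      cpath r = (a / (3 * h) + b / (3 * h)) * h + c / (3 * h) * (r - (s + 2 * h))"
proof -
  have h: "h > 0" using st by (simp add: h_def)
  have h3: "3 * h = t - s" by (simp add: h_def)
  have phi: "phi s t r = (r - s) / (3 * h)" unfolding phi_def h3 ..
  have thirds: "(r - s) / (3 * h) \<le> 1 / 3 \<longleftrightarrow> r \<le> s + h" "(r - s) / (3 * h) \<le> 2 / 3 \<longleftrightarrow> r \<le> s + 2 * h"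
    using h by (auto simp: field_simps)
  show "r \<in> {s..s + h} \<Longrightarrow> cpath r = a / (3 * h) * (r - s)"
    unfolding omega_def phi thirds by simp
  show "r \<in> {s + h..s + 2 * h} \<Longrightarrow> cpath r = a / (3 * h) * h + b / (3 * h) * (r - (s + h))"
    using h unfolding omega_def phi thirds coeff_b0 by (auto simp: field_simps)
  show "r \<in> {s + 2 * h..s + 3 * h} \<Longrightarrow>
      cpath r = (a / (3 * h) + b / (3 * h)) * h + c / (3 * h) * (r - (s + 2 * h))"
    using h unfolding omega_def phi thirds coeff_b0 coeff_c0 by (auto simp: field_simps)
qed

lemma path_start: "cpath s = 0"
  by (simp add: omega_def phi_def)

text \<open>\<open>D\<close> clears the denominators. In the sum of the three slopes
  \<open>K\<close> cancels, and the bracket identity turns \<open>12 * J - 6 * B\<close> into a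
  multiple of \<open>A\<close>.\<close>

lemma slopes:
  defines "D \<equiv> 2 * (t - s) * sqrt A"
  shows "a * D = - K + B / 2 + 8 * J" "(a + b) * D = K + 5 / 2 * B + 4 * J" "a + b + c = 3 * sqrt A"
proof -
  define R where "R = sqrt A"
  have R: "R > 0" "A = R * R" using Vst by (auto simp: R_def)
  have ts: "t - s > 0" using st by simp
  obtain w where w: "w > 0" "a = - ((K - B / 2 - 8 * J) / (2 * w))" "b = (K + B - 2 * J) / w"
    "c = - ((K + 17 / 2 * B - 8 * J) / (2 * w))" "w = (t - s) * sqrt A"
    by (rule coeffs)
  have Dw: "D = 2 * w" by (simp add: D_def w(5))
  have D: "D = 2 * ((t - s) * sqrt A)" by (simp add: D_def)
  have abc: "a * D = - K + B / 2 + 8 * J" "b * D = 2 * K + 2 * B - 4 * J" "c * D = - K - 17 / 2 * B + 8 * J"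
    unfolding w(2-4) Dw using w(1) by (simp_all add: field_simps)
  then show "a * D = - K + B / 2 + 8 * J" "(a + b) * D = K + 5 / 2 * B + 4 * J"
    by (simp_all add: distrib_right)
  have "(a + b + c) * D = 12 * J - 6 * B" using abc by (simp add: distrib_right)
  also have "\<dots> = 3 * (2 * ((t - s) * A))" using br by simp
  also have "\<dots> = 3 * R * D" unfolding R(2) D using R(1) by simp
  finally have "(a + b + c) * D = 3 * R * D" .
  moreover have "D > 0" unfolding Dw using w(1) by simp
  ultimately show "a + b + c = 3 * sqrt A" by (simp add: R_def)
qed

lemma path_end: "cpath t = sqrt A"
proof -
  have "cpath t = (a + b + c) / 3"
  proof -
    define h where "h = (t - s) / 3"
    have h: "h > 0" "t = s + 3 * h" using st by (auto simp: h_def field_simps)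
    have "t \<in> {s + 2 * h..s + 3 * h}" using h by auto
    then have "cpath t = (a / (3 * h) + b / (3 * h)) * h + c / (3 * h) * (t - (s + 2 * h))"
      by (rule path_pieces(3)[folded h_def])
    also have "\<dots> = (a + b + c) / 3" using h by (simp add: field_simps)
    finally show ?thesis .
  qed
  then show ?thesis by (simp add: slopes(3))
qed

text \<open>With node values \<open>p\<close>, \<open>q\<close> and \<open>R = sqrt A\<close>, the
  first integral involves only \<open>p + q\<close>, where \<open>K\<close> cancels; the second
  rests on \<open>cubature_identity\<close>.\<close>

lemma path_integrals:
  "(cpath has_integral J / sqrt A) {s..t}" "((\<lambda>r. (cpath r)\<^sup>2) has_integral J) {s..t}"
proof -
  define h where "h = (t - s) / 3"
  have h: "h > 0" "h \<ge> 0" and h3: "s + 3 * h = t" using st by (auto simp: h_def field_simps)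
  define R where "R = sqrt A"
  have R: "R > 0" "A = R * R" using Vst by (auto simp: R_def)
  define D where "D = 2 * (t - s) * R"
  have D: "D > 0" using R st by (simp add: D_def)
  define p q where "p = a / 3" and "q = (a + b) / 3"
  have p: "3 * p * D = - K + B / 2 + 8 * J" and q: "3 * q * D = K + 5 / 2 * B + 4 * J"
  proof -
    have "3 * p = a" "3 * q = a + b" by (simp_all add: p_def q_def)
    then show "3 * p * D = - K + B / 2 + 8 * J" "3 * q * D = K + 5 / 2 * B + 4 * J"
      unfolding D_def R_def by (simp_all only: slopes)
  qed
  have e: "R * D = 2 * ((t - s) * A)" by (simp add: D_def R(2))
  have tA: "(t - s) * A = 2 * J - B" using br by simp
  have eq: "a / (3 * h) * h = p" "(a / (3 * h) + b / (3 * h)) * h = q"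
      "(a / (3 * h) + b / (3 * h) + c / (3 * h)) * h = R"
    using h slopes(3) by (simp_all add: p_def q_def R_def add_divide_distrib distrib_right)
  note I = piecewise_affine_integrals[OF h(2) path_pieces(1)[folded h_def] path_pieces(2)[folded h_def]
    path_pieces(3)[folded h_def], unfolded h3 eq]
  have "h * (2 * p + 2 * q + R) / 2 * D = (t - s) * J * 2"
  proof -
    have "3 * (2 * p + 2 * q + R) * D = 2 * (3 * p * D) + 2 * (3 * q * D) + 3 * (R * D)"
      by (simp add: algebra_simps)
    also have "\<dots> = 36 * J" unfolding p q e tA by simp
    finally have "3 * (2 * p + 2 * q + R) * D = 36 * J" .
    moreover have "h * (2 * p + 2 * q + R) / 2 * D = h / 6 * (3 * (2 * p + 2 * q + R) * D)" by simp
    ultimately show ?thesis by (simp add: h_def)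
  qed
  also have "(t - s) * J * 2 = J / R * D" using R(1) by (simp add: D_def)
  finally have "h * (2 * p + 2 * q + R) / 2 = J / R" using D by (subst (asm) mult_right_cancel) auto
  with I(1) show "(cpath has_integral J / sqrt A) {s..t}" by (simp add: R_def)
  \<comment> \<open>The factor is the square of \<open>3 * D\<close>, which turns the node values
    into polynomials in \<open>J\<close>, \<open>B\<close> and \<open>K\<close>.\<close>
  have "(2 * p\<^sup>2 + p * q + 2 * q\<^sup>2 + q * R + R\<^sup>2) * (9 * D\<^sup>2)
      = 2 * (3 * p * D)\<^sup>2 + (3 * p * D) * (3 * q * D) + 2 * (3 * q * D)\<^sup>2 + (3 * q * D) * (3 * (R * D)) + (3 * (R * D))\<^sup>2"
    by (simp add: power2_eq_square algebra_simps)
  also have "\<dots> = 324 * (J * (2 * J - B))"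
    unfolding p q e tA
    by (rule cubature_identity) (simp only: kappa_sq power_mult_distrib[symmetric] tA)
  also have "2 * J - B = (t - s) * A" by (rule tA[symmetric])
  finally have "(2 * p\<^sup>2 + p * q + 2 * q\<^sup>2 + q * R + R\<^sup>2) * (9 * D\<^sup>2) = 324 * (J * ((t - s) * A))" .
  moreover have "9 * D\<^sup>2 = (t - s) * (36 * ((t - s) * A))"
    unfolding D_def R(2) by (simp add: power2_eq_square algebra_simps)
  ultimately have "((2 * p\<^sup>2 + p * q + 2 * q\<^sup>2 + q * R + R\<^sup>2) * (t - s)) * (36 * ((t - s) * A)) = (9 * J) * (36 * ((t - s) * A))"
    by (simp only: mult.assoc)
  then have "(2 * p\<^sup>2 + p * q + 2 * q\<^sup>2 + q * R + R\<^sup>2) * (t - s) = 9 * J"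
    using st Vst by (subst (asm) mult_right_cancel) auto
  moreover have "h * (2 * p\<^sup>2 + p * q + 2 * q\<^sup>2 + q * R + R\<^sup>2) / 3
      = (2 * p\<^sup>2 + p * q + 2 * q\<^sup>2 + q * R + R\<^sup>2) * (t - s) / 9" by (simp add: h_def)
  ultimately have "h * (2 * p\<^sup>2 + p * q + 2 * q\<^sup>2 + q * R + R\<^sup>2) / 3 = J" by simp
  with I(2) show "((\<lambda>r. (cpath r)\<^sup>2) has_integral J) {s..t}" by simp
qed

lemma path_lipschitz: "\<exists>L. \<forall>u v. \<bar>cpath v - cpath u\<bar> \<le> L * \<bar>v - u\<bar>"
proof -
  \<comment> \<open>A sum of ramps, weighted with the jumps of the slope, spares a case distinction
    over the pieces containing the two points.\<close>
  have om: "omega V s t x = a * x + (b - a) * max 0 (x - 1 / 3) + (c - b) * max 0 (x - 2 / 3)" for x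
    by (auto simp: omega_def coeff_b0 coeff_c0 max_def field_simps)
  define L where "L = \<bar>a\<bar> + \<bar>b - a\<bar> + \<bar>c - b\<bar>"
  have omL: "\<bar>omega V s t y - omega V s t x\<bar> \<le> L * \<bar>y - x\<bar>" for x y
  proof -
    have m: "\<bar>max 0 (y - k) - max 0 (x - k)\<bar> \<le> \<bar>y - x\<bar>" for k :: real by (auto simp: max_def)
    have "omega V s t y - omega V s t x = a * (y - x) + (b - a) * (max 0 (y - 1 / 3) - max 0 (x - 1 / 3))
        + (c - b) * (max 0 (y - 2 / 3) - max 0 (x - 2 / 3))" unfolding om by (simp only: right_diff_distrib) simp
    also have "\<bar>\<dots>\<bar> \<le> \<bar>a\<bar> * \<bar>y - x\<bar> + \<bar>b - a\<bar> * \<bar>y - x\<bar> + \<bar>c - b\<bar> * \<bar>y - x\<bar>"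
      by (intro order_trans[OF abs_triangle_ineq] add_mono) (auto simp: abs_mult intro!: mult_left_mono m)
    finally show ?thesis by (simp add: L_def distrib_right)
  qed
  have "\<bar>cpath v - cpath u\<bar> \<le> L / (t - s) * \<bar>v - u\<bar>" for u v
  proof -
    have "phi s t v - phi s t u = (v - u) / (t - s)" by (simp add: phi_def diff_divide_distrib)
    then show ?thesis using omL[of "phi s t v" "phi s t u"] st by (simp add: abs_divide)
  qed
  then show ?thesis by blast
qed

end

section \<open>Expectation over the random path\<close>

text \<open>In a complete space, modification on a null set preserves measurability. Off the three
  prescribed events the random path is arbitrary, so measurability of its iterated integrals is
  obtained on the completion.\<close>

lemma (in complete_measure) measurable_AE_eq:
  assumes eq: "AE x in M. f x = g x" and f: "f \<in> measurable M N" and g: "\<And>x. x \<in> space M \<Longrightarrow> g x \<in> space N"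
  shows "g \<in> measurable M N"
proof (rule measurableI[OF g])
  fix A assume "A \<in> sets N"
  then have A: "f -` A \<inter> space M \<in> sets M" using f by (rule measurable_sets[rotated])
  show "g -` A \<inter> space M \<in> sets M"
  proof (rule in_sets_AE[OF _ A])
    show "AE x in M. x \<in> f -` A \<inter> space M \<longleftrightarrow> x \<in> g -` A \<inter> space M"
      using eq by eventually_elim auto
  qed auto
qed

context cubature_path
begin

text \<open>The weights are the moments of a variable with values \<open>sqrt 3\<close>,
  \<open>- sqrt 3\<close> and 0: they are 1, 1, 3 for \<open>k\<close> equal to 0, 2, 4, and 0 for
  odd \<open>k\<close>. For \<open>k = 0\<close> the zero path counts too, because
  \<open>0 ^ 0 = 1\<close>.\<close>

lemma jint_path:
  assumes \<alpha>: "\<alpha> \<in> words_upto 5" and J_eq: "J = integral {s..t} (\<lambda>r. V r - V s)"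
  defines "k \<equiv> length (filter (\<lambda>i. i \<noteq> 0) (rev \<alpha>))"
  shows "((sqrt 3) ^ k + (- sqrt 3) ^ k) / 6 * jint cpath s (rev \<alpha>) 0 t
      + 2 / 3 * (0 ^ k * jint cpath s (rev \<alpha>) 0 t) = moment_value V s t \<alpha>"
proof (cases "odd k")
  case True
  have "count_list \<alpha> 1 = k" 
  proof -
    have "set \<alpha> \<subseteq> {0, 1}" using \<alpha> by (simp add: words_upto_def)
    then have "length (filter (\<lambda>i. i \<noteq> 0) \<alpha>) = count_list \<alpha> 1" by (induction \<alpha>) auto
    then show ?thesis by (simp add: k_def rev_filter[symmetric])
  qed
  then show ?thesis using True by (auto simp: moment_value_def power_0_left)
next
  case False
  have s3: "sqrt 3 ^ 4 = (9::real)" using power_mult[of "sqrt 3" 2 2] by simp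
  have x2: "integral {s..t} (\<lambda>r. (cpath r)\<^sup>2) = J" "integral {s..t} cpath = J / sqrt A"
    "(\<lambda>r. (cpath r)\<^sup>2) integrable_on {s..t}" "cpath integrable_on {s..t}"
    using path_integrals by (auto intro: integral_unique)
  have A0: "sqrt A > 0" "sqrt A * sqrt A = A" "A \<noteq> 0" using Vst by auto
  \<comment> \<open>The word \<open>[1,0,1]\<close> must give 0; this is why the integral of the
    path has to be \<open>J / sqrt A\<close>.\<close>
  have int: "integral {s..t} (\<lambda>r. cpath r * (sqrt A - cpath r)) = 0"
  proof -
    have "integral {s..t} (\<lambda>r. sqrt A * cpath r - (cpath r)\<^sup>2) = sqrt A * (J / sqrt A) - J"
      using x2 integrable_on_mult_right[OF x2(4), of "sqrt A"] by (subst integral_diff) auto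
    then show ?thesis using A0 by (simp add: power2_eq_square algebra_simps)
  qed
  \<comment> \<open>Expanding the square shows that \<open>[0,1,1]\<close> imposes no new condition:
    both path integrals and the end value determine it.\<close>
  have int2: "integral {s..t} (\<lambda>r. (sqrt A - cpath r)\<^sup>2) = (t - s) * A - J"
  proof -
    have "(cpath has_integral J / sqrt A) {s..t}" "((\<lambda>r. (cpath r)\<^sup>2) has_integral J) {s..t}"
      by (rule path_integrals)+
    moreover have "((\<lambda>r. A) has_integral (t - s) * A) {s..t}"
      using has_integral_const_real[of A s t] st by simp
    ultimately have "((\<lambda>r. (A - (2 * sqrt A) * cpath r) + (cpath r)\<^sup>2) has_integral
        ((t - s) * A - (2 * sqrt A) * (J / sqrt A)) + J) {s..t}"
      by (intro has_integral_add has_integral_diff has_integral_mult_right)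
    then have "integral {s..t} (\<lambda>r. (A - (2 * sqrt A) * cpath r) + (cpath r)\<^sup>2) = ((t - s) * A - 2 * sqrt A * (J / sqrt A)) + J"
      by (simp add: integral_unique)
    also have "(\<lambda>r. (A - (2 * sqrt A) * cpath r) + (cpath r)\<^sup>2) = (\<lambda>r. (sqrt A - cpath r)\<^sup>2)"
      using A0 by (auto simp: power2_diff)
    finally show ?thesis using A0 by simp
  qed
  have tt: "integral {s..t} (\<lambda>r. if s \<le> r then r - s else 0) = (t - s)\<^sup>2 / 2"
    using integral_start_diff[of s t] st by (subst Henstock_Kurzweil_Integration.integral_cong[where g = "\<lambda>r. r - s"]) auto
  have "\<alpha> \<in> {[], [0], [0,0], [1,1], [1,1,1,1], [1,1,0], [1,0,1], [0,1,1]}"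
    using \<alpha> False unfolding words_upto_5 k_def by auto
  then consider "\<alpha> = []" | "\<alpha> = [0]" | "\<alpha> = [0,0]" | "\<alpha> = [1,1]" | "\<alpha> = [1,1,1,1]" | "\<alpha> = [1,1,0]"
    | "\<alpha> = [1,0,1]" | "\<alpha> = [0,1,1]" by blast
  then show ?thesis
  proof cases
    case 1 then show ?thesis by (simp add: moment_value_def k_def)
  next
    case 2 then show ?thesis using st by (simp add: moment_value_def k_def) (simp add: field_simps)
  next
    case 3 then show ?thesis using st tt by (simp add: moment_value_def k_def)
  next
    case 4 then show ?thesis using A0 Vst
      by (simp add: moment_value_def k_def path_start path_end numeral_2_eq_2[symmetric])
  next
    case 5
    have "sqrt A ^ 4 = A\<^sup>2" using A0(2) power_mult[of "sqrt A" 2 2] Vst by simp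
    moreover have "jint cpath s (rev \<alpha>) 0 t = sqrt A ^ 4 / fact 4"
      using 5 by (simp add: path_start path_end numeral_eq_Suc)
    moreover have "k = 4" using 5 by (simp add: k_def)
    moreover have "moment_value V s t \<alpha> = A\<^sup>2 / 8" using 5 by (simp add: moment_value_def)
    ultimately show ?thesis by (simp add: s3 fact_numeral)
  next
    case 6 then show ?thesis using x2 J_eq
      by (simp add: moment_value_def k_def path_start numeral_2_eq_2[symmetric])
  next
    case 7 then show ?thesis using int
      by (simp add: moment_value_def k_def path_start path_end numeral_2_eq_2[symmetric])
  next
    case 8 then show ?thesis using int2 J_eq
      by (simp add: moment_value_def k_def path_start path_end numeral_2_eq_2[symmetric])
  qed
qed

lemma iter_int_scaled_path:
  "iter_int (\<lambda>r. x * cpath r) \<alpha> s t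
    = x ^ length (filter (\<lambda>i. i \<noteq> 0) (rev \<alpha>)) * jint cpath s (rev \<alpha>) 0 t"
proof -
  obtain L where L: "\<And>u v. \<bar>cpath v - cpath u\<bar> \<le> L * \<bar>v - u\<bar>" using path_lipschitz by blast
  have "\<bar>x * cpath v - x * cpath u\<bar> \<le> (\<bar>x\<bar> * L) * \<bar>v - u\<bar>" for u v
    unfolding right_diff_distrib[symmetric] abs_mult mult.assoc using L by (intro mult_left_mono) auto
  then have "iter_int (\<lambda>r. x * cpath r) \<alpha> s t = jint (\<lambda>r. x * cpath r) s (rev \<alpha>) 0 t"
    using st by (intro iter_int_lipschitz) auto
  then show ?thesis by (simp add: jint_scale)
qed

text \<open>The three events are disjoint and of total probability 1, so the iterated integral is
  almost surely a combination of their indicators.\<close>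

lemma expectation_iter_int:
  assumes Q: "prob_space Q" and \<alpha>: "\<alpha> \<in> words_upto 5" and J_eq: "J = integral {s..t} (\<lambda>r. V r - V s)"
    and pos: "measure Q {y \<in> space Q. \<forall>r\<in>{s..t}. W y r = sqrt 3 * cpath r} = 1 / 6"
    and neg: "measure Q {y \<in> space Q. \<forall>r\<in>{s..t}. W y r = - sqrt 3 * cpath r} = 1 / 6"
    and zero: "measure Q {y \<in> space Q. \<forall>r\<in>{s..t}. W y r = 0} = 2 / 3"
  shows "integrable (completion Q) (\<lambda>y. iter_int (W y) \<alpha> s t) \<and>
    prob_space.expectation (completion Q) (\<lambda>y. iter_int (W y) \<alpha> s t) = moment_value V s t \<alpha>"
proof -
  interpret prob_space Q by fact
  define S where "S x = {y \<in> space Q. \<forall>r\<in>{s..t}. W y r = x * cpath r}" for x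
  have mS: "measure Q (S (sqrt 3)) = 1 / 6" "measure Q (S (- sqrt 3)) = 1 / 6" "measure Q (S 0) = 2 / 3"
    using pos neg zero by (simp_all add: S_def)
  \<comment> \<open>Non-measurable sets have measure 0 by convention, so positive probabilities
    already make the three sets events.\<close>
  have S[measurable]: "S (sqrt 3) \<in> events" "S (- sqrt 3) \<in> events" "S 0 \<in> events"
    using mS measure_notin_sets[of _ Q] by fastforce+
  have disj: "S x \<inter> S y = {}" if "x \<noteq> y" for x y
  proof -
    \<comment> \<open>Distinct multiples of the path differ at time \<open>t\<close>, since the path
      ends at \<open>sqrt A\<close>, which is positive.\<close>
    have "cpath t \<noteq> 0" using path_end Vst by simp
    then show ?thesis using that st by (force simp: S_def)
  qed
  define v where "v x = iter_int (\<lambda>r. x * cpath r) \<alpha> s t" for x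
  have v: "iter_int (W y) \<alpha> s t = v x" if "y \<in> S x" for x y
    unfolding v_def using that st by (intro iter_int_cong) (auto simp: S_def)
  define g where "g y = v (sqrt 3) * indicator (S (sqrt 3)) y + v (- sqrt 3) * indicator (S (- sqrt 3)) y
      + v 0 * indicator (S 0) y" for y
  have dis: "S (sqrt 3) \<inter> S (- sqrt 3) = {}" "(S (sqrt 3) \<union> S (- sqrt 3)) \<inter> S 0 = {}"
    using disj[of "sqrt 3" "- sqrt 3"] disj[of "sqrt 3" 0] disj[of "- sqrt 3" 0] by auto
  have "prob (S (sqrt 3) \<union> S (- sqrt 3) \<union> S 0) = 1"
    using dis mS by (simp add: finite_measure_Union)
  then have "AE y in Q. y \<in> S (sqrt 3) \<union> S (- sqrt 3) \<union> S 0"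
    by (intro AE_prob_1) 
  then have "AE y in Q. g y = iter_int (W y) \<alpha> s t"
  proof eventually_elim
    case (elim y)
    then show ?case using dis by (auto simp: g_def v indicator_def)
  qed
  then have AE: "AE y in completion Q. g y = iter_int (W y) \<alpha> s t" by (rule AE_completion)
  have g: "g \<in> borel_measurable Q" unfolding g_def by measurable
  have gc: "g \<in> borel_measurable (completion Q)" using g by (rule measurable_completion)
  have fc: "(\<lambda>y. iter_int (W y) \<alpha> s t) \<in> borel_measurable (completion Q)"
    using AE gc by (rule completion.measurable_AE_eq) simp
  have gi: "integrable Q g" unfolding g_def
    by (intro Bochner_Integration.integrable_add integrable_mult_right integrable_real_indicator S)
      (auto simp: emeasure_eq_measure)
  have "expectation g = (v (sqrt 3) + v (- sqrt 3)) / 6 + 2 / 3 * v 0"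
  proof -
    have ind: "integrable Q (indicator (S x) :: _ \<Rightarrow> real)" "expectation (indicator (S x)) = measure Q (S x)"
      if "S x \<in> events" for x
      using that by (auto intro!: integrable_real_indicator simp: emeasure_eq_measure)
    have "expectation g = v (sqrt 3) * measure Q (S (sqrt 3)) + v (- sqrt 3) * measure Q (S (- sqrt 3)) + v 0 * measure Q (S 0)"
      unfolding g_def using ind[OF S(1)] ind[OF S(2)] ind[OF S(3)] by simp
    then show ?thesis unfolding mS by (simp add: add_divide_distrib)
  qed
  also have "\<dots> = moment_value V s t \<alpha>"
    using jint_path[OF \<alpha> J_eq] unfolding v_def iter_int_scaled_path by (simp add: distrib_right add_divide_distrib)
  finally have Eg: "expectation g = moment_value V s t \<alpha>" .
  have "integrable (completion Q) (\<lambda>y. iter_int (W y) \<alpha> s t) \<longleftrightarrow> integrable (completion Q) g"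
    using AE by (intro integrable_cong_AE fc gc) auto
  moreover have "integral\<^sup>L (completion Q) (\<lambda>y. iter_int (W y) \<alpha> s t) = integral\<^sup>L (completion Q) g"
    using AE by (intro integral_cong_AE fc gc) auto
  ultimately show ?thesis using gi Eg integrable_completion[OF g] integral_completion[OF g] by simp
qed

end

section \<open>Equality of the two expectations\<close>

theorem lemma4p3:
  fixes P :: "'a measure" and F :: "real \<Rightarrow> 'a measure" and T :: real
    and M :: "real \<Rightarrow> 'a \<Rightarrow> real" and V :: "real \<Rightarrow> real"
    and Q :: "'b measure" and W :: "real \<Rightarrow> real \<Rightarrow> 'b \<Rightarrow> real \<Rightarrow> real"
  assumes T_pos: "0 < T"
    and P: "prob_space P"
    and mart: "martingale_upto P F T M"
    and cont: "continuous_process_upto P T M"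
    and gauss: "gaussian_process_upto P T M"
    and qv: "quadratic_variation_upto P T M (\<lambda>r x. V r)"
    and V_eq: "\<And>r. 0 \<le> r \<Longrightarrow> r \<le> T \<Longrightarrow> V r = prob_space.expectation P (\<lambda>x. (M r x)\<^sup>2)"
    and V_strict: "\<And>s t. 0 \<le> s \<Longrightarrow> s < t \<Longrightarrow> t \<le> T \<Longrightarrow> V s < V t"
    and bracket_bound: "\<And>s t. 0 \<le> s \<Longrightarrow> s < t \<Longrightarrow> t \<le> T \<Longrightarrow>
      135 / 88 * (bracket V (\<lambda>r. r) s t)\<^sup>2 \<le> (t - s)\<^sup>2 * (V t - V s)\<^sup>2"
    and Q: "prob_space Q"
    and W_pos: "\<And>s t. 0 \<le> s \<Longrightarrow> s < t \<Longrightarrow> t \<le> T \<Longrightarrow>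
      measure Q {y \<in> space Q. \<forall>r\<in>{s..t}. W s t y r = sqrt 3 * omega V s t (phi s t r)} = 1 / 6"
    and W_neg: "\<And>s t. 0 \<le> s \<Longrightarrow> s < t \<Longrightarrow> t \<le> T \<Longrightarrow>
      measure Q {y \<in> space Q. \<forall>r\<in>{s..t}. W s t y r = - sqrt 3 * omega V s t (phi s t r)} = 1 / 6"
    and W_zero: "\<And>s t. 0 \<le> s \<Longrightarrow> s < t \<Longrightarrow> t \<le> T \<Longrightarrow>
      measure Q {y \<in> space Q. \<forall>r\<in>{s..t}. W s t y r = 0} = 2 / 3"
  shows "\<forall>s t \<alpha>. 0 \<le> s \<and> s < t \<and> t \<le> T \<and> \<alpha> \<in> words_upto 5 \<longrightarrow>
    integrable (completion Q) (\<lambda>y. iter_int (W s t y) \<alpha> s t) \<and>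
    integrable P (iter_strat P M \<alpha> s t) \<and>
    prob_space.expectation (completion Q) (\<lambda>y. iter_int (W s t y) \<alpha> s t) =
    prob_space.expectation P (iter_strat P M \<alpha> s t)"
proof (intro allI impI)
  fix s t \<alpha>
  assume "0 \<le> s \<and> s < t \<and> t \<le> T \<and> \<alpha> \<in> words_upto 5"
  then have st: "0 \<le> s" "s < t" "t \<le> T" and \<alpha>: "\<alpha> \<in> words_upto 5" by auto
  interpret prob_space P by (rule P)
  \<comment> \<open>The quadratic variation is deterministic: the event does not depend on
    \<open>x\<close>, so it holds outright.\<close>
  have "AE x in P. continuous_on {0..T} V"
    using qv unfolding quadratic_variation_upto_def continuous_process_upto_def by blast
  then have "continuous_on {0..T} V" by simp
  then have V: "continuous_on {s..t} V" using st by (auto intro: continuous_on_subset)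
  have mono: "mono_on {s..t} V"
  proof (rule mono_onI)
    fix u v assume "u \<in> {s..t}" "v \<in> {s..t}" "u \<le> v"
    then show "V u \<le> V v" using V_strict[of u v] st by (cases "u = v") auto
  qed
  have J: "I10 V s t = integral {s..t} (\<lambda>r. V r - V s)"
    using I10_eq[OF V] st by simp
  interpret C: cubature_path V s t
    using st V_strict[OF st] br_eq[OF V _ mono] bracket_bound[OF st] by unfold_locales (auto simp: br_def)
  have Q_side: "integrable (completion Q) (\<lambda>y. iter_int (W s t y) \<alpha> s t) \<and>
      prob_space.expectation (completion Q) (\<lambda>y. iter_int (W s t y) \<alpha> s t) = moment_value V s t \<alpha>"
    by (rule C.expectation_iter_int[OF Q \<alpha> J W_pos[OF st] W_neg[OF st] W_zero[OF st]])
  obtain N where N: "gaussian_increments P N s t V" and MN: "\<And>r. r \<in> {s..t} \<Longrightarrow> AE x in P. M r x = N r x"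
    using gaussian_martingale_increments[OF P mart cont gauss V_eq st(1) less_imp_le[OF st(2)] st(3)] by blast
  interpret N: gaussian_increments P N s t V by (rule N)
  have "M r \<in> borel_measurable P" if "r \<in> {s..t}" for r
    using gauss that st unfolding gaussian_process_upto_def by auto
  then have strat: "iter_strat P M \<alpha> s t \<in> borel_measurable P"
    "AE x in P. iter_strat P M \<alpha> s t x = jint (\<lambda>r. N r x) s (rev \<alpha>) 0 t"
    using N.iter_strat_rev_AE[OF _ MN, of t "rev \<alpha>"] st by (auto simp: iter_strat_def)
  have jm: "(\<lambda>x. jint (\<lambda>r. N r x) s (rev \<alpha>) 0 t) \<in> borel_measurable P"
    using N.jint_measurable st by auto
  have "integrable P (iter_strat P M \<alpha> s t) \<and> expectation (iter_strat P M \<alpha> s t) = moment_value V s t \<alpha>"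
    using N.expectation_jint[OF V \<alpha>] integrable_cong_AE[OF strat(1) jm strat(2)] integral_cong_AE[OF strat(1) jm strat(2)]
    by simp
  with Q_side show "integrable (completion Q) (\<lambda>y. iter_int (W s t y) \<alpha> s t) \<and>
    integrable P (iter_strat P M \<alpha> s t) \<and>
    prob_space.expectation (completion Q) (\<lambda>y. iter_int (W s t y) \<alpha> s t) =
    prob_space.expectation P (iter_strat P M \<alpha> s t)"
    by simp
qed

end
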